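(* Let $M$ be a locally tame $d$-manifold. Then, for every integer $\ell$ with $1\leq\ell\leq\frac{d-1}{2}$, $$\sum_{i=0}^{\ell}(-1)^{\ell-i}\mu_i(M)\;\leq\;(-1)^{\ell}+\frac{g_{\ell+1}(M)}{\binom{d+2}{\ell+1}}.$$ Equality holds here if and only if $M$ is locally $\ell$-stacked.
   Context: All simplicial complexes are finite and abstract, and the empty set is a face (of dimension $-1$) of every simplicial complex. A field $\mathbb{F}$ is fixed and all homology is simplicial homology with coefficients in $\mathbb{F}$. $V(X)$ is the vertex set of $X$; for any set $A$, $X[A]=\{\alpha\in X:\alpha\subseteq A\}$. For $x\in V(X)$, $\mathrm{lk}(x,X)=\{\alpha: x\notin\alpha,\ \alpha\sqcup\{x\}\in X\}$. Bistellar moves. For a non-empty finite set $\alpha$, $\overline{\alpha}$ (resp. $\partial\alpha$) is the simplicial complex whose faces are all subsets (resp. all proper subsets) of $\alpha$. $X_1*X_2$ (join) has as faces the disjoint unions of a face of $X_1$ with a face of $X_2$. Let $\alpha,\beta$ be disjoint non-empty finite sets with $\#(\alpha)+\#(\beta)=d+2$ and let $X$ be a $d$-dimensional simplicial complex. $X$ admits the bistellar move $\alpha\mapsto\beta$ if $X[\alpha\cup\beta]=\overline{\alpha}*\partial\beta$; the result of the move is $Y=(X\setminus(\overline{\alpha}*\partial\beta))\cup(\overline{\beta}*\partial\alpha)$. The index of the move is $t=\#(\beta)-1$. (When $t=0$, $\beta$ consists of a new vertex not in $V(X)$; when $t=d$, the unique vertex in $\alpha$ is deleted.) Tameness. $S^d_{d+2}$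 denotes the standard $d$-sphere $\partial\alpha$ with $\#(\alpha)=d+2$. A tame $d$-sphere is a $d$-dimensional simplicial complex obtainable from $S^d_{d+2}$ by a finite sequence of bistellar moves, each of index $<d/2$. A locally tame $d$-manifold is a $d$-dimensional simplicial complex all of whose vertex links are tame $(d-1)$-spheres. $g$-vector. For a $d$-dimensional complex $X$, $f_i(X)$ is the number of $i$-dimensional faces ($-1\le i\le d$), and $g_j(X)=\sum_{i=-1}^{j-1}(-1)^{j-i-1}\binom{d-i+1}{j-i-1}f_i(X)$ for $0\le j\le d+1$. Sigma- and mu-vectors. $\beta_i(X)=\dim_{\mathbb F}H_i(X)$ (unreduced). Reduced Betti numbers: $\tilde\beta_0(X)=\beta_0(X)-1$ (so $\tilde\beta_0(\{\emptyset\})=-1$) and $\tilde\beta_i(X)=\beta_i(X)$ for $i\ge1$. Put $\sigma_i(X)=\sum_{A\subseteq V(X)}\tilde\beta_i(X[A])\big/\binom{f_0(X)}{\#(A)}$ for $i\ge 0$ (the sum includes $A=\emptyset$). The mu-vector $(\mu_0,\dots,\mu_d)$ of a $d$-dimensional simplicial complex $X$ is $$\mu_0(X)=\sum_{x\in V(X)}\frac{1}{1+f_0(\mathrm{lk}(x,X))},\qquad \mu_i(X)=\sum_{x\in V(X)}\frac{\delta_{i1}+\sigma_{i-1}(\mathrm{lk}(x,X))}{1+f_0(\mathrm{lk}(x,X))}\quad(1\le i\le d),$$ where $\delta_{ij}$ is the Kronecker symbol. Homology manifolds (over $\mathbb{F}$). A homology $d$-manifold is a pure $d$-dimensional simplicial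 complex $\Delta$ in which the link of each non-empty face $\alpha$ has the $\mathbb{F}$-homology either of a sphere of dimension $d-\#(\alpha)$ (where $\{\emptyset\}$ counts as the $(-1)$-sphere) or of a point; its boundary $\partial\Delta$ consists of $\emptyset$ and the faces whose links have the homology of a point. It is closed if $\partial\Delta=\{\emptyset\}$; otherwise $\partial\Delta$ is required to be a closed homology $(d-1)$-manifold. A homology $d$-sphere is a closed homology $d$-manifold with the $\mathbb{F}$-homology of the $d$-sphere. A homology $d$-ball is a homology $d$-manifold with the $\mathbb{F}$-homology of a point whose boundary is a homology $(d-1)$-sphere. Stackedness. $\mathrm{Skel}_k(X)$ is the subcomplex of faces of $X$ of dimension $\le k$. A homology $d$-sphere $S$ is $k$-stacked ($0\le k\le d$) if there is a homology $(d+1)$-ball $\Delta$ with $\partial\Delta=S$ and $\mathrm{Skel}_{d-k}(\Delta)=\mathrm{Skel}_{d-k}(S)$. A homology manifold is locally $\ell$-stacked if all its vertex links are $\ell$-stacked homology spheres. *)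

theory Defs
  imports Complex_Main
    "HOL-Library.Function_Algebras"
    "HOL-Library.Set_Algebras"
    "Jordan_Normal_Form.VS_Connect"
begin

section \<open>Finite abstract simplicial complexes\<close>

text \<open>The empty set is a face of every complex. Dimensions are integers, as \<open>{{}}\<close> has
  dimension \<open>-1\<close>.\<close>

definition scomplex :: "'a set set \<Rightarrow> bool" where
  "scomplex X \<longleftrightarrow> finite X \<and> {} \<in> X \<and> (\<forall>\<alpha>\<in>X. finite \<alpha> \<and> (\<forall>\<beta>. \<beta> \<subseteq> \<alpha> \<longrightarrow> \<beta> \<in> X))"

definition face_dim :: "'a set \<Rightarrow> int" where
  "face_dim \<alpha> = int (card \<alpha>) - 1"

definition cdim :: "'a set set \<Rightarrow> int" where
  "cdim X = Max (face_dim ` X)"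

definition verts :: "'a set set \<Rightarrow> 'a set" where
  "verts X = \<Union>X"

definition induced :: "'a set set \<Rightarrow> 'a set \<Rightarrow> 'a set set" where
  "induced X A = {\<alpha> \<in> X. \<alpha> \<subseteq> A}"

text \<open>The link of a face; the link of a vertex \<open>x\<close> is \<open>link {x} X\<close>.\<close>

definition link :: "'a set \<Rightarrow> 'a set set \<Rightarrow> 'a set set" where
  "link \<alpha> X = {\<beta>. \<alpha> \<inter> \<beta> = {} \<and> \<alpha> \<union> \<beta> \<in> X}"

definition skel :: "int \<Rightarrow> 'a set set \<Rightarrow> 'a set set" where
  "skel k X = {\<alpha> \<in> X. face_dim \<alpha> \<le> k}"

definition face_number :: "int \<Rightarrow> 'a set set \<Rightarrow> nat" where
  "face_number i X = card {\<alpha> \<in> X. face_dim \<alpha> = i}"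

definition g_number :: "nat \<Rightarrow> 'a set set \<Rightarrow> int" where
  "g_number j X = (\<Sum>i = -1..int j - 1. (-1) ^ nat (int j - i - 1)
      * int (nat (cdim X - i + 1) choose nat (int j - i - 1)) * int (face_number i X))"


section \<open>Bistellar moves and tameness\<close>

definition full_simplex :: "'a set \<Rightarrow> 'a set set" where
  "full_simplex \<alpha> = {\<gamma>. \<gamma> \<subseteq> \<alpha>}"

definition simplex_bd :: "'a set \<Rightarrow> 'a set set" where
  "simplex_bd \<alpha> = {\<gamma>. \<gamma> \<subset> \<alpha>}"

definition cjoin :: "'a set set \<Rightarrow> 'a set set \<Rightarrow> 'a set set" where
  "cjoin X Y = {\<alpha> \<union> \<beta> | \<alpha> \<beta>. \<alpha> \<in> X \<and> \<beta> \<in> Y \<and> \<alpha> \<inter> \<beta> = {}}"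

definition admits_move :: "int \<Rightarrow> 'a set set \<Rightarrow> 'a set \<Rightarrow> 'a set \<Rightarrow> bool" where
  "admits_move d X \<alpha> \<beta> \<longleftrightarrow>
     finite \<alpha> \<and> finite \<beta> \<and> \<alpha> \<noteq> {} \<and> \<beta> \<noteq> {} \<and> \<alpha> \<inter> \<beta> = {} \<and>
     int (card \<alpha>) + int (card \<beta>) = d + 2 \<and>
     scomplex X \<and> cdim X = d \<and>
     induced X (\<alpha> \<union> \<beta>) = cjoin (full_simplex \<alpha>) (simplex_bd \<beta>)"

definition bistellar_move :: "'a set set \<Rightarrow> 'a set \<Rightarrow> 'a set \<Rightarrow> 'a set set" where
  "bistellar_move X \<alpha> \<beta> =
     (X - cjoin (full_simplex \<alpha>) (simplex_bd \<beta>)) \<union> cjoin (full_simplex \<beta>) (simplex_bd \<alpha>)"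

definition move_index :: "'a set \<Rightarrow> int" where
  "move_index \<beta> = int (card \<beta>) - 1"

text \<open>Moves of index \<open>< d/2\<close> never delete a vertex, so all intermediate complexes live on
  vertices of the final one and the ambient type \<open>'a\<close> need not be infinite.\<close>

inductive tame_sphere :: "int \<Rightarrow> 'a set set \<Rightarrow> bool" for d :: int where
  standard: "finite \<alpha> \<Longrightarrow> \<alpha> \<noteq> {} \<Longrightarrow> int (card \<alpha>) = d + 2 \<Longrightarrow> tame_sphere d (simplex_bd \<alpha>)"
| move: "tame_sphere d X \<Longrightarrow> admits_move d X \<alpha> \<beta> \<Longrightarrow>
     real_of_int (move_index \<beta>) < real_of_int d / 2 \<Longrightarrow> tame_sphere d (bistellar_move X \<alpha> \<beta>)"

definition locally_tame_manifold :: "int \<Rightarrow> 'a set set \<Rightarrow> bool" where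
  "locally_tame_manifold d M \<longleftrightarrow>
     scomplex M \<and> cdim M = d \<and> (\<forall>x\<in>verts M. tame_sphere (d - 1) (link {x} M))"


section \<open>Simplicial homology over a field\<close>

text \<open>Chains are functions on faces; a linear order on the vertices fixes the orientations.
  The field is the type \<open>'f\<close>, passed as an argument \<open>TYPE('f)\<close> where it does not
  occur otherwise.\<close>

definition chains :: "nat \<Rightarrow> 'a set set \<Rightarrow> ('a set \<Rightarrow> 'f::field) set" where
  "chains i X = {c. \<forall>\<sigma>. c \<sigma> \<noteq> 0 \<longrightarrow> \<sigma> \<in> X \<and> face_dim \<sigma> = int i}"

text \<open>The coefficient at \<open>\<tau>\<close> of the usual boundary
  \<open>\<partial>[v\<^sub>0, ..., v\<^sub>i] = (\<Sum>j. (-1)^j [v\<^sub>0, ..., (omit v\<^sub>j), ..., v\<^sub>i])\<close>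
  where \<open>v\<^sub>0 < ... < v\<^sub>i\<close>. The coefficient at the empty face is put to \<open>0\<close>,
  so the resulting homology is unreduced.\<close>

definition chain_bd ::
  "'a::linorder set set \<Rightarrow> ('a set \<Rightarrow> 'f::field) \<Rightarrow> ('a set \<Rightarrow> 'f)" where
  "chain_bd X c = (\<lambda>\<tau>. if \<tau> = {} then 0
     else \<Sum>v \<in> verts X - \<tau>. (-1) ^ card {w \<in> \<tau>. w < v} * c (insert v \<tau>))"

definition cycles :: "nat \<Rightarrow> 'a::linorder set set \<Rightarrow> ('a set \<Rightarrow> 'f::field) set" where
  "cycles i X = {c \<in> chains i X. chain_bd X c = 0}"

definition boundaries :: "nat \<Rightarrow> 'a::linorder set set \<Rightarrow> ('a set \<Rightarrow> 'f::field) set" where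
  "boundaries i X = chain_bd X ` chains (Suc i) X"

definition chain_scale :: "'f::field \<Rightarrow> ('a set \<Rightarrow> 'f) \<Rightarrow> ('a set \<Rightarrow> 'f)" where
  "chain_scale t c = (\<lambda>\<sigma>. t * c \<sigma>)"

text \<open>The quotient \<open>Z / B\<close>, its elements being the cosets \<open>z +o B\<close>. In the scalar
  multiplication \<open>B\<close> is added so that \<open>0\<close> times a coset is \<open>B\<close> itself. The ring
  operations \<open>mult\<close> and \<open>one\<close>, which the record type of modules inherits, are not used.\<close>

definition quotient_space ::
  "('a set \<Rightarrow> 'f::field) set \<Rightarrow> ('a set \<Rightarrow> 'f) set \<Rightarrow> ('f, ('a set \<Rightarrow> 'f) set) module" where
  "quotient_space Z B = \<lparr>carrier = (\<lambda>z. z +o B) ` Z, mult = undefined, one = undefined,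
     zero = B, add = (\<lambda>P Q. P + Q), smult = (\<lambda>t P. chain_scale t ` P + B)\<rparr>"

definition homology ::
  "nat \<Rightarrow> 'a::linorder set set \<Rightarrow> ('f::field, ('a set \<Rightarrow> 'f) set) module" where
  "homology i X = quotient_space (cycles i X) (boundaries i X)"

text \<open>The record \<open>homology i X\<close> is indeed a vector space, so that \<open>vectorspace.dim\<close> is meaningful.\<close>

definition chain_subspace :: "('a set \<Rightarrow> 'f::field) set \<Rightarrow> bool" where
  "chain_subspace S \<longleftrightarrow> 0 \<in> S \<and> (\<forall>x\<in>S. \<forall>y\<in>S. x + y \<in> S) \<and> (\<forall>t. \<forall>x\<in>S. chain_scale t x \<in> S)"

lemma chain_subspace_plus:
  assumes "chain_subspace (S :: ('a set \<Rightarrow> 'f::field) set)" shows "S + S = S"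
proof
  show "S + S \<subseteq> S" using assms by (auto simp: chain_subspace_def set_plus_def)
  show "S \<subseteq> S + S"
  proof
    fix x assume "x \<in> S"
    moreover have "0 \<in> S" using assms by (simp add: chain_subspace_def)
    ultimately have "x + 0 \<in> S + S" by (rule set_plus_intro)
    thus "x \<in> S + S" by simp
  qed
qed

lemma coset_plus:
  assumes "chain_subspace (B :: ('a set \<Rightarrow> 'f::field) set)"
  shows "(z +o B) + (w +o B) = (z + w) +o B"
  by (simp add: set_plus_rearrange chain_subspace_plus[OF assms])

lemma coset_scale:
  assumes B: "chain_subspace (B :: ('a set \<Rightarrow> 'f::field) set)"
  shows "chain_scale t ` (z +o B) + B = chain_scale t z +o B"
proof
  have dist: "chain_scale t (x + y) = chain_scale t x + chain_scale t y" for x y :: "'a set \<Rightarrow> 'f"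
    by (auto simp: chain_scale_def fun_eq_iff algebra_simps)
  show "chain_scale t ` (z +o B) + B \<subseteq> chain_scale t z +o B"
  proof
    fix x assume "x \<in> chain_scale t ` (z +o B) + B"
    then obtain b c where "b \<in> B" "c \<in> B" "x = chain_scale t (z + b) + c"
      by (auto simp: set_plus_def elt_set_plus_def)
    hence "x = chain_scale t z + (chain_scale t b + c)" by (simp add: dist add.assoc)
    moreover have "chain_scale t b + c \<in> B" using B \<open>b \<in> B\<close> \<open>c \<in> B\<close>
      by (auto simp: chain_subspace_def)
    ultimately show "x \<in> chain_scale t z +o B" by (auto simp: elt_set_plus_def)
  qed
  show "chain_scale t z +o B \<subseteq> chain_scale t ` (z +o B) + B"
  proof
    fix x assume "x \<in> chain_scale t z +o B"
    then obtain b where b: "b \<in> B" "x = chain_scale t (z + 0) + b" by (auto simp: elt_set_plus_def)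
    have "0 \<in> B" using B by (simp add: chain_subspace_def)
    hence "z + 0 \<in> z +o B" by (rule set_plus_intro2)
    thus "x \<in> chain_scale t ` (z +o B) + B" unfolding b(2) using b(1) by blast
  qed
qed

lemma vectorspace_quotient_space:
  assumes Z: "chain_subspace (Z :: ('a set \<Rightarrow> 'f::field) set)" and B: "chain_subspace B"
  shows "vectorspace class_ring (quotient_space Z B)"
proof -
  let ?Q = "quotient_space Z B"
  have zero: "B = 0 +o B" by (auto simp: elt_set_plus_def)
  have neg: "\<exists>w\<in>Z. w + z = 0" if "z \<in> Z" for z
  proof (rule bexI)
    show "chain_scale (-1) z + z = 0" by (auto simp: chain_scale_def fun_eq_iff)
    show "chain_scale (-1) z \<in> Z" using that Z by (auto simp: chain_subspace_def)
  qed
  have "abelian_group ?Q"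
  proof (rule abelian_groupI)
    fix x assume "x \<in> carrier ?Q"
    then obtain z where z: "z \<in> Z" "x = z +o B" by (auto simp: quotient_space_def)
    obtain w where w: "w \<in> Z" "w + z = 0" using neg[OF z(1)] by auto
    show "\<exists>y\<in>carrier ?Q. y \<oplus>\<^bsub>?Q\<^esub> x = \<zero>\<^bsub>?Q\<^esub>"
      by (rule bexI[of _ "w +o B"])
         (use w z in \<open>auto simp: quotient_space_def coset_plus[OF B] zero[symmetric]\<close>)
    show "\<zero>\<^bsub>?Q\<^esub> \<oplus>\<^bsub>?Q\<^esub> x = x"
      using coset_plus[OF B, of 0 z] zero z by (simp add: quotient_space_def)
  next
    show "\<zero>\<^bsub>?Q\<^esub> \<in> carrier ?Q"
      using Z zero by (auto simp: quotient_space_def chain_subspace_def intro: image_eqI[of _ _ 0])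
  qed (use Z in \<open>auto simp: quotient_space_def coset_plus[OF B] chain_subspace_def add_ac\<close>)
  moreover have "cring (class_ring :: 'f ring)" ..
  ultimately have "Module.module class_ring ?Q"
  proof (intro Module.module.intro Module.module_axioms.intro)
  qed (use Z in \<open>auto simp: quotient_space_def coset_plus[OF B] coset_scale[OF B]
         chain_subspace_def, auto simp: chain_scale_def fun_eq_iff algebra_simps plus_fun_def\<close>)
  thus ?thesis unfolding vectorspace_def using class_field by auto
qed

lemma chain_subspace_chains: "chain_subspace (chains i X)"
  unfolding chain_subspace_def chains_def
  by (auto simp: chain_scale_def) (metis add.right_neutral)+

lemma chain_bd_add: "chain_bd X (c + c') = chain_bd X c + chain_bd X c'"
  by (auto simp: chain_bd_def fun_eq_iff algebra_simps sum.distrib)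

lemma chain_bd_scale: "chain_bd X (chain_scale t c) = chain_scale t (chain_bd X c)"
  by (auto simp: chain_bd_def chain_scale_def fun_eq_iff sum_distrib_left algebra_simps)

lemma chain_bd_zero: "chain_bd X 0 = 0"
  by (auto simp: chain_bd_def fun_eq_iff)

lemma chain_scale_zero: "chain_scale t 0 = 0"
  by (auto simp: chain_scale_def fun_eq_iff)

lemma chain_subspace_cycles: "chain_subspace (cycles i X)"
  using chain_subspace_chains[of i X] unfolding chain_subspace_def cycles_def
  by (auto simp: chain_bd_add chain_bd_scale chain_bd_zero chain_scale_zero)

lemma chain_subspace_boundaries: "chain_subspace (boundaries i X :: ('a::linorder set \<Rightarrow> 'b::field) set)"
proof -
  have S: "chain_subspace (chains (Suc i) X :: ('a set \<Rightarrow> 'b) set)" by (rule chain_subspace_chains)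
  hence "chain_bd X (0 :: 'a set \<Rightarrow> 'b) \<in> boundaries i X" unfolding boundaries_def chain_subspace_def by blast
  moreover have "chain_bd X c + chain_bd X c' \<in> boundaries i X"
    if "c \<in> chains (Suc i) X" "c' \<in> chains (Suc i) X" for c c' :: "'a set \<Rightarrow> 'b"
    using S that unfolding boundaries_def chain_subspace_def chain_bd_add[symmetric] by blast
  moreover have "chain_scale t (chain_bd X c) \<in> boundaries i X"
    if "c \<in> chains (Suc i) X" for t and c :: "'a set \<Rightarrow> 'b"
    using S that unfolding boundaries_def chain_subspace_def chain_bd_scale[symmetric] by blast
  ultimately show ?thesis by (auto simp: chain_subspace_def boundaries_def chain_bd_zero)
qed

lemma vectorspace_homology:
  "vectorspace class_ring (homology i X :: ('f::field, ('a::linorder set \<Rightarrow> 'f) set) module)"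
  unfolding homology_def
  by (rule vectorspace_quotient_space) (rule chain_subspace_cycles chain_subspace_boundaries)+

definition betti :: "'f::field itself \<Rightarrow> nat \<Rightarrow> 'a::linorder set set \<Rightarrow> nat" where
  "betti F i X =
     vectorspace.dim class_ring (homology i X :: ('f, ('a set \<Rightarrow> 'f) set) module)"

definition red_betti :: "'f::field itself \<Rightarrow> nat \<Rightarrow> 'a::linorder set set \<Rightarrow> int" where
  "red_betti F i X = int (betti F i X) - (if i = 0 then 1 else 0)"


section \<open>Sigma- and mu-vectors\<close>

definition sigma_number :: "'f::field itself \<Rightarrow> nat \<Rightarrow> 'a::linorder set set \<Rightarrow> real" where
  "sigma_number F i X = (\<Sum>A\<in>Pow (verts X).
     real_of_int (red_betti F i (induced X A)) / real (face_number 0 X choose card A))"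

definition mu_number :: "'f::field itself \<Rightarrow> nat \<Rightarrow> 'a::linorder set set \<Rightarrow> real" where
  "mu_number F i X =
     (if i = 0 then \<Sum>x\<in>verts X. 1 / (1 + real (face_number 0 (link {x} X)))
      else \<Sum>x\<in>verts X. ((if i = 1 then 1 else 0) + sigma_number F (i - 1) (link {x} X))
             / (1 + real (face_number 0 (link {x} X))))"


section \<open>Homology manifolds and stackedness\<close>

definition pure :: "'a set set \<Rightarrow> bool" where
  "pure X \<longleftrightarrow> (\<forall>\<alpha>\<in>X. \<exists>\<beta>\<in>X. \<alpha> \<subseteq> \<beta> \<and> face_dim \<beta> = cdim X)"

text \<open>Betti numbers of the \<open>k\<close>-sphere for \<open>k \<ge> -1\<close>: the two summands add up to \<open>2\<close> for
  \<open>i = k = 0\<close>, and the \<open>(-1)\<close>-sphere \<open>{{}}\<close> has no unreduced homology.\<close>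

definition homology_of_sphere :: "'f::field itself \<Rightarrow> int \<Rightarrow> 'a::linorder set set \<Rightarrow> bool" where
  "homology_of_sphere F k X \<longleftrightarrow> (\<forall>i. betti F i X =
     (if i = 0 \<and> k \<ge> 0 then 1 else 0) + (if int i = k then 1 else 0))"

definition homology_of_point :: "'f::field itself \<Rightarrow> 'a::linorder set set \<Rightarrow> bool" where
  "homology_of_point F X \<longleftrightarrow> (\<forall>i. betti F i X = (if i = 0 then 1 else 0))"

definition mfd_boundary :: "'f::field itself \<Rightarrow> 'a::linorder set set \<Rightarrow> 'a set set" where
  "mfd_boundary F X = insert {} {\<alpha> \<in> X. \<alpha> \<noteq> {} \<and> homology_of_point F (link \<alpha> X)}"

text \<open>The condition on links alone. What a homology manifold satisfies in addition is
  a condition on its boundary, which only refers to closed manifolds, so there is no recursion.\<close>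

definition homology_mfd_links :: "'f::field itself \<Rightarrow> int \<Rightarrow> 'a::linorder set set \<Rightarrow> bool" where
  "homology_mfd_links F d X \<longleftrightarrow> scomplex X \<and> cdim X = d \<and> pure X \<and>
     (\<forall>\<alpha>\<in>X. \<alpha> \<noteq> {} \<longrightarrow>
        homology_of_sphere F (d - int (card \<alpha>)) (link \<alpha> X) \<or> homology_of_point F (link \<alpha> X))"

definition closed_homology_manifold ::
  "'f::field itself \<Rightarrow> int \<Rightarrow> 'a::linorder set set \<Rightarrow> bool" where
  "closed_homology_manifold F d X \<longleftrightarrow> homology_mfd_links F d X \<and> mfd_boundary F X = {{}}"

definition homology_manifold :: "'f::field itself \<Rightarrow> int \<Rightarrow> 'a::linorder set set \<Rightarrow> bool" where
  "homology_manifold F d X \<longleftrightarrow> homology_mfd_links F d X \<and>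
     (mfd_boundary F X = {{}} \<or> closed_homology_manifold F (d - 1) (mfd_boundary F X))"

definition homology_sphere :: "'f::field itself \<Rightarrow> int \<Rightarrow> 'a::linorder set set \<Rightarrow> bool" where
  "homology_sphere F d X \<longleftrightarrow> closed_homology_manifold F d X \<and> homology_of_sphere F d X"

definition homology_ball :: "'f::field itself \<Rightarrow> int \<Rightarrow> 'a::linorder set set \<Rightarrow> bool" where
  "homology_ball F d X \<longleftrightarrow> homology_manifold F d X \<and> homology_of_point F X \<and>
     homology_sphere F (d - 1) (mfd_boundary F X)"

text \<open>Since \<open>d - k \<ge> 0\<close>, the ball has the same vertices as the sphere, so it is no loss
  to ask for a ball over the same vertex type.\<close>

definition stacked_sphere ::
  "'f::field itself \<Rightarrow> int \<Rightarrow> nat \<Rightarrow> 'a::linorder set set \<Rightarrow> bool" where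
  "stacked_sphere F d k S \<longleftrightarrow> homology_sphere F d S \<and> int k \<le> d \<and>
     (\<exists>\<Delta>. homology_ball F (d + 1) \<Delta> \<and> mfd_boundary F \<Delta> = S \<and>
          skel (d - int k) \<Delta> = skel (d - int k) S)"

definition locally_stacked :: "'f::field itself \<Rightarrow> nat \<Rightarrow> 'a::linorder set set \<Rightarrow> bool" where
  "locally_stacked F l X \<longleftrightarrow> homology_manifold F (cdim X) X \<and>
     (\<forall>x\<in>verts X. stacked_sphere F (cdim X - 1) l (link {x} X))"

end

theory Submission
  imports Defs
begin

text \<open>
  Fix a vertex link \<open>S\<close> of \<open>M\<close>, a tame sphere of dimension \<open>n = d - 1 \<ge> 2 * l\<close>. Since the terms of
  \<open>\<mu>\<^sub>0\<close> and the Kronecker terms of \<open>\<mu>\<^sub>1\<close> cancel, the contribution of \<open>S\<close> to the left-hand side is a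
  weighted sum \<open>weighted_morse\<close>, over all sets \<open>A\<close> of vertices, of the alternating sum of the reduced
  Betti numbers below dimension \<open>l\<close> of the induced subcomplexes \<open>S[A]\<close>. The weights are Beta integrals.
  On the other side, the g-numbers of \<open>M\<close> are determined by those of the links, and the right-hand side
  becomes the sum over all links of \<open>g_bound\<close>, a linear combination of \<open>g\<^sub>0(S), ..., g\<^sub>l(S)\<close>
  (\<open>sum_g_bound_links\<close>). It therefore suffices to compare the two quantities for a single tame sphere
  and to decide when they agree (\<open>flip_sphere_morse_inequality\<close>).

  For the boundary of a simplex they agree. Consider a move \<open>\<alpha> \<mapsto> \<beta>\<close> of index \<open>t < n / 2\<close>. Filling in
  the simplex on \<open>\<alpha> \<union> \<beta>\<close> shows that \<open>S[A]\<close> changes, up to homology, only if \<open>A\<close> contains \<open>\<beta>\<close> and is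
  disjoint from \<open>\<alpha>\<close>, or the other way round. In the second case only homology of high dimension is
  affected; in the first the face \<open>\<beta>\<close> of dimension \<open>t\<close> is attached. For \<open>t < l\<close> this changes each
  alternating sum by the same sign, whether a cycle is created or killed, and the total weight of these \<open>A\<close>
  depends only on the sizes of \<open>\<alpha>\<close> and \<open>\<beta>\<close>; as the move raises \<open>g\<^sub>t\<^sub>+\<^sub>1\<close> by 1 and leaves the other
  g-numbers involved alone, both quantities change equally. For \<open>t = l\<close> the first quantity drops strictly,
  \<open>A = \<beta>\<close> being a witness, while the second stays and \<open>g\<^sub>l\<^sub>+\<^sub>1\<close> grows. For \<open>t > l\<close> nothing changes
  (\<open>weighted_morse_flip\<close>, \<open>g_bound_flip\<close>). Moreover, if no move of index \<open>l\<close> has been made, then there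
  is none of larger index either, because all \<open>S[A]\<close> have a gap in their homology where the boundary of
  \<open>\<beta>\<close> would have to live (\<open>low_flip_sphere_no_higher_flip\<close>). Hence the inequality holds, and equality
  means that all moves have index below \<open>l\<close>, and also that \<open>g\<^sub>l\<^sub>+\<^sub>1(S) = 0\<close>
  (\<open>weighted_morse_le_g_bound\<close>).

  It remains to identify this case with stackedness. If all moves have index below \<open>l\<close>, gluing in the
  simplices \<open>\<alpha> \<union> \<beta>\<close> one after the other yields a ball with boundary \<open>S\<close> whose interior faces have
  dimension above \<open>n - l\<close> (\<open>flip_sphere_stacked\<close>). Conversely, a homology ball with this property forces
  \<open>g\<^sub>l\<^sub>+\<^sub>1(S) = 0\<close> by the Dehn-Sommerville relations (\<open>stacked_sphere_g_sum\<close>).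

  Homology is handled through the ranks of boundary matrices, with faces indexed by size and the empty
  face included; the Betti numbers enter only through \<open>betti_plus_ranks\<close>.
\<close>

section \<open>Linear algebra of quotients and ranks\<close>

lemma (in vector_space) independent_finite_in_span:
  assumes "independent B" "B \<subseteq> span S" "finite S"
  shows "finite B"
  using independent_span_bound[OF assms(3,1,2)] by simp

lemma (in vector_space) dim_insert_if_finite:
  assumes "finite S"
  shows "dim (insert x S) = (if x \<in> span S then dim S else Suc (dim S))"
proof (cases "x \<in> span S")
  case True
  have "dim (insert x S) = dim (span (insert x S))" by simp
  also have "span (insert x S) = span S" using True by (rule span_redundant)
  finally show ?thesis using True by simp
next
  case False
  obtain B where B: "B \<subseteq> S" "independent B" "S \<subseteq> span B" "card B = dim S"
    by (rule basis_exists)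
  have sp: "span B = span S"
    using B(1,3) by (metis span_mono span_span subset_antisym span_minimal subspace_span)
  have fin: "finite B" using B(1) assms finite_subset by blast
  have xB: "x \<notin> span B" using False sp by simp
  have "independent (insert x B)" using xB B(2) by (simp add: independent_insertI)
  moreover have "insert x S \<subseteq> span (insert x B)"
    using B(3) span_mono[of B "insert x B"] span_base[of x "insert x B"] by auto
  moreover have "insert x B \<subseteq> insert x S" using B(1) by auto
  ultimately have "dim (insert x S) = card (insert x B)" using basis_card_eq_dim by metis
  also have "\<dots> = Suc (card B)" using fin xB span_base by (metis card_insert_disjoint)
  finally show ?thesis using False B(4) by simp
qed

text \<open>Both rank-nullity and the dimension of a quotient reduce to choosing a finite complement \<open>C\<close>
of a subspace \<open>K\<close>: a basis of \<open>V\<close> that extends a basis of \<open>K\<close>, with the latter removed.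
The ambient space of all functions on faces need not have finite dimension, hence the finite
spanning set \<open>S\<close>.\<close>

lemma (in vector_space) complement_exists:
  assumes K: "subspace K" and V: "subspace V" and "K \<subseteq> V" and fin: "V \<subseteq> span S" "finite S"
  obtains C where "finite C" "C \<subseteq> V" "independent C" "span C \<inter> K = {0}"
    "\<And>v. v \<in> V \<Longrightarrow> \<exists>c\<in>span C. v - c \<in> K" "dim V = dim K + card C"
proof -
  obtain A where A: "A \<subseteq> K" "independent A" "K \<subseteq> span A" "card A = dim K"
    by (rule basis_exists)
  obtain B where B: "A \<subseteq> B" "B \<subseteq> V" "independent B" "V \<subseteq> span B"
    using maximal_independent_subset_extend[of A V] A \<open>K \<subseteq> V\<close> by blast
  have finB: "finite B" using independent_finite_in_span B(2,3) fin by blast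
  have spA: "span A = K" using A K by (meson span_subspace)
  define C where "C = B - A"
  have BAC: "B = A \<union> C" using B(1) by (auto simp: C_def)
  have int: "x = 0" if x: "x \<in> span C" "x \<in> K" for x
  proof (rule ccontr)
    assume "x \<noteq> 0"
    have CB: "C \<subseteq> B" by (auto simp: C_def)
    have xA: "x \<in> span A" using x spA by simp
    have iA: "independent A" "independent C" using B(3) independent_mono CB B(1) by blast+
    have "representation B x b = representation A x b" for b
      using representation_extend[OF B(3) xA B(1)] by simp
    moreover have "representation B x b = representation C x b" for b
      using representation_extend[OF B(3) x(1) CB] by simp
    ultimately have eq: "representation A x b = representation C x b" for b by simp
    have "representation A x b = 0" for b
    proof (cases "b \<in> A")
      case True
      hence "b \<notin> C" by (simp add: C_def)
      thus ?thesis using representation_ne_zero[of C x b] eq[of b] by auto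
    next
      case False thus ?thesis using representation_ne_zero[of A x b] by auto
    qed
    hence "x = 0" using sum_nonzero_representation_eq[OF iA(1) xA] by simp
    thus False using \<open>x \<noteq> 0\<close> by simp
  qed
  show thesis
  proof (rule that[of C])
    show "finite C" "C \<subseteq> V" "independent C"
      using finB B independent_mono[OF B(3), of C] by (auto simp: C_def)
    show "span C \<inter> K = {0}" using int K by (auto simp: span_zero subspace_0)
    show "dim V = dim K + card C"
      using basis_card_eq_dim[OF B(2,4,3)] A(4) B(1) finB unfolding C_def
      by (metis card_Diff_subset card_mono finite_subset le_add_diff_inverse)
    fix v assume "v \<in> V"
    hence "v \<in> span (A \<union> C)" using B(4) BAC by auto
    then obtain a c where "v = a + c" "a \<in> span A" "c \<in> span C" unfolding span_Un by auto
    thus "\<exists>c\<in>span C. v - c \<in> K" using spA by (intro bexI[of _ c]) auto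
  qed
qed

lemma (in vector_space_pair) rank_nullity_on_subspace:
  assumes f: "Vector_Spaces.linear s1 s2 f" and V: "vs1.subspace V" and fin: "V \<subseteq> vs1.span S" "finite S"
  shows "vs1.dim V = vs1.dim {v \<in> V. f v = 0} + vs2.dim (f ` V)"
proof -
  let ?K = "{v \<in> V. f v = 0}"
  have "?K = V \<inter> {v. f v = 0}" by auto
  hence K: "vs1.subspace ?K" using V linear_subspace_kernel[OF f] by (simp add: vs1.subspace_inter)
  obtain C where C: "finite C" "C \<subseteq> V" "vs1.independent C" "vs1.span C \<inter> ?K = {0}"
    "\<And>v. v \<in> V \<Longrightarrow> \<exists>c\<in>vs1.span C. v - c \<in> ?K" "vs1.dim V = vs1.dim ?K + card C"
    using vs1.complement_exists[OF K V _ fin] by (metis (no_types, lifting) mem_Collect_eq subsetI)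
  have spC: "vs1.span C \<subseteq> V" using C(2) V by (simp add: vs1.span_minimal)
  have inj: "inj_on f (vs1.span C)"
    unfolding linear_inj_on_iff_eq_0[OF f vs1.subspace_span]
    using C(4) spC by blast
  have "vs2.independent (f ` C)"
    using linear_independent_injective_image[OF f C(3) inj] .
  moreover have "f ` V \<subseteq> vs2.span (f ` C)"
  proof
    fix y assume "y \<in> f ` V"
    then obtain v where v: "v \<in> V" "y = f v" by auto
    then obtain c where c: "c \<in> vs1.span C" "v - c \<in> ?K" using C(5) by blast
    have "f v = f c" using c(2) linear_diff[OF f, of v c] by simp
    thus "y \<in> vs2.span (f ` C)" using v c linear_span_image[OF f, of C] by auto
  qed
  ultimately have "vs2.dim (f ` V) = card (f ` C)"
    using C(2) by (metis vs2.basis_card_eq_dim image_mono)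
  also have "\<dots> = card C"
    by (rule card_image) (meson inj inj_on_subset vs1.span_superset)
  finally show ?thesis using C(6) by simp
qed

interpretation chain: vector_space "chain_scale :: 'f::field \<Rightarrow> ('a set \<Rightarrow> 'f) \<Rightarrow> 'a set \<Rightarrow> 'f"
  by unfold_locales (auto simp: chain_scale_def fun_eq_iff algebra_simps)

interpretation chain_maps: vector_space_pair
  "chain_scale :: 'f::field \<Rightarrow> ('a set \<Rightarrow> 'f) \<Rightarrow> 'a set \<Rightarrow> 'f"
  "chain_scale :: 'f::field \<Rightarrow> ('a set \<Rightarrow> 'f) \<Rightarrow> 'a set \<Rightarrow> 'f"
  by unfold_locales

lemma chain_subspace_iff: "chain_subspace S \<longleftrightarrow> chain.subspace S"
  unfolding chain_subspace_def chain.subspace_def by blast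

lemma coset_eq_iff:
  assumes B: "chain_subspace (B :: ('a set \<Rightarrow> 'f::field) set)"
  shows "z +o B = w +o B \<longleftrightarrow> z - w \<in> B"
proof
  assume *: "z +o B = w +o B"
  have "0 \<in> B" using B by (simp add: chain_subspace_def)
  hence "z + 0 \<in> z +o B" by (rule set_plus_intro2)
  hence "z \<in> w +o B" using * by simp
  thus "z - w \<in> B" by (auto simp: elt_set_plus_def)
next
  assume *: "z - w \<in> B"
  have sub: "chain.subspace B" using B by (simp add: chain_subspace_iff)
  show "z +o B = w +o B"
  proof (intro equalityI subsetI)
    fix x assume "x \<in> z +o B"
    then obtain b where b: "b \<in> B" "x = z + b" by (auto simp: elt_set_plus_def)
    have "x = w + ((z - w) + b)" using b by (simp add: algebra_simps)
    thus "x \<in> w +o B" using set_plus_intro2[OF chain.subspace_add[OF sub * b(1)]] by metis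
  next
    fix x assume "x \<in> w +o B"
    then obtain b where b: "b \<in> B" "x = w + b" by (auto simp: elt_set_plus_def)
    have "x = z + (b - (z - w))" using b by (simp add: algebra_simps)
    thus "x \<in> z +o B" using set_plus_intro2[OF chain.subspace_diff[OF sub b(1) *]] by metis
  qed
qed

text \<open>This is where the record-based quotient behind the Betti numbers is left for good: the cosets of
a complement of \<open>B\<close> in \<open>Z\<close> form a basis of \<open>Z / B\<close>.\<close>

lemma dim_quotient_space:
  fixes Z B :: "('a set \<Rightarrow> 'f::field) set"
  assumes Z: "chain_subspace Z" and B: "chain_subspace B" and BZ: "B \<subseteq> Z"
    and fin: "Z \<subseteq> chain.span S" "finite S"
  shows "chain.dim Z = chain.dim B + vectorspace.dim class_ring (quotient_space Z B)"
proof -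
  let ?Q = "quotient_space Z B"
  interpret Q: vectorspace class_ring ?Q using vectorspace_quotient_space[OF Z B] .
  have subB: "chain.subspace B" and subZ: "chain.subspace Z"
    using Z B by (simp_all add: chain_subspace_iff)
  obtain C where C: "finite C" "C \<subseteq> Z" "chain.independent C" "chain.span C \<inter> B = {0}"
    "\<And>v. v \<in> Z \<Longrightarrow> \<exists>c\<in>chain.span C. v - c \<in> B" "chain.dim Z = chain.dim B + card C"
    using chain.complement_exists[OF subB subZ BZ fin] by metis
  let ?q = "\<lambda>z. z +o B"
  have zero: "\<zero>\<^bsub>?Q\<^esub> = ?q 0" by (auto simp: quotient_space_def elt_set_plus_def)
  have in_Z: "(\<Sum>c\<in>D. chain_scale (a c) c) \<in> Z" if "D \<subseteq> Z" for a D
    using that subZ by (intro chain.subspace_sum[OF subZ]) (auto intro: chain.subspace_scale)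
  have sc: "t \<odot>\<^bsub>?Q\<^esub> ?q c = ?q (chain_scale t c)" for t c
    by (simp add: quotient_space_def coset_scale[OF B])
  have sc_in: "?q (chain_scale t c) \<in> carrier ?Q" if "c \<in> Z" for t c
    using that chain.subspace_scale[OF subZ] by (simp add: quotient_space_def)
  have comb: "finsum ?Q (\<lambda>c. a c \<odot>\<^bsub>?Q\<^esub> ?q c) D = ?q (\<Sum>c\<in>D. chain_scale (a c) c)"
    if "D \<subseteq> Z" "finite D" for a D
    using that(2,1)
  proof (induction D rule: finite_induct)
    case empty
    show ?case by (simp only: Q.finsum_empty sum.empty zero)
  next
    case (insert x D)
    have "finsum ?Q (\<lambda>c. a c \<odot>\<^bsub>?Q\<^esub> ?q c) (insert x D)
        = (a x \<odot>\<^bsub>?Q\<^esub> ?q x) \<oplus>\<^bsub>?Q\<^esub> finsum ?Q (\<lambda>c. a c \<odot>\<^bsub>?Q\<^esub> ?q c) D"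
      using insert by (intro Q.finsum_insert) (auto simp: sc intro!: sc_in)
    also have "\<dots> = ?q (chain_scale (a x) x + (\<Sum>c\<in>D. chain_scale (a c) c))"
      using insert coset_plus[OF B] by (simp add: sc) (simp add: quotient_space_def)
    finally show ?case by (simp only: sum.insert[OF insert.hyps(1,2)])
  qed
  have injq: "inj_on ?q C"
  proof (rule inj_onI)
    fix x y assume "x \<in> C" "y \<in> C" "?q x = ?q y"
    hence "x - y \<in> B" "x - y \<in> chain.span C"
      using coset_eq_iff[OF B] by (auto intro: chain.span_base chain.span_diff)
    hence "x - y = 0" using C(4) by blast
    thus "x = y" by simp
  qed
  have lc: "Q.lincomb b (?q ` D) = ?q (\<Sum>c\<in>D. chain_scale (b (?q c)) c)"
    if D: "D \<subseteq> C" for b D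
  proof -
    have fD: "finite D" "D \<subseteq> Z" using D C finite_subset by auto
    have "Q.lincomb b (?q ` D) = finsum ?Q (\<lambda>c. b (?q c) \<odot>\<^bsub>?Q\<^esub> ?q c) D"
      unfolding Q.lincomb_def
      using fD(2) by (subst Q.finsum_reindex) (auto simp: inj_on_subset[OF injq D] sc intro!: sc_in)
    thus ?thesis using comb fD by simp
  qed
  have car: "?q ` C \<subseteq> carrier ?Q" using C(2) by (auto simp: quotient_space_def)
  have li: "Q.lin_indpt (?q ` C)"
  proof
    assume "Q.lin_dep (?q ` C)"
    then obtain A b v where A: "finite A" "A \<subseteq> ?q ` C" "Q.lincomb b A = \<zero>\<^bsub>?Q\<^esub>" "v \<in> A"
      "b v \<noteq> \<zero>\<^bsub>class_ring\<^esub>" unfolding Q.lin_dep_def by auto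
    then obtain D where D: "D \<subseteq> C" "A = ?q ` D" by (meson subset_image_iff)
    obtain c where c: "c \<in> D" "v = ?q c" using A(4) D by auto
    have "?q (\<Sum>c\<in>D. chain_scale (b (?q c)) c) = ?q 0" using lc[OF D(1), of b] A(3) D(2) zero by simp
    hence "(\<Sum>c\<in>D. chain_scale (b (?q c)) c) - 0 \<in> B" unfolding coset_eq_iff[OF B] .
    hence "(\<Sum>c\<in>D. chain_scale (b (?q c)) c) \<in> B" by (simp only: diff_zero)
    moreover have "(\<Sum>c\<in>D. chain_scale (b (?q c)) c) \<in> chain.span C"
      by (rule chain.span_sum, rule chain.span_scale, rule chain.span_base) (use D in blast)
    ultimately have "(\<Sum>c\<in>D. chain_scale (b (?q c)) c) = 0" using C(4) by blast
    hence "b (?q c) = 0"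
      by (rule chain.independentD[OF C(3) finite_subset[OF D(1) C(1)] D(1) _ c(1)])
    thus False using A(5) c by (simp add: class_ring_simps)
  qed
  have gen: "Q.span (?q ` C) = carrier ?Q"
  proof
    show "Q.span (?q ` C) \<subseteq> carrier ?Q" using car by (meson Q.span_is_subset2)
    show "carrier ?Q \<subseteq> Q.span (?q ` C)"
    proof
      fix x assume "x \<in> carrier ?Q"
      then obtain z where z: "z \<in> Z" "x = ?q z" by (auto simp: quotient_space_def)
      obtain c where c: "c \<in> chain.span C" "z - c \<in> B" using C(5)[OF z(1)] by blast
      obtain u where u: "c = (\<Sum>v\<in>C. chain_scale (u v) v)"
        using c(1) chain.span_finite[OF C(1)] by auto
      define b where "b = (\<lambda>y. u (the_inv_into C ?q y))"
      have "x = ?q c" using z(2) c(2) coset_eq_iff[OF B] by simp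
      also have "c = (\<Sum>v\<in>C. chain_scale (b (?q v)) v)"
        unfolding u by (rule sum.cong) (simp_all add: b_def the_inv_into_f_f[OF injq])
      finally have "x = Q.lincomb b (?q ` C)" using lc[OF subset_refl, of b] by simp
      moreover have "b \<in> ?q ` C \<rightarrow> carrier class_ring" by (simp add: class_ring_simps)
      ultimately show "x \<in> Q.span (?q ` C)" unfolding Q.span_def using C(1) by blast
    qed
  qed
  have "Q.dim = card (?q ` C)"
    using li gen car C(1) by (intro Q.dim_basis) (auto simp: Q.basis_def)
  also have "\<dots> = card C" by (rule card_image[OF injq])
  finally show ?thesis using C(6) by simp
qed

section \<open>Reduced homology through ranks\<close>

text \<open>The reduced boundary of a single oriented face. The coefficient at the empty face is kept, in
contrast to \<^const>\<open>chain_bd\<close>: with reduced homology the empty face needs no special treatment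
in the attaching arguments below.\<close>

definition face_bd :: "'a::linorder set \<Rightarrow> 'a set \<Rightarrow> 'f::field" where
  "face_bd \<tau> = (\<lambda>\<sigma>. \<Sum>v\<in>\<tau>. if \<sigma> = \<tau> - {v} then (-1) ^ card {w \<in> \<tau>. w < v} else 0)"

text \<open>Faces are counted by size rather than by dimension, so that all indices are natural numbers and
the empty face has index 0.\<close>

definition faces :: "nat \<Rightarrow> 'a set set \<Rightarrow> 'a set set" where
  "faces k X = {\<sigma> \<in> X. card \<sigma> = k}"

definition bd_rank :: "'f::field itself \<Rightarrow> 'a::linorder set set \<Rightarrow> nat" where
  "bd_rank F T = chain.dim (face_bd ` T :: ('a set \<Rightarrow> 'f) set)"

text \<open>The dimension of the reduced homology in dimension \<open>k - 1\<close>, written as number of faces of size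
\<open>k\<close> minus the ranks of the two adjacent boundary maps. This form makes the effect of adding one
face immediate, as only one rank can change.\<close>

definition red_hom :: "'f::field itself \<Rightarrow> nat \<Rightarrow> 'a::linorder set set \<Rightarrow> int" where
  "red_hom F k X = int (card (faces k X)) - int (bd_rank F (faces k X)) - int (bd_rank F (faces (Suc k) X))"

lemma faces_insert: "faces k (insert \<tau> X) = (if card \<tau> = k then insert \<tau> (faces k X) else faces k X)"
  by (auto simp: faces_def)

lemma finite_faces [simp]: "finite X \<Longrightarrow> finite (faces k X)"
  by (simp add: faces_def)

lemma face_bd_at_ridge:
  assumes "finite \<tau>" "v \<in> \<tau>"
  shows "face_bd \<tau> (\<tau> - {v}) = ((-1) ^ card {w \<in> \<tau>. w < v} :: 'f::field)"
proof -
  have "(if \<tau> - {v} = \<tau> - {u} then (-1) ^ card {w \<in> \<tau>. w < u} else 0 :: 'f)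
      = (if u = v then (-1) ^ card {w \<in> \<tau>. w < v} else 0)" if "u \<in> \<tau>" for u
    using that assms(2) by auto
  hence "face_bd \<tau> (\<tau> - {v}) = (\<Sum>u\<in>\<tau>. if u = v then (-1) ^ card {w \<in> \<tau>. w < v} else 0 :: 'f)"
    unfolding face_bd_def by (intro sum.cong refl) blast
  thus ?thesis using assms by simp
qed

lemma sum_fun_apply: "(\<Sum>x\<in>A. f x) y = (\<Sum>x\<in>A. f x y)"
  for f :: "'i \<Rightarrow> 'b \<Rightarrow> 'c::comm_monoid_add"
  by (induction A rule: infinite_finite_induct) auto

lemma face_bd_eq_0: "\<forall>v\<in>\<tau>. \<sigma> \<noteq> \<tau> - {v} \<Longrightarrow> face_bd \<tau> \<sigma> = (0 :: 'f::field)"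
  unfolding face_bd_def by (rule sum.neutral) auto

lemma face_bd_empty: "face_bd {} = 0"
  by (simp add: face_bd_def zero_fun_def)

text \<open>The square of the boundary vanishes: deleting \<open>v\<close> and then \<open>w\<close> gives the opposite sign of
deleting \<open>w\<close> and then \<open>v\<close>. The sum is split by the order of the two vertices before terms are
cancelled, since halving would fail in characteristic 2.\<close>

lemma face_bd_face_bd:
  fixes \<tau> :: "'a::linorder set"
  assumes fin: "finite \<tau>"
  shows "(\<Sum>v\<in>\<tau>. chain_scale ((-1) ^ card {w \<in> \<tau>. w < v}) (face_bd (\<tau> - {v}))) = (0 :: 'a set \<Rightarrow> 'f::field)"
proof
  fix \<rho> :: "'a set"
  define h where "h = (\<lambda>v w. if \<rho> = \<tau> - {v} - {w} then
     (-1) ^ card {u \<in> \<tau>. u < v} * (-1) ^ card {u \<in> \<tau> - {v}. u < w} else 0 :: 'f)"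
  have anti: "h w v = - h v w" if vw: "v \<in> \<tau>" "w \<in> \<tau>" "v < w" for v w
  proof -
    have "{u \<in> \<tau>. u < w} = insert v {u \<in> \<tau> - {v}. u < w}" using vw by auto
    hence "card {u \<in> \<tau>. u < w} = Suc (card {u \<in> \<tau> - {v}. u < w})" using fin by simp
    moreover have "{u \<in> \<tau> - {w}. u < v} = {u \<in> \<tau>. u < v}" using vw by auto
    moreover have "\<tau> - {v} - {w} = \<tau> - {w} - {v}" by auto
    ultimately show ?thesis unfolding h_def by simp
  qed
  have "(\<Sum>v\<in>\<tau>. chain_scale ((-1) ^ card {w \<in> \<tau>. w < v}) (face_bd (\<tau> - {v}))) \<rho>
      = (\<Sum>v\<in>\<tau>. \<Sum>w\<in>\<tau> - {v}. h v w)"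
    by (simp add: sum_fun_apply chain_scale_def face_bd_def sum_distrib_left h_def if_distrib cong: if_cong)
  also have "\<dots> = (\<Sum>p\<in>(SIGMA v:\<tau>. \<tau> - {v}). h (fst p) (snd p))"
    using fin by (subst sum.Sigma) (auto simp: case_prod_beta)
  also have "(SIGMA v:\<tau>. \<tau> - {v}) = {p \<in> \<tau> \<times> \<tau>. fst p < snd p} \<union> {p \<in> \<tau> \<times> \<tau>. snd p < fst p}"
    by auto
  also have "(\<Sum>p\<in>\<dots>. h (fst p) (snd p)) = (\<Sum>p\<in>{p \<in> \<tau> \<times> \<tau>. fst p < snd p}. h (fst p) (snd p))
      + (\<Sum>p\<in>{p \<in> \<tau> \<times> \<tau>. snd p < fst p}. h (fst p) (snd p))"
    using fin by (intro sum.union_disjoint) auto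
  also have "(\<Sum>p\<in>{p \<in> \<tau> \<times> \<tau>. snd p < fst p}. h (fst p) (snd p))
      = (\<Sum>p\<in>{p \<in> \<tau> \<times> \<tau>. fst p < snd p}. h (snd p) (fst p))"
    by (rule sum.reindex_bij_witness[of _ prod.swap prod.swap]) auto
  also have "\<dots> = (\<Sum>p\<in>{p \<in> \<tau> \<times> \<tau>. fst p < snd p}. - h (fst p) (snd p))"
    by (intro sum.cong refl anti) auto
  finally show "(\<Sum>v\<in>\<tau>. chain_scale ((-1) ^ card {w \<in> \<tau>. w < v}) (face_bd (\<tau> - {v}))) \<rho> = (0 :: 'a set \<Rightarrow> 'f) \<rho>"
    by (simp add: sum_negf)
qed

lemma bd_rank_insert:
  assumes "finite T"
  shows "bd_rank F (insert \<tau> T) = (if face_bd \<tau> \<in> chain.span (face_bd ` T :: ('a::linorder set \<Rightarrow> 'f::field) set)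
     then bd_rank F T else Suc (bd_rank (F :: 'f itself) T))"
  unfolding bd_rank_def image_insert using assms by (intro chain.dim_insert_if_finite) auto

text \<open>A new face either closes a new cycle in its own dimension or kills one in the dimension below,
according to whether its boundary is already a combination of boundaries.\<close>

lemma red_hom_attach_face:
  assumes "finite X" "\<tau> \<notin> X" "card \<tau> = Suc n"
  shows "(\<forall>k. red_hom F k (insert \<tau> X) = red_hom F k X + (if k = Suc n then 1 else 0)) \<or>
         (\<forall>k. red_hom F k (insert \<tau> X) = red_hom F k X - (if k = n then 1 else 0))"
proof -
  have "\<tau> \<notin> faces (Suc n) X" using assms by (auto simp: faces_def)
  thus ?thesis
  using assms unfolding red_hom_def
  by (cases "face_bd \<tau> \<in> chain.span (face_bd ` faces (Suc n) X :: ('a set \<Rightarrow> 'b) set)")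
     (auto simp: faces_insert bd_rank_insert)
qed

text \<open>The inverse of an elementary collapse. The large face \<open>\<tau>\<close> raises the rank because it is the
only face through the ridge \<open>\<tau> - {v}\<close>, and the ridge itself does not raise the rank below because
the relation of vanishing double boundary expresses its boundary by the other ridges.\<close>

lemma red_hom_elementary_expansion:
  fixes X :: "'a::linorder set set" and F :: "'f::field itself"
  assumes X: "scomplex X" and \<tau>: "finite \<tau>" "v \<in> \<tau>" and \<sigma>: "\<tau> - {v} \<notin> X"
    and ridges: "\<And>w. w \<in> \<tau> \<Longrightarrow> w \<noteq> v \<Longrightarrow> \<tau> - {w} \<in> X"
  shows "red_hom F k (insert \<tau> (insert (\<tau> - {v}) X)) = red_hom F k X"
proof -
  let ?\<sigma> = "\<tau> - {v}"
  define n where "n = card ?\<sigma>"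
  have card: "card ?\<sigma> = n" "card \<tau> = Suc n" using card.remove[OF \<tau>] by (simp_all add: n_def)
  have fin: "finite X" using X by (simp add: scomplex_def)
  have down: "\<alpha> \<in> X" if "\<beta> \<in> X" "\<alpha> \<subseteq> \<beta>" for \<alpha> \<beta> using X that by (auto simp: scomplex_def)
  have "\<tau> \<notin> X" using \<sigma> down[of \<tau> ?\<sigma>] by auto
  have ne: "?\<sigma> \<noteq> \<tau>" using \<tau> by auto
  let ?S = "chain.span (face_bd ` faces n X :: ('a set \<Rightarrow> 'f) set)"
  have in_span: "face_bd ?\<sigma> \<in> ?S"
  proof -
    let ?c = "\<lambda>u. (-1) ^ card {w \<in> \<tau>. w < u} :: 'f"
    have rest: "(\<Sum>u\<in>\<tau> - {v}. chain_scale (?c u) (face_bd (\<tau> - {u}))) \<in> ?S"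
    proof (intro chain.span_sum chain.span_scale chain.span_base imageI)
      fix u assume u: "u \<in> \<tau> - {v}"
      have "card (\<tau> - {u}) = n" using u card(2) \<tau>(1) by (simp add: card_Diff_singleton)
      thus "\<tau> - {u} \<in> faces n X" using u ridges by (auto simp: faces_def)
    qed
    have "chain_scale (?c v) (face_bd ?\<sigma>) + (\<Sum>u\<in>\<tau> - {v}. chain_scale (?c u) (face_bd (\<tau> - {u}))) = 0"
      using face_bd_face_bd[OF \<tau>(1), where ?'f = 'f] \<tau> by (simp add: sum.remove)
    hence "chain_scale (?c v) (face_bd ?\<sigma>) = - (\<Sum>u\<in>\<tau> - {v}. chain_scale (?c u) (face_bd (\<tau> - {u})))"
      by (simp add: eq_neg_iff_add_eq_0)
    hence "chain_scale (?c v) (face_bd ?\<sigma>) \<in> ?S" using chain.span_neg[OF rest] by simp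
    hence "chain_scale (?c v) (chain_scale (?c v) (face_bd ?\<sigma>)) \<in> ?S" by (rule chain.span_scale)
    thus ?thesis by (simp add: power_mult_distrib[symmetric])
  qed
  have notin: "face_bd \<tau> \<notin> chain.span (face_bd ` faces (Suc n) X :: ('a set \<Rightarrow> 'f) set)"
  proof
    let ?K = "{c. c ?\<sigma> = 0} :: ('a set \<Rightarrow> 'f) set"
    have K: "chain.subspace ?K" by (auto simp: chain.subspace_def chain_scale_def)
    have "face_bd ` faces (Suc n) X \<subseteq> ?K"
      using \<sigma> down by (auto simp: faces_def intro!: face_bd_eq_0)
    moreover assume "face_bd \<tau> \<in> chain.span (face_bd ` faces (Suc n) X :: ('a set \<Rightarrow> 'f) set)"
    ultimately have "face_bd \<tau> \<in> ?K" using chain.span_minimal[OF _ K] by blast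
    thus False using face_bd_at_ridge[OF \<tau>, where ?'f = 'f] by simp
  qed
  have f: "faces j (insert \<tau> (insert ?\<sigma> X)) = (if j = n then insert ?\<sigma> (faces n X)
      else if j = Suc n then insert \<tau> (faces (Suc n) X) else faces j X)" for j
    using card by (simp add: faces_insert)
  have new: "?\<sigma> \<notin> faces n X" "\<tau> \<notin> faces (Suc n) X"
    using \<sigma> \<open>\<tau> \<notin> X\<close> by (simp_all add: faces_def)
  \<comment> \<open>The new ridge creates a cycle, which the new large face kills.\<close>
  have r: "bd_rank F (insert ?\<sigma> (faces n X)) = bd_rank F (faces n X)"
    "bd_rank F (insert \<tau> (faces (Suc n) X)) = Suc (bd_rank F (faces (Suc n) X))"
    unfolding bd_rank_insert[OF finite_faces[OF fin]] using in_span notin by simp_all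
  have c: "card (insert ?\<sigma> (faces n X)) = Suc (card (faces n X))"
    "card (insert \<tau> (faces (Suc n) X)) = Suc (card (faces (Suc n) X))"
    using new fin by simp_all
  consider "k = n" | "k = Suc n" | "Suc k = n" | "k \<noteq> n" "k \<noteq> Suc n" "Suc k \<noteq> n" by blast
  thus ?thesis unfolding red_hom_def f by cases (simp_all add: r c)
qed

section \<open>Betti numbers from ranks\<close>

definition unit_chain :: "'a set \<Rightarrow> 'a set \<Rightarrow> 'f::field" where
  "unit_chain \<tau> = (\<lambda>\<sigma>. if \<sigma> = \<tau> then 1 else 0)"

lemma dim_unit_chains:
  assumes "finite T"
  shows "chain.dim (unit_chain ` T :: ('a set \<Rightarrow> 'f::field) set) = card T"
  using assms
proof (induction T rule: finite_induct)
  case empty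
  show ?case using chain.dim_eq_card_independent[OF chain.independent_empty] by simp
next
  case (insert \<tau> T)
  let ?K = "{c. c \<tau> = 0} :: ('a set \<Rightarrow> 'f) set"
  have K: "chain.subspace ?K" by (auto simp: chain.subspace_def chain_scale_def)
  have "chain.span (unit_chain ` T) \<subseteq> ?K"
    by (rule chain.span_minimal[OF _ K]) (use insert in \<open>auto simp: unit_chain_def\<close>)
  moreover have "unit_chain \<tau> \<notin> ?K" by (simp add: unit_chain_def)
  ultimately have "unit_chain \<tau> \<notin> chain.span (unit_chain ` T :: ('a set \<Rightarrow> 'f) set)" by blast
  thus ?case using insert by (simp add: chain.dim_insert_if_finite)
qed

lemma sum_unit_chains:
  assumes "finite T" "\<And>\<sigma>. c \<sigma> \<noteq> 0 \<Longrightarrow> \<sigma> \<in> T"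
  shows "(\<Sum>\<tau>\<in>T. chain_scale (c \<tau>) (unit_chain \<tau>)) = (c :: 'a set \<Rightarrow> 'f::field)"
proof
  fix \<sigma>
  have "(\<Sum>\<tau>\<in>T. chain_scale (c \<tau>) (unit_chain \<tau>)) \<sigma> = (\<Sum>\<tau>\<in>T. if \<sigma> = \<tau> then c \<tau> else 0)"
    by (simp add: sum_fun_apply chain_scale_def unit_chain_def if_distrib cong: if_cong)
  thus "(\<Sum>\<tau>\<in>T. chain_scale (c \<tau>) (unit_chain \<tau>)) \<sigma> = c \<sigma>" using assms by auto
qed

lemma chains_eq_span:
  assumes "finite X"
  shows "chains i X = chain.span (unit_chain ` faces (Suc i) X :: ('a set \<Rightarrow> 'f::field) set)"
proof
  show "chain.span (unit_chain ` faces (Suc i) X) \<subseteq> (chains i X :: ('a set \<Rightarrow> 'f) set)"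
  proof (rule chain.span_minimal)
    show "chain.subspace (chains i X :: ('a set \<Rightarrow> 'f) set)"
      using chain_subspace_chains by (simp only: chain_subspace_iff)
  qed (auto simp: chains_def unit_chain_def faces_def face_dim_def split: if_splits)
  show "(chains i X :: ('a set \<Rightarrow> 'f) set) \<subseteq> chain.span (unit_chain ` faces (Suc i) X)"
  proof
    fix c :: "'a set \<Rightarrow> 'f" assume c: "c \<in> chains i X"
    have "\<And>\<sigma>. c \<sigma> \<noteq> 0 \<Longrightarrow> \<sigma> \<in> faces (Suc i) X"
      using c by (force simp: chains_def faces_def face_dim_def)
    hence "(\<Sum>\<tau>\<in>faces (Suc i) X. chain_scale (c \<tau>) (unit_chain \<tau>)) = c"
      using assms by (intro sum_unit_chains) auto
    moreover have "(\<Sum>\<tau>\<in>faces (Suc i) X. chain_scale (c \<tau>) (unit_chain \<tau>))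
        \<in> chain.span (unit_chain ` faces (Suc i) X)"
      by (rule chain.span_sum, rule chain.span_scale, rule chain.span_base) blast
    ultimately show "c \<in> chain.span (unit_chain ` faces (Suc i) X)" by (simp only:)
  qed
qed

lemma linear_chain_bd:
  "Vector_Spaces.linear chain_scale chain_scale (chain_bd X :: ('a::linorder set \<Rightarrow> 'f::field) \<Rightarrow> _)"
  unfolding Vector_Spaces.linear_iff 
  by (intro conjI allI chain.vector_space_axioms chain_bd_add chain_bd_scale)

lemma chain_bd_unit_chain:
  assumes X: "scomplex X" and "\<tau> \<in> X"
  shows "chain_bd X (unit_chain \<tau> :: 'a::linorder set \<Rightarrow> 'f::field) = (if card \<tau> \<ge> 2 then face_bd \<tau> else 0)"
proof
  fix \<sigma> :: "'a set"
  have fin: "finite \<tau>" and finX: "finite (verts X)" and sub: "\<tau> \<subseteq> verts X"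
    using assms by (auto simp: scomplex_def verts_def)
  show "chain_bd X (unit_chain \<tau>) \<sigma> = (if card \<tau> \<ge> 2 then face_bd \<tau> else 0 :: 'a set \<Rightarrow> 'f) \<sigma>"
  proof (cases "\<exists>v\<in>\<tau>. \<sigma> = \<tau> - {v}")
    case False
    have "unit_chain \<tau> (insert v \<sigma>) = (0 :: 'f)" if "v \<in> verts X - \<sigma>" for v
      using False that by (auto simp: unit_chain_def)
    hence "chain_bd X (unit_chain \<tau>) \<sigma> = (0 :: 'f)" by (simp add: chain_bd_def)
    thus ?thesis using False face_bd_eq_0[of \<tau> \<sigma>, where ?'f = 'f] by auto
  next
    case True
    then obtain v where v: "v \<in> \<tau>" "\<sigma> = \<tau> - {v}" by auto
    show ?thesis
    proof (cases "\<sigma> = {}")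
      case True
      hence "card \<tau> = 1" using v card.remove[OF fin v(1)] by (metis One_nat_def card.empty)
      thus ?thesis using True by (simp add: chain_bd_def)
    next
      case False
      have "card \<tau> \<ge> 2" using False v fin card.remove[OF fin v(1)] card_gt_0_iff[of \<sigma>] by simp
      have "unit_chain \<tau> (insert u \<sigma>) = (if u = v then 1 else 0 :: 'f)" if "u \<in> verts X - \<sigma>" for u
      proof (cases "u = v")
        case True
        hence "insert u \<sigma> = \<tau>" using v by (simp add: insert_absorb)
        thus ?thesis using True by (simp add: unit_chain_def)
      next
        case False
        hence "u \<notin> \<tau>" using that v by simp
        hence "insert u \<sigma> \<noteq> \<tau>" by blast
        thus ?thesis using False by (simp add: unit_chain_def)
      qed
      hence "chain_bd X (unit_chain \<tau>) \<sigma> = (\<Sum>u\<in>verts X - \<sigma>. if u = v then (-1) ^ card {w \<in> \<sigma>. w < v} else 0 :: 'f)"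
        unfolding chain_bd_def if_not_P[OF False] by (intro sum.cong refl) (simp only: mult_1_right mult_zero_right split: if_splits, simp)
      also have "\<dots> = (-1) ^ card {w \<in> \<sigma>. w < v}" using finX v sub by auto
      also have "{w \<in> \<sigma>. w < v} = {w \<in> \<tau>. w < v}" using v by auto
      also have "(-1) ^ card {w \<in> \<tau>. w < v} = (face_bd \<tau> \<sigma> :: 'f)" using face_bd_at_ridge[OF fin v(1), where ?'f = 'f] v by simp
      finally show ?thesis using \<open>card \<tau> \<ge> 2\<close> by simp
    qed
  qed
qed

lemma chain_bd_face_bd:
  assumes X: "scomplex X" and "\<tau> \<in> X"
  shows "chain_bd X (face_bd \<tau> :: 'a::linorder set \<Rightarrow> 'f::field) = 0"
proof -
  have fin: "finite \<tau>" using assms by (auto simp: scomplex_def)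
  have ridge: "\<tau> - {v} \<in> X" for v using assms unfolding scomplex_def by blast
  have inj: "inj_on (\<lambda>v. \<tau> - {v}) \<tau>" by (rule inj_onI) blast
  let ?c = "\<lambda>u. (-1) ^ card {w \<in> \<tau>. w < u} :: 'f"
  have supp: "face_bd \<tau> \<sigma> \<noteq> (0 :: 'f) \<Longrightarrow> \<sigma> \<in> (\<lambda>v. \<tau> - {v}) ` \<tau>" for \<sigma>
    using face_bd_eq_0[of \<tau> \<sigma>, where ?'f = 'f] by blast
  have "(face_bd \<tau> :: 'a set \<Rightarrow> 'f) = (\<Sum>\<sigma>\<in>(\<lambda>v. \<tau> - {v}) ` \<tau>. chain_scale (face_bd \<tau> \<sigma>) (unit_chain \<sigma>))"
    using fin supp by (intro sum_unit_chains[symmetric]) auto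
  also have "\<dots> = (\<Sum>v\<in>\<tau>. chain_scale (?c v) (unit_chain (\<tau> - {v})))"
    by (subst sum.reindex[OF inj]) (auto intro!: sum.cong simp: face_bd_at_ridge[OF fin])
  finally have "chain_bd X (face_bd \<tau>) = (\<Sum>v\<in>\<tau>. chain_scale (?c v) (chain_bd X (unit_chain (\<tau> - {v}))))"
    by (simp add: chain_maps.linear_sum[OF linear_chain_bd] chain_bd_scale)
  also have "\<dots> = (\<Sum>v\<in>\<tau>. chain_scale (?c v) (if card \<tau> \<ge> 3 then face_bd (\<tau> - {v}) else 0))"
    using fin by (intro sum.cong refl arg_cong[of _ _ "chain_scale _"]) (auto simp: chain_bd_unit_chain[OF X ridge] card_Diff_singleton)
  also have "\<dots> = 0" using face_bd_face_bd[OF fin, where ?'f = 'f] by (cases "card \<tau> \<ge> 3") auto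
  finally show ?thesis .
qed

lemma dim_chain_bd_image:
  assumes X: "scomplex X"
  shows "chain.dim (chain_bd X ` chains i X :: ('a::linorder set \<Rightarrow> 'f::field) set)
    = (if i = 0 then 0 else bd_rank (F :: 'f itself) (faces (Suc i) X))"
proof -
  have fin: "finite X" using X by (simp add: scomplex_def)
  have "chain_bd X ` chains i X = chain.span (chain_bd X ` unit_chain ` faces (Suc i) X :: ('a set \<Rightarrow> 'f) set)"
    unfolding chains_eq_span[OF fin] chain_maps.linear_span_image[OF linear_chain_bd] ..
  hence "chain.dim (chain_bd X ` chains i X :: ('a set \<Rightarrow> 'f) set)
      = chain.dim (chain_bd X ` unit_chain ` faces (Suc i) X :: ('a set \<Rightarrow> 'f) set)" by simp
  also have "chain_bd X ` unit_chain ` faces (Suc i) X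
      = (\<lambda>\<tau>. if i = 0 then 0 else face_bd \<tau> :: 'a set \<Rightarrow> 'f) ` faces (Suc i) X"
    unfolding image_image by (intro image_cong refl) (auto simp: faces_def chain_bd_unit_chain[OF X])
  finally have *: "chain.dim (chain_bd X ` chains i X :: ('a set \<Rightarrow> 'f) set)
    = chain.dim ((\<lambda>\<tau>. if i = 0 then 0 else face_bd \<tau> :: 'a set \<Rightarrow> 'f) ` faces (Suc i) X)" .
  show ?thesis
  proof (cases "i = 0")
    case True
    have "chain.dim ((\<lambda>\<tau>. 0 :: 'a set \<Rightarrow> 'f) ` faces (Suc i) X) \<le> 0"
      using chain.dim_le_card[of "(\<lambda>\<tau>. 0 :: 'a set \<Rightarrow> 'f) ` faces (Suc i) X" "{}"] by auto
    thus ?thesis using * True by simp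
  qed (use * in \<open>simp add: bd_rank_def\<close>)
qed

text \<open>Rank-nullity on the chain groups. In dimension 0 the unreduced boundary is zero, which is why
one rank is absent there.\<close>

lemma betti_plus_ranks:
  fixes X :: "'a::linorder set set" and F :: "'f::field itself"
  assumes X: "scomplex X"
  shows "card (faces (Suc i) X)
     = betti F i X + bd_rank F (faces (Suc (Suc i)) X) + (if i = 0 then 0 else bd_rank F (faces (Suc i) X))"
proof -
  have fin: "finite X" using X by (simp add: scomplex_def)
  let ?C = "chains i X :: ('a set \<Rightarrow> 'f) set"
  let ?Z = "cycles i X :: ('a set \<Rightarrow> 'f) set"
  let ?B = "boundaries i X :: ('a set \<Rightarrow> 'f) set"
  have dimC: "chain.dim ?C = card (faces (Suc i) X)"
    using chains_eq_span[OF fin, of i, where ?'f = 'f] dim_unit_chains[of "faces (Suc i) X", where ?'f = 'f] fin by simp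
  have C_fin: "?C \<subseteq> chain.span (unit_chain ` faces (Suc i) X)" "finite (unit_chain ` faces (Suc i) X :: ('a set \<Rightarrow> 'f) set)"
    using chains_eq_span[OF fin, of i, where ?'f = 'f] fin by auto
  have BZ: "?B \<subseteq> ?Z"
  proof
    fix b assume "b \<in> ?B"
    then obtain c where c: "c \<in> chains (Suc i) X" "b = chain_bd X c" by (auto simp: boundaries_def)
    have c': "c \<in> chain.span (unit_chain ` faces (Suc (Suc i)) X)"
      using c(1) chains_eq_span[OF fin] by blast
    have "b \<in> chain.span (chain_bd X ` unit_chain ` faces (Suc (Suc i)) X)"
      using c' c(2) chain_maps.linear_span_image[OF linear_chain_bd] by blast
    also have "chain_bd X ` unit_chain ` faces (Suc (Suc i)) X = face_bd ` faces (Suc (Suc i)) X"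
      unfolding image_image by (intro image_cong refl) (auto simp: faces_def chain_bd_unit_chain[OF X])
    finally have b: "b \<in> chain.span (face_bd ` faces (Suc (Suc i)) X)" .
    have "chain_bd X b = 0"
      by (rule chain_maps.linear_eq_0_on_span[OF linear_chain_bd _ b]) (auto simp: faces_def chain_bd_face_bd[OF X])
    moreover have "chain.span (face_bd ` faces (Suc (Suc i)) X) \<subseteq> ?C"
    proof (rule chain.span_minimal)
      show "chain.subspace ?C" using chain_subspace_chains by (simp add: chain_subspace_iff)
      have "face_bd \<tau> \<in> ?C" if \<tau>: "\<tau> \<in> faces (Suc (Suc i)) X" for \<tau>
        unfolding chains_def
      proof (intro CollectI allI impI)
        fix \<sigma> assume "face_bd \<tau> \<sigma> \<noteq> (0 :: 'f)"
        then obtain v where v: "v \<in> \<tau>" "\<sigma> = \<tau> - {v}" using face_bd_eq_0[of \<tau> \<sigma>, where ?'f = 'f] by auto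
        have "finite \<tau>" "card \<tau> = Suc (Suc i)" using \<tau> X by (auto simp: faces_def scomplex_def)
        hence "card \<sigma> = Suc i" using v by (simp add: card_Diff_singleton)
        moreover have "\<sigma> \<in> X" using \<tau> X v by (auto simp: faces_def scomplex_def)
        ultimately show "\<sigma> \<in> X \<and> face_dim \<sigma> = int i" by (simp add: face_dim_def)
      qed
      thus "face_bd ` faces (Suc (Suc i)) X \<subseteq> ?C" by blast
    qed
    ultimately show "b \<in> ?Z" using b by (auto simp: cycles_def)
  qed
  have ZC: "?Z \<subseteq> ?C" by (auto simp: cycles_def)
  have "chain.dim ?Z = chain.dim ?B + betti F i X"
    unfolding betti_def homology_def
    by (rule dim_quotient_space[OF chain_subspace_cycles chain_subspace_boundaries BZ order_trans[OF ZC C_fin(1)] C_fin(2)])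
  moreover have "chain.dim ?C = chain.dim ?Z + chain.dim (chain_bd X ` ?C)"
    using chain_maps.rank_nullity_on_subspace[OF linear_chain_bd _ C_fin] chain_subspace_chains
    unfolding cycles_def chain_subspace_iff by blast
  moreover have "chain.dim ?B = bd_rank F (faces (Suc (Suc i)) X)"
    unfolding boundaries_def using dim_chain_bd_image[OF X, of "Suc i" F] by simp
  ultimately show ?thesis using dimC dim_chain_bd_image[OF X, of i F] by simp
qed

lemma bd_rank_faces_0:
  assumes X: "scomplex X" shows "bd_rank F (faces 0 X) = 0" "card (faces 0 X) = 1"
proof -
  have "faces 0 X = {{}}" using X by (auto simp: scomplex_def faces_def)
  thus "card (faces 0 X) = 1" "bd_rank F (faces 0 X) = 0"
    using chain.dim_le_card[of "{0}" "{}"] by (auto simp: bd_rank_def face_bd_empty)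
qed

lemma betti_eq_red_hom:
  assumes X: "scomplex X"
  shows "int (betti F i X) = red_hom F (Suc i) X + (if i = 0 then 1 - red_hom F 0 X else 0)"
  using betti_plus_ranks[OF X, of i F] bd_rank_faces_0(1)[OF X, of F] bd_rank_faces_0(2)[OF X]
  by (auto simp: red_hom_def)

text \<open>For \<open>k \<ge> 2\<close> this would follow from the Betti numbers, but in the lowest degrees the reduced and
unreduced versions differ; the uniform argument is that the reduced boundaries of faces of size
\<open>k + 1\<close> lie in the kernel of the reduced boundary map on chains of size \<open>k\<close>.\<close>

lemma red_hom_nonneg:
  fixes X :: "'a::linorder set set" and F :: "'f::field itself"
  assumes X: "scomplex X"
  shows "red_hom F k X \<ge> 0"
proof -
  have fin: "finite X" using X by (simp add: scomplex_def)
  define R :: "('a set \<Rightarrow> 'f) \<Rightarrow> 'a set \<Rightarrow> 'f"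
    where "R = (\<lambda>c. \<Sum>\<tau>\<in>X. chain_scale (c \<tau>) (face_bd \<tau>))"
  have R: "Vector_Spaces.linear chain_scale chain_scale R"
    unfolding Vector_Spaces.linear_iff
  proof (intro conjI allI chain.vector_space_axioms)
    show "R (x + y) = R x + R y" for x y
      by (rule ext) (simp add: R_def sum_fun_apply chain_scale_def algebra_simps sum.distrib)
    show "R (chain_scale t x) = chain_scale t (R x)" for t x
      by (rule ext) (simp add: R_def sum_fun_apply chain_scale_def sum_distrib_left algebra_simps)
  qed
  have R_unit: "R (unit_chain \<tau>) = face_bd \<tau>" if "\<tau> \<in> X" for \<tau>
  proof
    fix \<sigma>
    have "R (unit_chain \<tau>) \<sigma> = (\<Sum>\<rho>\<in>X. if \<rho> = \<tau> then face_bd \<tau> \<sigma> else 0)"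
      unfolding R_def sum_fun_apply by (intro sum.cong refl) (simp add: chain_scale_def unit_chain_def)
    thus "R (unit_chain \<tau>) \<sigma> = face_bd \<tau> \<sigma>" using that fin by simp
  qed
  have face_bd_sum: "(face_bd \<tau> :: 'a set \<Rightarrow> 'f)
      = (\<Sum>v\<in>\<tau>. chain_scale ((-1) ^ card {w \<in> \<tau>. w < v}) (unit_chain (\<tau> - {v})))" if "finite \<tau>" for \<tau>
    by (rule ext) (simp add: face_bd_def sum_fun_apply chain_scale_def unit_chain_def if_distrib cong: if_cong)
  let ?V = "chain.span (unit_chain ` faces k X) :: ('a set \<Rightarrow> 'f) set"
  let ?K = "{c \<in> ?V. R c = 0}"
  let ?B = "chain.span (face_bd ` faces (Suc k) X) :: ('a set \<Rightarrow> 'f) set"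
  have "?K = ?V \<inter> {c. R c = 0}" by auto
  hence K: "chain.subspace ?K" using chain_maps.linear_subspace_kernel[OF R] by (simp add: chain.subspace_inter)
  have BK: "?B \<subseteq> ?K"
  proof (rule chain.span_minimal[OF _ K], rule subsetI)
    fix b :: "'a set \<Rightarrow> 'f" assume "b \<in> face_bd ` faces (Suc k) X"
    then obtain \<tau> where \<tau>: "\<tau> \<in> X" "card \<tau> = Suc k" "b = face_bd \<tau>" by (auto simp: faces_def)
    have ft: "finite \<tau>" using \<tau> card.infinite by fastforce
    have ridge: "\<tau> - {v} \<in> faces k X" if "v \<in> \<tau>" for v
      using that \<tau> X ft by (auto simp: faces_def scomplex_def)
    have "b \<in> ?V" unfolding \<tau>(3) face_bd_sum[OF ft]
      by (rule chain.span_sum, rule chain.span_scale, rule chain.span_base) (use ridge in blast)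
    moreover have "R b = 0"
    proof -
      have "R b = (\<Sum>v\<in>\<tau>. chain_scale ((-1) ^ card {w \<in> \<tau>. w < v}) (R (unit_chain (\<tau> - {v}))))"
        unfolding \<tau>(3) face_bd_sum[OF ft]
        by (simp only: chain_maps.linear_sum[OF R] chain_maps.linear_scale[OF R])
      also have "\<dots> = (\<Sum>v\<in>\<tau>. chain_scale ((-1) ^ card {w \<in> \<tau>. w < v}) (face_bd (\<tau> - {v})))"
        by (intro sum.cong refl) (use ridge R_unit in \<open>auto simp: faces_def\<close>)
      finally show ?thesis using face_bd_face_bd[OF ft, where ?'f = 'f] by simp
    qed
    ultimately show "b \<in> ?K" by simp
  qed
  have finU: "finite (unit_chain ` faces k X :: ('a set \<Rightarrow> 'f) set)" using fin by simp
  have "chain.dim ?V = chain.dim ?K + chain.dim (R ` ?V)"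
    by (rule chain_maps.rank_nullity_on_subspace[OF R chain.subspace_span order_refl finU])
  moreover have "R ` ?V = chain.span (face_bd ` faces k X)"
  proof -
    have "R ` unit_chain ` faces k X = face_bd ` faces k X"
      unfolding image_image by (intro image_cong refl) (auto simp: R_unit faces_def)
    thus ?thesis using chain_maps.linear_span_image[OF R, of "unit_chain ` faces k X"] by simp
  qed
  moreover obtain C :: "('a set \<Rightarrow> 'f) set" where "chain.dim ?K = chain.dim ?B + card C"
  proof (rule chain.complement_exists[OF chain.subspace_span K BK _ finU])
    show "?K \<subseteq> ?V" by blast
    fix C :: "('a set \<Rightarrow> 'f) set" assume "chain.dim ?K = chain.dim ?B + card C"
    thus thesis by (rule that)
  qed
  ultimately show ?thesis using dim_unit_chains[of "faces k X", where ?'f = 'f] fin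
    by (simp add: red_hom_def bd_rank_def)
qed

section \<open>Gluing in a simplex\<close>

text \<open>Here \<open>X\<close> contains exactly those faces of the simplex \<open>\<epsilon>\<close> that do not contain \<open>\<beta>\<close>, so that
adding the interval \<open>{\<beta>..\<epsilon>}\<close> to \<open>X\<close> glues in the whole simplex \<open>\<epsilon>\<close>. Every construction below
is such a gluing: half of a bistellar move, its traces on induced subcomplexes and on links, and one
step of building a stacked ball.\<close>

definition fillable :: "'a set set \<Rightarrow> 'a set \<Rightarrow> 'a set \<Rightarrow> bool" where
  "fillable X \<beta> \<epsilon> \<longleftrightarrow> scomplex X \<and> finite \<epsilon> \<and> \<beta> \<subseteq> \<epsilon> \<and> \<beta> \<notin> X \<and> (\<forall>v\<in>\<beta>. \<epsilon> - {v} \<in> X)"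

lemma scomplex_subset: "scomplex X \<Longrightarrow> \<sigma> \<in> X \<Longrightarrow> \<rho> \<subseteq> \<sigma> \<Longrightarrow> \<rho> \<in> X"
  by (auto simp: scomplex_def)

lemma scomplex_finite_face: "scomplex X \<Longrightarrow> \<sigma> \<in> X \<Longrightarrow> finite \<sigma>"
  by (auto simp: scomplex_def)

lemma scomplex_fill:
  assumes "fillable X \<beta> \<epsilon>"
  shows "scomplex (X \<union> {\<beta>..\<epsilon>})"
  unfolding scomplex_def
proof (intro conjI ballI allI impI)
  have X: "scomplex X" "finite \<epsilon>" and ridge: "\<And>v. v \<in> \<beta> \<Longrightarrow> \<epsilon> - {v} \<in> X"
    using assms by (auto simp: fillable_def)
  have "{\<beta>..\<epsilon>} \<subseteq> Pow \<epsilon>" by auto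
  thus "finite (X \<union> {\<beta>..\<epsilon>})" using X finite_subset by (auto simp: scomplex_def)
  show "{} \<in> X \<union> {\<beta>..\<epsilon>}" using X by (simp add: scomplex_def)
  fix \<sigma> assume \<sigma>: "\<sigma> \<in> X \<union> {\<beta>..\<epsilon>}"
  thus "finite \<sigma>" using X finite_subset by (auto simp: scomplex_def)
  fix \<rho> assume \<rho>: "\<rho> \<subseteq> \<sigma>"
  show "\<rho> \<in> X \<union> {\<beta>..\<epsilon>}"
  proof (cases "\<sigma> \<in> X \<or> \<beta> \<subseteq> \<rho>")
    case True thus ?thesis using \<sigma> \<rho> scomplex_subset[OF X(1)] by auto
  next
    case False
    then obtain v where "v \<in> \<beta>" "\<rho> \<subseteq> \<epsilon> - {v}" using \<sigma> \<rho> by auto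
    thus ?thesis using scomplex_subset[OF X(1) ridge] by blast
  qed
qed

text \<open>If \<open>\<beta> \<noteq> \<epsilon>\<close>, the simplex is glued along a ball, so nothing changes. With a vertex \<open>w\<close> of
\<open>\<epsilon>\<close> outside \<open>\<beta>\<close>, the interval \<open>{\<beta>..\<epsilon>}\<close> splits into \<open>{\<beta>..\<epsilon> - {w}}\<close> and
\<open>{insert w \<beta>..\<epsilon>}\<close>, two fillings that are again of this kind, down to the single pair of an elementary
expansion.\<close>

lemma red_hom_fill:
  assumes "fillable X \<beta> \<epsilon>" "\<beta> \<noteq> \<epsilon>"
  shows "red_hom F k (X \<union> {\<beta>..\<epsilon>}) = red_hom F k X"
  using assms
proof (induction "card (\<epsilon> - \<beta>)" arbitrary: X \<beta> \<epsilon> rule: less_induct)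
  case less
  have X: "scomplex X" "finite \<epsilon>" "\<beta> \<subseteq> \<epsilon>" "\<beta> \<notin> X" and ridge: "\<And>v. v \<in> \<beta> \<Longrightarrow> \<epsilon> - {v} \<in> X"
    using less.prems(1) by (auto simp: fillable_def)
  obtain w where w: "w \<in> \<epsilon>" "w \<notin> \<beta>" using X less.prems(2) by blast
  show ?case
  proof (cases "\<epsilon> - {w} = \<beta>")
    case True
    have "X \<union> {\<beta>..\<epsilon>} = insert \<epsilon> (insert (\<epsilon> - {w}) X)" using True w by auto
    thus ?thesis
      using red_hom_elementary_expansion[OF X(1,2) w(1), of F k] True X ridge by auto
  next
    case False
    let ?X1 = "X \<union> {\<beta>..\<epsilon> - {w}}"
    have fill1: "fillable X \<beta> (\<epsilon> - {w})"
      unfolding fillable_def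
    proof (intro conjI ballI)
      fix v assume "v \<in> \<beta>"
      show "\<epsilon> - {w} - {v} \<in> X" by (rule scomplex_subset[OF X(1) ridge[OF \<open>v \<in> \<beta>\<close>]]) auto
    qed (use X w in auto)
    have less1: "card (\<epsilon> - {w} - \<beta>) < card (\<epsilon> - \<beta>)"
      by (rule psubset_card_mono) (use X w in auto)
    have fill2: "fillable ?X1 (insert w \<beta>) \<epsilon>"
      using X w ridge scomplex_fill[OF fill1] scomplex_subset[OF X(1), of "insert w \<beta>" \<beta>]
      by (auto simp: fillable_def)
    have less2: "card (\<epsilon> - insert w \<beta>) < card (\<epsilon> - \<beta>)"
      by (rule psubset_card_mono) (use X w in auto)
    have eq: "X \<union> {\<beta>..\<epsilon>} = ?X1 \<union> {insert w \<beta>..\<epsilon>}" using w by auto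
    show ?thesis unfolding eq
      using less.hyps[OF less1 fill1] less.hyps[OF less2 fill2] False w X by auto
  qed
qed

lemma fillable_induced:
  assumes "fillable X \<beta> \<epsilon>" "\<beta> \<subseteq> A"
  shows "fillable (induced X A) \<beta> (\<epsilon> \<inter> A)"
proof -
  have X: "scomplex X" "finite \<epsilon>" "\<beta> \<subseteq> \<epsilon>" "\<beta> \<notin> X" and ridge: "\<And>v. v \<in> \<beta> \<Longrightarrow> \<epsilon> - {v} \<in> X"
    using assms(1) by (auto simp: fillable_def)
  have "\<epsilon> \<inter> A - {v} \<in> X" if "v \<in> \<beta>" for v
    by (rule scomplex_subset[OF X(1) ridge[OF that]]) auto
  moreover have "scomplex (induced X A)" using X(1) by (auto simp: scomplex_def induced_def)
  ultimately show ?thesis using X assms(2) by (simp add: fillable_def) (simp add: induced_def, blast)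
qed

lemma induced_fill: "induced (X \<union> {\<beta>..\<epsilon>}) A = induced X A \<union> (if \<beta> \<subseteq> A then {\<beta>..\<epsilon> \<inter> A} else {})"
  by (auto simp: induced_def)

lemma scomplex_induced: "scomplex X \<Longrightarrow> scomplex (induced X A)"
  by (auto simp: scomplex_def induced_def)

lemma scomplex_link:
  assumes "scomplex X" "\<gamma> \<in> X" shows "scomplex (link \<gamma> X)"
  unfolding scomplex_def
proof (intro conjI ballI allI impI)
  have "link \<gamma> X \<subseteq> X" using scomplex_subset[OF assms(1)] by (auto simp: link_def)
  thus "finite (link \<gamma> X)" using assms finite_subset by (auto simp: scomplex_def)
  show "{} \<in> link \<gamma> X" using assms by (simp add: link_def)
  fix \<sigma> assume \<sigma>: "\<sigma> \<in> link \<gamma> X"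
  thus "finite \<sigma>" using scomplex_finite_face[OF assms(1), of "\<gamma> \<union> \<sigma>"] by (auto simp: link_def)
  fix \<rho> assume "\<rho> \<subseteq> \<sigma>"
  thus "\<rho> \<in> link \<gamma> X" using \<sigma> scomplex_subset[OF assms(1), of "\<gamma> \<union> \<sigma>" "\<gamma> \<union> \<rho>"]
    by (auto simp: link_def)
qed

lemma fillable_link:
  assumes "fillable X \<beta> \<epsilon>" "\<gamma> \<in> X" "\<gamma> \<subseteq> \<epsilon>"
  shows "fillable (link \<gamma> X) (\<beta> - \<gamma>) (\<epsilon> - \<gamma>)"
  unfolding fillable_def
proof (intro conjI ballI)
  show "\<beta> - \<gamma> \<notin> link \<gamma> X"
    using assms scomplex_subset[of X "\<gamma> \<union> (\<beta> - \<gamma>)" \<beta>] by (auto simp: fillable_def link_def)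
  fix v assume v: "v \<in> \<beta> - \<gamma>"
  have "\<gamma> \<union> (\<epsilon> - \<gamma> - {v}) = \<epsilon> - {v}" using v assms by auto
  thus "\<epsilon> - \<gamma> - {v} \<in> link \<gamma> X" using v assms by (auto simp: link_def fillable_def)
qed (use assms scomplex_link in \<open>auto simp: fillable_def\<close>)

lemma link_fill:
  "link \<gamma> (X \<union> {\<beta>..\<epsilon>}) = link \<gamma> X \<union> (if \<gamma> \<subseteq> \<epsilon> then {\<beta> - \<gamma>..\<epsilon> - \<gamma>} else {})"
  by (auto simp: link_def)

section \<open>Homology spheres, acyclic complexes and Euler characteristic\<close>

text \<open>The index \<open>s\<close> is a size, so the sphere has dimension \<open>s - 1\<close>; \<open>s = 0\<close> is the complex \<open>{{}}\<close>.\<close>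

definition sphere_hom :: "'f::field itself \<Rightarrow> nat \<Rightarrow> 'a::linorder set set \<Rightarrow> bool" where
  "sphere_hom F s X \<longleftrightarrow> (\<forall>k. red_hom F k X = (if k = s then 1 else 0))"

definition acyclic_hom :: "'f::field itself \<Rightarrow> 'a::linorder set set \<Rightarrow> bool" where
  "acyclic_hom F X \<longleftrightarrow> (\<forall>k. red_hom F k X = 0)"

lemma bd_rank_empty [simp]: "bd_rank F {} = 0"
  using chain.dim_eq_card_independent[OF chain.independent_empty] by (simp add: bd_rank_def)

lemma face_bd_nonzero:
  assumes "finite \<tau>" "\<tau> \<noteq> {}" shows "face_bd \<tau> \<noteq> (0 :: 'a::linorder set \<Rightarrow> 'f::field)"
proof -
  obtain v where "v \<in> \<tau>" using assms by auto
  thus ?thesis using face_bd_at_ridge[OF assms(1), of v, where ?'f = 'f] by force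
qed

lemma scomplex_Pow: "finite \<epsilon> \<Longrightarrow> scomplex (Pow \<epsilon>)"
  by (auto simp: scomplex_def dest: finite_subset)

lemma acyclic_Pow:
  assumes "finite \<epsilon>" "\<epsilon> \<noteq> {}"
  shows "acyclic_hom F (Pow \<epsilon>)"
  using assms
proof (induction \<epsilon> rule: finite_ne_induct)
  case (singleton v)
  have "faces k (Pow {v}) = (if k = 0 then {{}} else if k = 1 then {{v}} else {})" for k
    by (auto simp: faces_def subset_singleton_iff)
  moreover have "bd_rank F {{}} = 0" using bd_rank_insert[of "{}" F "{}"] by (simp add: face_bd_empty)
  moreover have "bd_rank F {{v}} = 1" using bd_rank_insert[of "{}" F "{v}"] face_bd_nonzero[of "{v}"] by simp
  ultimately show ?case by (simp add: acyclic_hom_def red_hom_def)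
next
  case (insert w \<epsilon>)
  have "fillable (Pow \<epsilon>) {w} (insert w \<epsilon>)"
    using insert by (auto simp: fillable_def scomplex_Pow)
  moreover have "Pow (insert w \<epsilon>) = Pow \<epsilon> \<union> {{w}..insert w \<epsilon>}" by auto
  moreover have "{w} \<noteq> insert w \<epsilon>" using insert by auto
  ultimately show ?case using insert red_hom_fill unfolding acyclic_hom_def by metis
qed

lemma scomplex_simplex_bd: "finite \<epsilon> \<Longrightarrow> \<epsilon> \<noteq> {} \<Longrightarrow> scomplex (simplex_bd \<epsilon>)"
  unfolding scomplex_def simplex_bd_def
  by (auto intro: finite_subset[OF _ iffD2[OF finite_Pow_iff]] finite_subset)

lemma sphere_simplex_bd:
  assumes "finite \<epsilon>" "card \<epsilon> = Suc n"
  shows "sphere_hom F n (simplex_bd \<epsilon>)"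
proof -
  have ne: "\<epsilon> \<noteq> {}" using assms by auto
  have ins: "Pow \<epsilon> = insert \<epsilon> (simplex_bd \<epsilon>)" by (auto simp: simplex_bd_def)
  have fin: "finite (simplex_bd \<epsilon>)" using scomplex_simplex_bd[OF assms(1) ne] by (simp add: scomplex_def)
  have "faces j (simplex_bd \<epsilon>) = {}" if "j > n" for j
  proof (rule equals0I)
    fix \<rho> assume "\<rho> \<in> faces j (simplex_bd \<epsilon>)"
    hence "\<rho> \<subset> \<epsilon>" "card \<rho> = j" by (simp_all add: faces_def simplex_bd_def)
    thus False using psubset_card_mono[OF assms(1), of \<rho>] assms(2) that by simp
  qed
  hence top: "red_hom F (Suc n) (simplex_bd \<epsilon>) = 0" by (simp add: red_hom_def)
  have ac: "red_hom F k (insert \<epsilon> (simplex_bd \<epsilon>)) = 0" for k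
    using acyclic_Pow[OF assms(1) ne, of F] by (simp add: ins acyclic_hom_def)
  have "\<epsilon> \<notin> simplex_bd \<epsilon>" by (simp add: simplex_bd_def)
  from red_hom_attach_face[OF fin this assms(2), of F] show ?thesis
  proof
    assume "\<forall>k. red_hom F k (insert \<epsilon> (simplex_bd \<epsilon>)) = red_hom F k (simplex_bd \<epsilon>) + (if k = Suc n then 1 else 0)"
    from spec[OF this, of "Suc n"] have False using top ac[of "Suc n"] by simp
    thus ?thesis ..
  next
    assume "\<forall>k. red_hom F k (insert \<epsilon> (simplex_bd \<epsilon>)) = red_hom F k (simplex_bd \<epsilon>) - (if k = n then 1 else 0)"
    thus ?thesis unfolding sphere_hom_def ac by auto
  qed
qed

text \<open>Attaching a face to an acyclic complex can only create a cycle, as there is none to kill.\<close>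

lemma sphere_attach_acyclic:
  assumes "scomplex (insert \<beta> X)" "acyclic_hom F X" "\<beta> \<notin> X" "\<beta> \<noteq> {}"
  shows "sphere_hom F (card \<beta>) (insert \<beta> X)"
proof -
  have fin: "finite X" "finite \<beta>" using assms(1) by (auto simp: scomplex_def)
  then obtain n where n: "card \<beta> = Suc n" using assms(4) by (metis card_gt_0_iff gr0_implies_Suc)
  show ?thesis
    using red_hom_attach_face[OF fin(1) assms(3) n, of F] red_hom_nonneg[OF assms(1), of F n] assms(2) n
    by (auto simp: sphere_hom_def acyclic_hom_def)
qed

lemma sphere_hom_imp:
  assumes "scomplex X" "sphere_hom F s X"
  shows "homology_of_sphere F (int s - 1) X"
  unfolding homology_of_sphere_def
proof
  fix i
  have "int (betti F i X) = (if i = 0 \<and> int s - 1 \<ge> 0 then 1 else 0) + (if int i = int s - 1 then 1 else 0)"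
    using betti_eq_red_hom[OF assms(1), of F i] assms(2) by (auto simp: sphere_hom_def)
  thus "betti F i X = (if i = 0 \<and> int s - 1 \<ge> 0 then 1 else 0) + (if int i = int s - 1 then 1 else 0)"
    by (auto split: if_splits)
qed

lemma acyclic_hom_imp:
  assumes "scomplex X" "acyclic_hom F X"
  shows "homology_of_point F X"
  unfolding homology_of_point_def
proof
  fix i
  have "int (betti F i X) = (if i = 0 then 1 else 0)"
    using betti_eq_red_hom[OF assms(1), of F i] assms(2) by (simp add: acyclic_hom_def)
  thus "betti F i X = (if i = 0 then 1 else 0)" by (simp split: if_splits)
qed

lemma sphere_not_point:
  assumes "scomplex X" "sphere_hom F s X"
  shows "\<not> homology_of_point F X"
proof
  assume "homology_of_point F X"
  hence "int (betti F i X) = (if i = 0 then 1 else 0)" for i by (simp add: homology_of_point_def)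
  thus False using betti_eq_red_hom[OF assms(1), of F 0] betti_eq_red_hom[OF assms(1), of F "s - 1"] assms(2)
    by (auto simp: sphere_hom_def split: if_splits)
qed

text \<open>The Euler-Poincare formula, with reduced Euler characteristic up to sign on the left.\<close>

lemma euler_betti:
  assumes X: "scomplex X" and m: "\<And>\<sigma>. \<sigma> \<in> X \<Longrightarrow> card \<sigma> \<le> m"
  shows "(\<Sum>\<sigma>\<in>X. (-1) ^ card \<sigma>) = 1 - (\<Sum>i<m. (-1) ^ i * int (betti F i X))"
proof -
  have fin: "finite X" using X by (simp add: scomplex_def)
  have "(\<Sum>i<j. (-1) ^ i * int (betti F i X)) = (\<Sum>i<j. (-1) ^ i * int (card (faces (Suc i) X)))
      + (if j = 0 then 0 else (-1) ^ j * int (bd_rank F (faces (Suc j) X)))" for j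
  proof (induction j)
    case (Suc j)
    have b: "int (betti F j X) = int (card (faces (Suc j) X)) - int (bd_rank F (faces (Suc (Suc j)) X))
       - (if j = 0 then 0 else int (bd_rank F (faces (Suc j) X)))"
      using betti_plus_ranks[OF X, of j F] by auto
    show ?case using Suc by (auto simp: b algebra_simps)
  qed simp
  moreover have "faces (Suc m) X = {}" using m by (fastforce simp: faces_def)
  ultimately have *: "(\<Sum>i<m. (-1) ^ i * int (betti F i X)) = (\<Sum>i<m. (-1) ^ i * int (card (faces (Suc i) X)))"
    by simp
  have "(\<Sum>\<sigma>\<in>X. (-1) ^ card \<sigma>) = (\<Sum>j\<in>{..m}. \<Sum>\<sigma>\<in>{\<sigma>\<in>X. card \<sigma> = j}. (-1) ^ card \<sigma> :: int)"
    using m fin by (intro sum.group[symmetric]) auto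
  also have "\<dots> = (\<Sum>j\<le>m. (-1) ^ j * int (card (faces j X)))"
    by (intro sum.cong refl) (simp add: faces_def)
  also have "\<dots> = int (card (faces 0 X)) - (\<Sum>i<m. (-1) ^ i * int (card (faces (Suc i) X)))"
    by (subst sum.atMost_shift) (simp add: sum_negf)
  finally show ?thesis using * bd_rank_faces_0(2)[OF X] by simp
qed

lemma finite_interval_set: "finite \<epsilon> \<Longrightarrow> finite {\<beta>..\<epsilon> :: 'a set}"
  by (rule finite_subset[of _ "Pow \<epsilon>"]) auto

section \<open>Beta weights of vertex subsets\<close>

text \<open>Up to the factor \<open>card W + 1\<close> this is the weight of \<open>A\<close> in the sigma-numbers. It equals the
integral of \<open>x^a (1 - x)^b\<close> over the unit interval, with \<open>a\<close> and \<open>b\<close> the sizes of \<open>A\<close> and of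
its complement, which is the Beta integral \<open>beta_weight a b\<close>.\<close>

definition subset_weight :: "'a set \<Rightarrow> 'a set \<Rightarrow> real" where
  "subset_weight W A = 1 / (real (card W + 1) * real (card W choose card A))"

definition beta_weight :: "nat \<Rightarrow> nat \<Rightarrow> real" where
  "beta_weight a b = fact a * fact b / fact (a + b + 1)"

lemma beta_weight_commute: "beta_weight a b = beta_weight b a"
  by (simp add: beta_weight_def add.commute mult.commute)

lemma beta_weight_binomial:
  assumes "k \<le> n" shows "beta_weight k (n - k) = 1 / (real (n + 1) * real (n choose k))"
proof -
  have "real (n choose k) = fact n / (fact k * fact (n - k))" using assms by (rule binomial_fact)
  moreover have "fact (k + (n - k) + 1) = (real (n + 1) * fact n :: real)" using assms by simp
  ultimately show ?thesis unfolding beta_weight_def by simp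
qed

lemma beta_weight_split: "beta_weight (Suc a) b + beta_weight a (Suc b) = beta_weight a b"
proof -
  have "beta_weight (Suc a) b = beta_weight a b * (real (a + 1) / real (a + b + 2))"
    "beta_weight a (Suc b) = beta_weight a b * (real (b + 1) / real (a + b + 2))"
    by (simp_all add: beta_weight_def divide_simps)
  hence "beta_weight (Suc a) b + beta_weight a (Suc b)
      = beta_weight a b * (real (a + 1) / real (a + b + 2) + real (b + 1) / real (a + b + 2))"
    by (simp only: distrib_left)
  also have "real (a + 1) / real (a + b + 2) + real (b + 1) / real (a + b + 2) = 1"
    unfolding add_divide_distrib[symmetric] by simp
  finally show ?thesis by simp
qed

text \<open>As a Beta integral, the sum is the probability that a random subset contains \<open>\<beta>\<close> and
avoids \<open>\<alpha>\<close>, averaged over the density \<open>x\<close>; it therefore depends on \<open>\<alpha>\<close> and \<open>\<beta>\<close> only, not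
on \<open>W\<close>. This is what makes complexes with different vertex sets comparable. The induction decides
the remaining vertices one at a time.\<close>

lemma sum_subset_weight:
  assumes "finite W" "\<alpha> \<subseteq> W" "\<beta> \<subseteq> W" "\<alpha> \<inter> \<beta> = {}"
  shows "(\<Sum>A\<in>{\<beta>..W - \<alpha>}. subset_weight W A) = beta_weight (card \<alpha>) (card \<beta>)"
  using assms
proof (induction "card (W - \<alpha> - \<beta>)" arbitrary: \<alpha> \<beta> rule: less_induct)
  case less
  have fin: "finite \<alpha>" "finite \<beta>" using less.prems(1-3) by (auto intro: finite_subset)
  show ?case
  proof (cases "W - \<alpha> - \<beta> = {}")
    case True
    hence W: "W - \<alpha> = \<beta>" using less.prems by blast
    have "card W = card \<alpha> + card \<beta>" using less.prems W fin by (metis card_Diff_subset card_mono le_add_diff_inverse)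
    thus ?thesis unfolding W using beta_weight_binomial[of "card \<beta>" "card W"]
      by (simp add: subset_weight_def beta_weight_commute)
  next
    case False
    then obtain x where x: "x \<in> W" "x \<notin> \<alpha>" "x \<notin> \<beta>" by blast
    have l: "card (W - insert x \<alpha> - \<beta>) < card (W - \<alpha> - \<beta>)" "card (W - \<alpha> - insert x \<beta>) < card (W - \<alpha> - \<beta>)"
      by (rule psubset_card_mono; use less.prems x in auto)+
    have "{\<beta>..W - \<alpha>} = {\<beta>..W - insert x \<alpha>} \<union> {insert x \<beta>..W - \<alpha>}" using x by auto
    moreover have "finite {\<beta>..W - \<alpha>}" using less.prems(1) by (simp add: finite_interval_set)
    moreover have "{\<beta>..W - insert x \<alpha>} \<inter> {insert x \<beta>..W - \<alpha>} = {}" by auto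
    ultimately have "(\<Sum>A\<in>{\<beta>..W - \<alpha>}. subset_weight W A) = (\<Sum>A\<in>{\<beta>..W - insert x \<alpha>}. subset_weight W A)
       + (\<Sum>A\<in>{insert x \<beta>..W - \<alpha>}. subset_weight W A)"
      by (metis finite_Un sum.union_disjoint)
    also have "\<dots> = beta_weight (card (insert x \<alpha>)) (card \<beta>) + beta_weight (card \<alpha>) (card (insert x \<beta>))"
      using less.hyps[OF l(1)] less.hyps[OF l(2)] less.prems x by simp
    also have "\<dots> = beta_weight (card \<alpha>) (card \<beta>)" using x fin beta_weight_split by simp
    finally show ?thesis .
  qed
qed

section \<open>The g-numbers as sums over faces\<close>

lemma alternating_binomial_sum:
  assumes "finite \<epsilon>"
  shows "(\<Sum>\<gamma>\<in>Pow \<epsilon>. (-1) ^ card \<gamma> * int ((card \<epsilon> - card \<gamma>) choose k)) = (if k = card \<epsilon> then 1 else 0)"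
  using assms
proof (induction \<epsilon> arbitrary: k rule: finite_induct)
  case empty thus ?case by simp
next
  case (insert x \<epsilon>)
  have inj: "inj_on (insert x) (Pow \<epsilon>)" using insert by (intro inj_onI) (metis PowD insert_ident subsetD)
  let ?t = "\<lambda>m k \<gamma>. (-1) ^ card \<gamma> * int ((m - card \<gamma>) choose k)"
  have "(\<Sum>\<gamma>\<in>Pow (insert x \<epsilon>). ?t (card (insert x \<epsilon>)) k \<gamma>)
      = (\<Sum>\<gamma>\<in>Pow \<epsilon>. ?t (Suc (card \<epsilon>)) k \<gamma>) + (\<Sum>\<gamma>\<in>insert x ` Pow \<epsilon>. ?t (Suc (card \<epsilon>)) k \<gamma>)"
    unfolding Pow_insert using insert by (subst sum.union_disjoint) auto
  also have "(\<Sum>\<gamma>\<in>insert x ` Pow \<epsilon>. ?t (Suc (card \<epsilon>)) k \<gamma>) = (\<Sum>\<gamma>\<in>Pow \<epsilon>. - ?t (card \<epsilon>) k \<gamma>)"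
  proof (subst sum.reindex[OF inj], intro sum.cong refl)
    fix \<gamma> assume "\<gamma> \<in> Pow \<epsilon>"
    hence "x \<notin> \<gamma>" "finite \<gamma>" using insert finite_subset by auto
    thus "(?t (Suc (card \<epsilon>)) k \<circ> insert x) \<gamma> = - ?t (card \<epsilon>) k \<gamma>" by simp
  qed
  also have "(\<Sum>\<gamma>\<in>Pow \<epsilon>. ?t (Suc (card \<epsilon>)) k \<gamma>) + (\<Sum>\<gamma>\<in>Pow \<epsilon>. - ?t (card \<epsilon>) k \<gamma>)
      = (\<Sum>\<gamma>\<in>Pow \<epsilon>. case k of 0 \<Rightarrow> 0 | Suc k' \<Rightarrow> ?t (card \<epsilon>) k' \<gamma>)"
    unfolding sum.distrib[symmetric]
  proof (intro sum.cong refl)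
    fix \<gamma> assume "\<gamma> \<in> Pow \<epsilon>"
    hence "card \<gamma> \<le> card \<epsilon>" using insert by (auto intro: card_mono)
    thus "?t (Suc (card \<epsilon>)) k \<gamma> + - ?t (card \<epsilon>) k \<gamma> = (case k of 0 \<Rightarrow> 0 | Suc k' \<Rightarrow> ?t (card \<epsilon>) k' \<gamma>)"
      by (cases k) (simp_all add: Suc_diff_le algebra_simps)
  qed
  also have "\<dots> = (if k = card (insert x \<epsilon>) then 1 else 0)"
    using insert by (cases k) simp_all
  finally show ?case .
qed

text \<open>The g-number of a complex of dimension \<open>N - 2\<close>, written as a sum over faces. In contrast to
\<^const>\<open>g_number\<close>, the parameter \<open>N\<close> does not depend on \<open>X\<close>, so the expression is additive
and can be evaluated on sets of faces that are not complexes, and on balls of one dimension more.\<close>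

definition g_sum :: "nat \<Rightarrow> nat \<Rightarrow> 'a set set \<Rightarrow> int" where
  "g_sum N j X = (\<Sum>\<gamma>\<in>X. (-1) ^ (j + card \<gamma>) * int ((N - card \<gamma>) choose (N - j)))"

text \<open>The interval is a Boolean lattice, on which the alternating binomial sum is concentrated in
one degree.\<close>

lemma g_sum_interval:
  assumes "finite \<epsilon>" "\<beta> \<subseteq> \<epsilon>" "j \<le> card \<epsilon>"
  shows "g_sum (card \<epsilon>) j {\<beta>..\<epsilon>} = (if j = card \<beta> then 1 else 0)"
proof -
  let ?\<alpha> = "\<epsilon> - \<beta>"
  have fin: "finite ?\<alpha>" "finite \<beta>" using assms finite_subset by auto
  have c: "card \<epsilon> = card \<beta> + card ?\<alpha>" using assms fin by (metis card_Diff_subset card_mono le_add_diff_inverse)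
  have "{\<beta>..\<epsilon>} = (\<lambda>\<gamma>. \<beta> \<union> \<gamma>) ` Pow ?\<alpha>"
  proof (intro equalityI subsetI)
    fix \<delta> assume "\<delta> \<in> {\<beta>..\<epsilon>}"
    hence "\<delta> = \<beta> \<union> (\<delta> - \<beta>)" "\<delta> - \<beta> \<in> Pow ?\<alpha>" by auto
    thus "\<delta> \<in> (\<lambda>\<gamma>. \<beta> \<union> \<gamma>) ` Pow ?\<alpha>" by blast
  qed (use assms in auto)
  moreover have "inj_on (\<lambda>\<gamma>. \<beta> \<union> \<gamma>) (Pow ?\<alpha>)" by (auto simp: inj_on_def)
  ultimately have "g_sum (card \<epsilon>) j {\<beta>..\<epsilon>}
      = (\<Sum>\<gamma>\<in>Pow ?\<alpha>. (-1) ^ (j + card (\<beta> \<union> \<gamma>)) * int ((card \<epsilon> - card (\<beta> \<union> \<gamma>)) choose (card \<epsilon> - j)))"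
    by (simp add: g_sum_def sum.reindex)
  also have "\<dots> = (\<Sum>\<gamma>\<in>Pow ?\<alpha>. (-1) ^ (j + card \<beta>) * ((-1) ^ card \<gamma> * int ((card ?\<alpha> - card \<gamma>) choose (card \<epsilon> - j))))"
  proof (intro sum.cong refl)
    fix \<gamma> assume "\<gamma> \<in> Pow ?\<alpha>"
    hence "\<beta> \<inter> \<gamma> = {}" "finite \<gamma>" using fin finite_subset by auto
    hence "card (\<beta> \<union> \<gamma>) = card \<beta> + card \<gamma>" using fin by (simp add: card_Un_disjoint)
    thus "(-1) ^ (j + card (\<beta> \<union> \<gamma>)) * int ((card \<epsilon> - card (\<beta> \<union> \<gamma>)) choose (card \<epsilon> - j))
      = (-1) ^ (j + card \<beta>) * ((-1) ^ card \<gamma> * int ((card ?\<alpha> - card \<gamma>) choose (card \<epsilon> - j)))"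
      using c by (simp add: power_add)
  qed
  also have "\<dots> = (-1) ^ (j + card \<beta>) * (if card \<epsilon> - j = card ?\<alpha> then 1 else 0)"
    unfolding sum_distrib_left[symmetric] alternating_binomial_sum[OF fin(1)] ..
  also have "\<dots> = (if j = card \<beta> then 1 else 0)"
    using c assms(3) by (auto simp flip: mult_2 simp: power_mult)
  finally show ?thesis .
qed

lemma g_sum_Un:
  assumes "finite X" "finite Y" "X \<inter> Y = {}" shows "g_sum N j (X \<union> Y) = g_sum N j X + g_sum N j Y"
  unfolding g_sum_def using assms by (rule sum.union_disjoint)

lemma g_number_eq_g_sum:
  assumes X: "scomplex X" and d: "cdim X = int N - 2" and card: "\<And>\<gamma>. \<gamma> \<in> X \<Longrightarrow> card \<gamma> \<le> N" and j: "j \<le> N"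
  shows "g_number j X = g_sum N j X"
proof -
  have fin: "finite X" using X by (simp add: scomplex_def)
  have "g_number j X = (\<Sum>s\<in>{..j}. (-1) ^ (j - s) * int ((N - s) choose (j - s)) * int (card (faces s X)))"
    unfolding g_number_def
  proof (rule sum.reindex_bij_witness[of _ "\<lambda>s. int s - 1" "\<lambda>i. nat (i + 1)"])
    fix i assume i: "i \<in> {- 1..int j - 1}"
    hence "{\<alpha> \<in> X. face_dim \<alpha> = i} = faces (nat (i + 1)) X" by (auto simp: faces_def face_dim_def)
    moreover have "nat (int j - i - 1) = j - nat (i + 1)" "nat (cdim X - i + 1) = N - nat (i + 1)"
      using i d j by auto
    ultimately show "(-1) ^ (j - nat (i + 1)) * int ((N - nat (i + 1)) choose (j - nat (i + 1))) * int (card (faces (nat (i + 1)) X))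
      = (-1) ^ nat (int j - i - 1) * int (nat (cdim X - i + 1) choose nat (int j - i - 1)) * int (face_number i X)"
      by (simp add: face_number_def)
  qed auto
  also have "\<dots> = (\<Sum>s\<in>{..j}. \<Sum>\<gamma>\<in>{\<gamma>\<in>X. card \<gamma> = s}. (-1) ^ (j + card \<gamma>) * int ((N - card \<gamma>) choose (N - j)))"
  proof (intro sum.cong refl)
    fix s assume s: "s \<in> {..j}"
    have "(N - s) choose (j - s) = (N - s) choose (N - j)"
      using s j binomial_symmetric[of "j - s" "N - s"] by simp
    moreover have "(-1 :: int) ^ (j - s) = (-1) ^ (j + s)" using s by (simp add: minus_one_power_iff)
    ultimately show "(-1) ^ (j - s) * int ((N - s) choose (j - s)) * int (card (faces s X))
       = (\<Sum>\<gamma>\<in>{\<gamma>\<in>X. card \<gamma> = s}. (-1) ^ (j + card \<gamma>) * int ((N - card \<gamma>) choose (N - j)))"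
      by (simp add: faces_def)
  qed
  also have "\<dots> = (\<Sum>\<gamma>\<in>{\<gamma>\<in>X. card \<gamma> \<le> j}. (-1) ^ (j + card \<gamma>) * int ((N - card \<gamma>) choose (N - j)))"
  proof -
    let ?h = "\<lambda>\<gamma>. (-1) ^ (j + card \<gamma>) * int ((N - card \<gamma>) choose (N - j))" and ?X = "{\<gamma>\<in>X. card \<gamma> \<le> j}"
    have "sum ?h ?X = (\<Sum>s\<in>{..j}. sum ?h {\<gamma>\<in>?X. card \<gamma> = s})"
      using fin by (intro sum.group[symmetric]) auto
    also have "\<dots> = (\<Sum>s\<in>{..j}. sum ?h {\<gamma>\<in>X. card \<gamma> = s})"
      by (intro sum.cong) auto
    finally show ?thesis ..
  qed
  also have "\<dots> = g_sum N j X"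
    unfolding g_sum_def 
  proof (intro sum.mono_neutral_left ballI)
    fix \<gamma> assume "\<gamma> \<in> X - {\<gamma>\<in>X. card \<gamma> \<le> j}"
    hence "j < card \<gamma>" "card \<gamma> \<le> N" using card by auto
    hence "N - card \<gamma> < N - j" by linarith
    thus "(-1) ^ (j + card \<gamma>) * int ((N - card \<gamma>) choose (N - j)) = 0" by simp
  qed (use fin in auto)
  finally show ?thesis .
qed

section \<open>Bistellar moves as flips\<close>

text \<open>A bistellar move with the two complexes in symmetric roles: filling the simplex
\<open>\<alpha> \<union> \<beta>\<close> into either of them gives the same complex. Every statement about the passage from
\<open>X\<close> to this common complex thus applies to \<open>Y\<close> as well.\<close>

definition flip :: "'a set set \<Rightarrow> 'a set set \<Rightarrow> 'a set \<Rightarrow> 'a set \<Rightarrow> bool" where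
  "flip X Y \<alpha> \<beta> \<longleftrightarrow> \<alpha> \<inter> \<beta> = {} \<and> fillable X \<beta> (\<alpha> \<union> \<beta>) \<and> fillable Y \<alpha> (\<alpha> \<union> \<beta>) \<and>
     X \<union> {\<beta>..\<alpha> \<union> \<beta>} = Y \<union> {\<alpha>..\<alpha> \<union> \<beta>}"

lemma cjoin_full_bd:
  assumes "\<alpha> \<inter> \<beta> = {}"
  shows "cjoin (full_simplex \<alpha>) (simplex_bd \<beta>) = {\<delta>. \<delta> \<subseteq> \<alpha> \<union> \<beta> \<and> \<not> \<beta> \<subseteq> \<delta>}"
proof (intro equalityI subsetI)
  fix \<delta> assume "\<delta> \<in> cjoin (full_simplex \<alpha>) (simplex_bd \<beta>)"
  then obtain a b where "\<delta> = a \<union> b" "a \<subseteq> \<alpha>" "b \<subset> \<beta>"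
    by (auto simp: cjoin_def full_simplex_def simplex_bd_def)
  thus "\<delta> \<in> {\<delta>. \<delta> \<subseteq> \<alpha> \<union> \<beta> \<and> \<not> \<beta> \<subseteq> \<delta>}" using assms by blast
next
  fix \<delta> assume "\<delta> \<in> {\<delta>. \<delta> \<subseteq> \<alpha> \<union> \<beta> \<and> \<not> \<beta> \<subseteq> \<delta>}"
  hence "\<delta> = (\<delta> \<inter> \<alpha>) \<union> (\<delta> \<inter> \<beta>)" "\<delta> \<inter> \<alpha> \<subseteq> \<alpha>" "\<delta> \<inter> \<beta> \<subset> \<beta>" "(\<delta> \<inter> \<alpha>) \<inter> (\<delta> \<inter> \<beta>) = {}" using assms by blast+
  thus "\<delta> \<in> cjoin (full_simplex \<alpha>) (simplex_bd \<beta>)"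
    unfolding cjoin_def full_simplex_def simplex_bd_def by blast
qed

text \<open>The result of a move on an arbitrary complex need not be a complex, since \<open>\<alpha>\<close> may lie in faces
outside the part that is replaced. If it is a complex, then no such faces exist.\<close>

lemma flip_bistellar_move:
  assumes adm: "admits_move d X \<alpha> \<beta>" and Y: "scomplex (bistellar_move X \<alpha> \<beta>)"
  shows "flip X (bistellar_move X \<alpha> \<beta>) \<alpha> \<beta>"
proof -
  let ?Y = "bistellar_move X \<alpha> \<beta>" and ?\<epsilon> = "\<alpha> \<union> \<beta>"
  have fin: "finite \<alpha>" "finite \<beta>" "\<alpha> \<noteq> {}" "\<beta> \<noteq> {}" "\<alpha> \<inter> \<beta> = {}" and X: "scomplex X"
    and ind: "induced X ?\<epsilon> = cjoin (full_simplex \<alpha>) (simplex_bd \<beta>)"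
    using adm by (auto simp: admits_move_def)
  have disj': "\<beta> \<inter> \<alpha> = {}" using fin by blast
  have inX: "\<delta> \<in> X \<longleftrightarrow> \<not> \<beta> \<subseteq> \<delta>" if "\<delta> \<subseteq> ?\<epsilon>" for \<delta>
    using ind that unfolding cjoin_full_bd[OF fin(5)] induced_def by blast
  have Y_eq: "?Y = (X - {\<delta>. \<delta> \<subseteq> ?\<epsilon> \<and> \<not> \<beta> \<subseteq> \<delta>}) \<union> {\<delta>. \<delta> \<subseteq> ?\<epsilon> \<and> \<not> \<alpha> \<subseteq> \<delta>}"
    unfolding bistellar_move_def cjoin_full_bd[OF fin(5)] cjoin_full_bd[OF disj'] by (simp add: Un_commute)
  have inY: "\<delta> \<in> ?Y \<longleftrightarrow> \<not> \<alpha> \<subseteq> \<delta>" if "\<delta> \<subseteq> ?\<epsilon>" for \<delta>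
    using that inX[OF that] unfolding Y_eq by blast
  have "fillable X \<beta> ?\<epsilon>"
    unfolding fillable_def
  proof (intro conjI ballI)
    fix v assume "v \<in> \<beta>"
    thus "?\<epsilon> - {v} \<in> X" using inX[of "?\<epsilon> - {v}"] by blast
  qed (use fin X inX[of \<beta>] in simp_all)
  moreover have "fillable ?Y \<alpha> ?\<epsilon>"
    unfolding fillable_def
  proof (intro conjI ballI)
    fix v assume "v \<in> \<alpha>"
    thus "?\<epsilon> - {v} \<in> ?Y" using inY[of "?\<epsilon> - {v}"] by blast
  qed (use fin Y inY[of \<alpha>] in simp_all)
  moreover have "X \<union> {\<beta>..?\<epsilon>} = ?Y \<union> {\<alpha>..?\<epsilon>}"
  proof (rule Set.set_eqI)
    fix \<delta>
    show "\<delta> \<in> X \<union> {\<beta>..?\<epsilon>} \<longleftrightarrow> \<delta> \<in> ?Y \<union> {\<alpha>..?\<epsilon>}"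
    proof (cases "\<delta> \<subseteq> ?\<epsilon>")
      case True
      hence "\<delta> \<in> {\<beta>..?\<epsilon>} \<longleftrightarrow> \<beta> \<subseteq> \<delta>" "\<delta> \<in> {\<alpha>..?\<epsilon>} \<longleftrightarrow> \<alpha> \<subseteq> \<delta>" by simp_all
      thus ?thesis using inX[OF True] inY[OF True] by blast
    next
      case False thus ?thesis unfolding Y_eq by auto
    qed
  qed
  ultimately show ?thesis using fin by (simp add: flip_def)
qed

lemma g_sum_flip:
  assumes "flip X Y \<alpha> \<beta>" "card \<alpha> + card \<beta> = N" "j \<le> N"
  shows "g_sum N j Y = g_sum N j X + (if j = card \<beta> then 1 else 0) - (if j = card \<alpha> then 1 else 0)"
proof -
  let ?\<epsilon> = "\<alpha> \<union> \<beta>"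
  have X: "scomplex X" "\<beta> \<notin> X" and Y: "scomplex Y" "\<alpha> \<notin> Y" and fin: "finite ?\<epsilon>" and disj: "\<alpha> \<inter> \<beta> = {}"
    and eq: "X \<union> {\<beta>..?\<epsilon>} = Y \<union> {\<alpha>..?\<epsilon>}"
    using assms(1) by (auto simp: flip_def fillable_def)
  have N: "card ?\<epsilon> = N" using fin disj assms(2) by (simp add: card_Un_disjoint)
  have finI: "finite {\<gamma>..?\<epsilon>}" for \<gamma> using fin by (rule finite_interval_set)
  have "g_sum N j (X \<union> {\<beta>..?\<epsilon>}) = g_sum N j X + g_sum N j {\<beta>..?\<epsilon>}"
    using X scomplex_subset[OF X(1)] finI by (intro g_sum_Un) (auto simp: scomplex_def)
  moreover have "g_sum N j (Y \<union> {\<alpha>..?\<epsilon>}) = g_sum N j Y + g_sum N j {\<alpha>..?\<epsilon>}"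
    using Y scomplex_subset[OF Y(1)] finI by (intro g_sum_Un) (auto simp: scomplex_def)
  moreover have "g_sum N j {\<beta>..?\<epsilon>} = (if j = card \<beta> then 1 else 0)"
    "g_sum N j {\<alpha>..?\<epsilon>} = (if j = card \<alpha> then 1 else 0)"
    using g_sum_interval[OF fin, of \<beta> j] g_sum_interval[OF fin, of \<alpha> j] assms(3) N by auto
  ultimately show ?thesis using eq by simp
qed

lemma g_sum_simplex_bd:
  assumes "finite \<epsilon>" "card \<epsilon> = N" "j < N"
  shows "g_sum N j (simplex_bd \<epsilon>) = (if j = 0 then 1 else 0)"
proof -
  have "{{}..\<epsilon>} = simplex_bd \<epsilon> \<union> {\<epsilon>}" by (auto simp: simplex_bd_def)
  moreover have "finite (simplex_bd \<epsilon>)"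
    by (rule finite_subset[of _ "Pow \<epsilon>"]) (use assms(1) in \<open>auto simp: simplex_bd_def\<close>)
  moreover have "simplex_bd \<epsilon> \<inter> {\<epsilon>} = {}" by (auto simp: simplex_bd_def)
  ultimately have "g_sum N j {{}..\<epsilon>} = g_sum N j (simplex_bd \<epsilon>) + g_sum N j {\<epsilon>}"
    by (simp only: g_sum_Un finite.intros)
  moreover have "g_sum N j {\<epsilon>} = 0" using assms by (simp add: g_sum_def)
  ultimately show ?thesis using g_sum_interval[of \<epsilon> "{}" j] assms by simp
qed

section \<open>Effect of a flip on the weighted Morse sums\<close>

text \<open>The alternating sum of Betti numbers that occurs in the strong Morse inequalities; written with
sizes, for \<open>l \<ge> 1\<close> it involves the reduced Betti numbers in dimensions below \<open>l\<close>, see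
\<open>morse_eq_red_betti\<close>.\<close>

definition morse :: "'f::field itself \<Rightarrow> nat \<Rightarrow> 'a::linorder set set \<Rightarrow> int" where
  "morse F l X = (\<Sum>k\<le>l. (-1) ^ (l - k) * red_hom F k X)"

text \<open>The contribution of a vertex link \<open>X\<close> with vertex set \<open>W\<close> to the alternating sum of
mu-numbers. A larger \<open>W\<close> is allowed so that one set serves for a whole sequence of moves.\<close>

definition weighted_morse :: "'f::field itself \<Rightarrow> 'a::linorder set \<Rightarrow> nat \<Rightarrow> 'a set set \<Rightarrow> real" where
  "weighted_morse F W l X = (\<Sum>A\<in>Pow W. subset_weight W A * of_int (morse F l (induced X A)))"

text \<open>The upper bound for \<^const>\<open>weighted_morse\<close>. Its sum over all vertex links telescopes to the
right-hand side of the theorem, see \<open>sum_g_bound_links\<close>.\<close>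

definition g_bound :: "nat \<Rightarrow> nat \<Rightarrow> 'a set set \<Rightarrow> real" where
  "g_bound N l X = (\<Sum>j\<le>l. (-1) ^ (l - j) * of_int (g_sum N j X) * beta_weight j (N - j))"

lemma morse_fill_interval:
  assumes "fillable X \<beta> \<epsilon>" "\<beta> \<noteq> \<epsilon>"
  shows "morse F l (X \<union> {\<beta>..\<epsilon>}) = morse F l X"
  by (simp add: morse_def red_hom_fill[OF assms])

text \<open>Below the cut-off both possible effects of a new face change the alternating sum by the same
amount. At the cut-off a cycle may be killed without compensation, and above it nothing is seen.\<close>

lemma morse_attach_face:
  assumes X: "finite X" "\<beta> \<notin> X" and \<beta>: "finite \<beta>" "\<beta> \<noteq> {}"
  shows "card \<beta> \<le> l \<Longrightarrow> morse F l (insert \<beta> X) = morse F l X + (-1) ^ (l - card \<beta>)"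
    and "card \<beta> > l \<Longrightarrow> morse F l (insert \<beta> X) \<le> morse F l X"
    and "card \<beta> \<ge> l + 2 \<Longrightarrow> morse F l (insert \<beta> X) = morse F l X"
proof -
  obtain n where n: "card \<beta> = Suc n" using \<beta> by (metis card_gt_0_iff gr0_implies_Suc)
  have sum1: "(\<Sum>k\<le>l. (-1) ^ (l - k) * (r k + (if k = m then c else 0)))
     = (\<Sum>k\<le>l. (-1) ^ (l - k) * r k) + (if m \<le> l then (-1) ^ (l - m) * c else 0 :: int)" for m r c
  proof -
    have "(\<Sum>k\<le>l. (-1) ^ (l - k) * (r k + (if k = m then c else 0)))
      = (\<Sum>k\<le>l. (-1) ^ (l - k) * r k + (if k = m then (-1) ^ (l - m) * c else 0))"
      by (intro sum.cong refl) (simp add: distrib_left)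
    thus ?thesis by (simp add: sum.distrib)
  qed
  consider "\<forall>k. red_hom F k (insert \<beta> X) = red_hom F k X + (if k = Suc n then 1 else 0)"
    | "\<forall>k. red_hom F k (insert \<beta> X) = red_hom F k X + (if k = n then - 1 else 0)"
    using red_hom_attach_face[OF X n, of F] by fastforce
  hence *: "morse F l (insert \<beta> X) = morse F l X + (if Suc n \<le> l then (-1) ^ (l - Suc n) else 0) \<or>
        morse F l (insert \<beta> X) = morse F l X + (if n \<le> l then (-1) ^ (l - n) * (-1) else 0)"
    by cases (simp_all add: morse_def sum1)
  show "morse F l (insert \<beta> X) = morse F l X + (-1) ^ (l - card \<beta>)" if "card \<beta> \<le> l"
  proof -
    have "l - n = Suc (l - Suc n)" "n \<le> l" "Suc n \<le> l" using that n by auto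
    thus ?thesis using * n by auto
  qed
  show "morse F l (insert \<beta> X) \<le> morse F l X" if "card \<beta> > l"
    using * that n by (auto simp: le_less_Suc_eq)
  show "morse F l (insert \<beta> X) = morse F l X" if "card \<beta> \<ge> l + 2"
    using * that n by auto
qed

lemma induced_simplex_bd:
  assumes "fillable X \<beta> \<epsilon>" shows "induced X \<beta> = simplex_bd \<beta>"
proof (intro equalityI subsetI)
  fix \<rho> assume "\<rho> \<in> simplex_bd \<beta>"
  then obtain v where v: "v \<in> \<beta>" "\<rho> \<subseteq> \<epsilon> - {v}" "\<rho> \<subseteq> \<beta>" using assms by (auto simp: simplex_bd_def fillable_def)
  thus "\<rho> \<in> induced X \<beta>" using assms scomplex_subset[of X "\<epsilon> - {v}" \<rho>] by (auto simp: fillable_def induced_def)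
next
  fix \<rho> assume "\<rho> \<in> induced X \<beta>"
  thus "\<rho> \<in> simplex_bd \<beta>" using assms by (auto simp: simplex_bd_def fillable_def induced_def)
qed

lemma morse_simplex_bd:
  assumes "finite \<beta>" "card \<beta> = Suc l"
  shows "morse F l (simplex_bd \<beta>) = 1" "morse F l (Pow \<beta>) = 0"
proof -
  have "\<beta> \<noteq> {}" using assms by auto
  thus "morse F l (Pow \<beta>) = 0" using acyclic_Pow[OF assms(1), of F] by (simp add: morse_def acyclic_hom_def)
  have "morse F l (simplex_bd \<beta>) = (\<Sum>k\<le>l. if k = l then 1 else 0)"
    unfolding morse_def using sphere_simplex_bd[OF assms, of F]
    by (intro sum.cong refl) (auto simp: sphere_hom_def)
  thus "morse F l (simplex_bd \<beta>) = 1" by simp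
qed

lemma morse_induced_fill:
  assumes fill: "fillable X \<beta> (\<alpha> \<union> \<beta>)" and disj: "\<alpha> \<inter> \<beta> = {}"
  shows "\<not> \<beta> \<subseteq> A \<or> A \<inter> \<alpha> \<noteq> {} \<Longrightarrow> morse F l (induced (X \<union> {\<beta>..\<alpha> \<union> \<beta>}) A) = morse F l (induced X A)"
    and "\<beta> \<subseteq> A \<Longrightarrow> A \<inter> \<alpha> = {} \<Longrightarrow> induced (X \<union> {\<beta>..\<alpha> \<union> \<beta>}) A = insert \<beta> (induced X A)"
    and "finite (induced X A)" "\<beta> \<notin> induced X A" "finite \<beta>" "\<beta> \<noteq> {}"
proof -
  show "finite (induced X A)" "\<beta> \<notin> induced X A" "finite \<beta>" "\<beta> \<noteq> {}"
    using fill by (auto simp: fillable_def induced_def scomplex_def)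
  show "induced (X \<union> {\<beta>..\<alpha> \<union> \<beta>}) A = insert \<beta> (induced X A)" if A: "\<beta> \<subseteq> A" "A \<inter> \<alpha> = {}"
  proof -
    have "(\<alpha> \<union> \<beta>) \<inter> A = \<beta>" using A by blast
    thus ?thesis using A by (simp add: induced_fill)
  qed
  show "morse F l (induced (X \<union> {\<beta>..\<alpha> \<union> \<beta>}) A) = morse F l (induced X A)" if A: "\<not> \<beta> \<subseteq> A \<or> A \<inter> \<alpha> \<noteq> {}"
  proof (cases "\<beta> \<subseteq> A")
    case True
    hence "\<beta> \<noteq> (\<alpha> \<union> \<beta>) \<inter> A" using A disj by blast
    thus ?thesis using morse_fill_interval[OF fillable_induced[OF fill True]] True by (simp add: induced_fill)
  qed (simp add: induced_fill)
qed

text \<open>Only the subsets that contain \<open>\<beta>\<close> and avoid \<open>\<alpha>\<close> see a change, and their total weight is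
known. The strict inequality comes from the subset \<open>\<beta>\<close> itself: before the filling it induces the
boundary of \<open>\<beta>\<close>, whose fundamental cycle is killed.\<close>

lemma weighted_morse_fill:
  assumes fill: "fillable X \<beta> (\<alpha> \<union> \<beta>)" and disj: "\<alpha> \<inter> \<beta> = {}" and W: "finite W" "\<alpha> \<union> \<beta> \<subseteq> W"
  shows "card \<beta> \<le> l \<Longrightarrow> weighted_morse F W l (X \<union> {\<beta>..\<alpha> \<union> \<beta>})
            = weighted_morse F W l X + (-1) ^ (l - card \<beta>) * beta_weight (card \<alpha>) (card \<beta>)"
    and "card \<beta> = l + 1 \<Longrightarrow> weighted_morse F W l (X \<union> {\<beta>..\<alpha> \<union> \<beta>}) < weighted_morse F W l X"
    and "card \<beta> \<ge> l + 2 \<Longrightarrow> weighted_morse F W l (X \<union> {\<beta>..\<alpha> \<union> \<beta>}) = weighted_morse F W l X"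
proof -
  let ?T = "X \<union> {\<beta>..\<alpha> \<union> \<beta>}"
  let ?d = "\<lambda>A. of_int (morse F l (induced ?T A)) - of_int (morse F l (induced X A)) :: real"
  let ?I = "{\<beta>..W - \<alpha>}"
  note m = morse_induced_fill[OF fill disj]
  have att: "card \<beta> \<le> l \<Longrightarrow> ?d A = (-1) ^ (l - card \<beta>)"
    "card \<beta> > l \<Longrightarrow> ?d A \<le> 0" "card \<beta> \<ge> l + 2 \<Longrightarrow> ?d A = 0" if "A \<in> ?I" for A
  proof -
    have A: "\<beta> \<subseteq> A" "A \<inter> \<alpha> = {}" using that by auto
    note a = morse_attach_face[OF m(3)[of A] m(4)[of A] m(5) m(6), of l F]
    show "card \<beta> \<le> l \<Longrightarrow> ?d A = (-1) ^ (l - card \<beta>)" unfolding m(2)[OF A] using a(1) by simp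
    show "card \<beta> > l \<Longrightarrow> ?d A \<le> 0" unfolding m(2)[OF A] using a(2) by simp
    show "card \<beta> \<ge> l + 2 \<Longrightarrow> ?d A = 0" unfolding m(2)[OF A] using a(3) by simp
  qed
  have finI: "finite ?I" using W by (simp add: finite_interval_set)
  have "weighted_morse F W l ?T - weighted_morse F W l X = (\<Sum>A\<in>Pow W. subset_weight W A * ?d A)"
    by (simp add: weighted_morse_def sum_subtractf[symmetric] algebra_simps)
  also have "\<dots> = (\<Sum>A\<in>?I. subset_weight W A * ?d A)"
  proof (rule sum.mono_neutral_right)
    show "\<forall>A\<in>Pow W - ?I. subset_weight W A * ?d A = 0"
    proof
      fix A assume "A \<in> Pow W - ?I"
      hence "\<not> \<beta> \<subseteq> A \<or> A \<inter> \<alpha> \<noteq> {}" by auto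
      hence "morse F l (induced ?T A) = morse F l (induced X A)" by (rule m(1))
      thus "subset_weight W A * ?d A = 0" by simp
    qed
  qed (use W in auto)
  finally have diff: "weighted_morse F W l ?T = weighted_morse F W l X + (\<Sum>A\<in>?I. subset_weight W A * ?d A)" by simp
  show "weighted_morse F W l ?T = weighted_morse F W l X + (-1) ^ (l - card \<beta>) * beta_weight (card \<alpha>) (card \<beta>)"
    if "card \<beta> \<le> l"
  proof -
    have "(\<Sum>A\<in>?I. subset_weight W A * ?d A) = (\<Sum>A\<in>?I. subset_weight W A) * (-1) ^ (l - card \<beta>)"
      unfolding sum_distrib_right using att(1) that by (intro sum.cong refl) simp
    thus ?thesis unfolding diff using sum_subset_weight[of W \<alpha> \<beta>] W disj by simp
  qed
  show "weighted_morse F W l ?T = weighted_morse F W l X" if "card \<beta> \<ge> l + 2"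
  proof -
    have "(\<Sum>A\<in>?I. subset_weight W A * ?d A) = 0"
      by (rule sum.neutral, intro ballI) (simp only: att(3)[OF _ that] mult_zero_right)
    thus ?thesis unfolding diff by simp
  qed
  show "weighted_morse F W l ?T < weighted_morse F W l X" if b: "card \<beta> = l + 1"
  proof -
    have w: "subset_weight W A > 0" if "A \<in> ?I" for A
    proof -
      have "card A \<le> card W" using that W by (intro card_mono) auto
      thus ?thesis by (simp add: subset_weight_def)
    qed
    \<comment> \<open>The subset \<open>A = \<beta>\<close> alone makes the inequality strict.\<close>
    have \<beta>I: "\<beta> \<in> ?I" using W disj by auto
    have "insert \<beta> (simplex_bd \<beta>) = Pow \<beta>" by (auto simp: simplex_bd_def)
    hence "?d \<beta> = -1" using m(2)[of \<beta>] disj induced_simplex_bd[OF fill] morse_simplex_bd[OF m(5), of l F] b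
      by (simp add: Int_commute)
    hence neg: "subset_weight W \<beta> * ?d \<beta> < 0" using w[OF \<beta>I] by simp
    have "(\<Sum>A\<in>?I. subset_weight W A * ?d A) < (\<Sum>A\<in>?I. 0)"
    proof (rule sum_strict_mono_ex1[OF finI])
      show "\<forall>A\<in>?I. subset_weight W A * ?d A \<le> 0"
        using w att(2) b by (intro ballI mult_nonneg_nonpos) (auto simp: less_imp_le)
      show "\<exists>A\<in>?I. subset_weight W A * ?d A < 0" using neg \<beta>I by blast
    qed
    thus ?thesis unfolding diff by simp
  qed
qed

text \<open>The face \<open>\<alpha>\<close> that disappears is so large that its removal affects only homology above the
cut-off; hence the move acts like the mere insertion of \<open>\<beta>\<close>.\<close>

lemma weighted_morse_flip:
  assumes flip: "flip X Y \<alpha> \<beta>" and a: "card \<alpha> \<ge> l + 2" and W: "finite W" "\<alpha> \<union> \<beta> \<subseteq> W"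
  shows "card \<beta> \<le> l \<Longrightarrow> weighted_morse F W l Y
            = weighted_morse F W l X + (-1) ^ (l - card \<beta>) * beta_weight (card \<alpha>) (card \<beta>)"
    and "card \<beta> = l + 1 \<Longrightarrow> weighted_morse F W l Y < weighted_morse F W l X"
    and "card \<beta> \<ge> l + 2 \<Longrightarrow> weighted_morse F W l Y = weighted_morse F W l X"
proof -
  have f: "fillable X \<beta> (\<alpha> \<union> \<beta>)" "fillable Y \<alpha> (\<beta> \<union> \<alpha>)" "\<alpha> \<inter> \<beta> = {}" "\<beta> \<inter> \<alpha> = {}"
    "X \<union> {\<beta>..\<alpha> \<union> \<beta>} = Y \<union> {\<alpha>..\<beta> \<union> \<alpha>}"
    using flip by (auto simp: flip_def Un_commute)
  have W': "\<beta> \<union> \<alpha> \<subseteq> W" using W by auto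
  have "weighted_morse F W l Y = weighted_morse F W l (X \<union> {\<beta>..\<alpha> \<union> \<beta>})"
    unfolding f(5) by (rule weighted_morse_fill(3)[OF f(2,4) W(1) W' a, symmetric])
  thus "card \<beta> \<le> l \<Longrightarrow> weighted_morse F W l Y
            = weighted_morse F W l X + (-1) ^ (l - card \<beta>) * beta_weight (card \<alpha>) (card \<beta>)"
    "card \<beta> = l + 1 \<Longrightarrow> weighted_morse F W l Y < weighted_morse F W l X"
    "card \<beta> \<ge> l + 2 \<Longrightarrow> weighted_morse F W l Y = weighted_morse F W l X"
    using weighted_morse_fill[OF f(1,3) W, of l F] by simp_all
qed

text \<open>Among the g-numbers that occur in the bound, a flip can only raise the one whose index is the
size of \<open>\<beta>\<close>.\<close>

lemma g_bound_flip:
  assumes flip: "flip X Y \<alpha> \<beta>" and N: "card \<alpha> + card \<beta> = N" and a: "card \<alpha> > l"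
  shows "g_bound N l Y = g_bound N l X
     + (if card \<beta> \<le> l then (-1) ^ (l - card \<beta>) * beta_weight (card \<alpha>) (card \<beta>) else 0)"
proof -
  have "g_bound N l Y = (\<Sum>j\<le>l. (-1) ^ (l - j) * of_int (g_sum N j X) * beta_weight j (N - j)
      + (if j = card \<beta> then (-1) ^ (l - card \<beta>) * beta_weight (card \<alpha>) (card \<beta>) else 0))"
    unfolding g_bound_def
  proof (intro sum.cong refl)
    fix j assume "j \<in> {..l}"
    hence "g_sum N j Y = g_sum N j X + (if j = card \<beta> then 1 else 0)"
      using g_sum_flip[OF flip N, of j] a N by auto
    moreover have "N - card \<beta> = card \<alpha>" using N by simp
    ultimately show "(-1) ^ (l - j) * of_int (g_sum N j Y) * beta_weight j (N - j)
       = (-1) ^ (l - j) * of_int (g_sum N j X) * beta_weight j (N - j)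
      + (if j = card \<beta> then (-1) ^ (l - card \<beta>) * beta_weight (card \<alpha>) (card \<beta>) else 0)"
      by (auto simp: algebra_simps beta_weight_commute)
  qed
  also have "\<dots> = g_bound N l X + (if card \<beta> \<le> l then (-1) ^ (l - card \<beta>) * beta_weight (card \<alpha>) (card \<beta>) else 0)"
    by (simp add: g_bound_def sum.distrib)
  finally show ?thesis .
qed

lemma induced_simplex_bd_cases:
  assumes "finite \<epsilon>" "card \<epsilon> = n + 2"
  shows "red_hom F k (induced (simplex_bd \<epsilon>) A)
    = (if A \<inter> \<epsilon> = {} then (if k = 0 then 1 else 0) else if \<epsilon> \<subseteq> A then (if k = n + 1 then 1 else 0) else 0)"
proof -
  have c: "card \<epsilon> = Suc (n + 1)" using assms by simp
  consider "A \<inter> \<epsilon> = {}" | "\<epsilon> \<subseteq> A" "A \<inter> \<epsilon> \<noteq> {}" | "A \<inter> \<epsilon> \<noteq> {}" "\<not> \<epsilon> \<subseteq> A" by blast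
  thus ?thesis
  proof cases
    case 1
    have "\<epsilon> \<noteq> {}" using assms by auto
    hence "induced (simplex_bd \<epsilon>) A = {{}}" using 1 by (auto simp: induced_def simplex_bd_def)
    moreover have "simplex_bd {x :: 'a} = {{}}" for x by (auto simp: simplex_bd_def)
    moreover have "sphere_hom F 0 (simplex_bd {undefined :: 'a})" by (rule sphere_simplex_bd) auto
    ultimately show ?thesis using 1 by (simp add: sphere_hom_def)
  next
    case 2
    hence "induced (simplex_bd \<epsilon>) A = simplex_bd \<epsilon>" by (auto simp: induced_def simplex_bd_def)
    thus ?thesis using sphere_simplex_bd[OF assms(1) c, of F] 2 by (simp add: sphere_hom_def)
  next
    case 3
    hence "induced (simplex_bd \<epsilon>) A = Pow (A \<inter> \<epsilon>)" by (auto simp: induced_def simplex_bd_def)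
    thus ?thesis using acyclic_Pow[of "A \<inter> \<epsilon>" F] 3 assms by (simp add: acyclic_hom_def)
  qed
qed

text \<open>Subsets that meet \<open>\<epsilon>\<close> induce an acyclic complex or the whole sphere, whose homology lies above the
cut-off. The others induce \<open>{{}}\<close>, whose reduced homology sits in size 0.\<close>

lemma weighted_morse_simplex_bd:
  assumes \<epsilon>: "finite \<epsilon>" "card \<epsilon> = n + 2" and W: "finite W" "\<epsilon> \<subseteq> W" and l: "l \<le> n"
  shows "weighted_morse F W l (simplex_bd \<epsilon>) = (-1) ^ l * beta_weight 0 (n + 2)"
    and "g_bound (n + 2) l (simplex_bd \<epsilon>) = (-1) ^ l * beta_weight 0 (n + 2)"
proof -
  have "morse F l (induced (simplex_bd \<epsilon>) A) = (if A \<in> {{}..W - \<epsilon>} then (-1) ^ l else 0)" if "A \<in> Pow W" for A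
  proof -
    have "morse F l (induced (simplex_bd \<epsilon>) A) = (\<Sum>k\<le>l. if k = 0 then if A \<inter> \<epsilon> = {} then (-1) ^ l else 0 else 0)"
      unfolding morse_def by (intro sum.cong refl) (use l in \<open>auto simp: induced_simplex_bd_cases[OF \<epsilon>]\<close>)
    thus ?thesis using that by auto
  qed
  hence "weighted_morse F W l (simplex_bd \<epsilon>) = (\<Sum>A\<in>Pow W. if A \<in> {{}..W - \<epsilon>} then subset_weight W A * (-1) ^ l else 0)"
    unfolding weighted_morse_def by (intro sum.cong refl) simp
  also have "\<dots> = (\<Sum>A\<in>{{}..W - \<epsilon>}. subset_weight W A * (-1) ^ l)"
    using W by (intro sum.mono_neutral_cong_right) auto
  also have "\<dots> = (-1) ^ l * beta_weight (card \<epsilon>) 0"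
    unfolding sum_distrib_right[symmetric] using sum_subset_weight[of W \<epsilon> "{}"] W by simp
  finally show "weighted_morse F W l (simplex_bd \<epsilon>) = (-1) ^ l * beta_weight 0 (n + 2)"
    using \<epsilon> by (simp add: beta_weight_commute)
  have g: "g_sum (n + 2) j (simplex_bd \<epsilon>) = (if j = 0 then 1 else 0)" if "j \<le> l" for j
    using that l by (intro g_sum_simplex_bd[OF \<epsilon>]) simp
  have "g_bound (n + 2) l (simplex_bd \<epsilon>) = (\<Sum>j\<le>l. if j = 0 then (-1) ^ l * beta_weight 0 (n + 2) else 0)"
    unfolding g_bound_def
  proof (intro sum.cong refl)
    fix j assume "j \<in> {..l}"
    thus "(-1) ^ (l - j) * of_int (g_sum (n + 2) j (simplex_bd \<epsilon>)) * beta_weight j (n + 2 - j)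
       = (if j = 0 then (-1) ^ l * beta_weight 0 (n + 2) else 0)"
      using g[of j] by (cases "j = 0") simp_all
  qed
  thus "g_bound (n + 2) l (simplex_bd \<epsilon>) = (-1) ^ l * beta_weight 0 (n + 2)" by simp
qed

section \<open>Tame spheres and the inequality for a single link\<close>

text \<open>Spheres obtained from the boundary of a simplex by moves that insert faces of size at most \<open>m\<close>,
that is, of index below \<open>m\<close>. Tame \<open>n\<close>-spheres have \<open>m = (n + 1) div 2\<close>; those with \<open>m = l\<close> will
be the \<open>l\<close>-stacked ones.\<close>

inductive flip_sphere :: "nat \<Rightarrow> nat \<Rightarrow> 'a set set \<Rightarrow> bool" for n m where
  simplex: "finite \<epsilon> \<Longrightarrow> card \<epsilon> = n + 2 \<Longrightarrow> flip_sphere n m (simplex_bd \<epsilon>)"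
| flip: "flip_sphere n m X \<Longrightarrow> flip X Y \<alpha> \<beta> \<Longrightarrow> card \<alpha> + card \<beta> = n + 2 \<Longrightarrow> card \<beta> \<le> m \<Longrightarrow>
     flip_sphere n m Y"

text \<open>Admissibility of the next move already includes that the intermediate result is a complex, so
the assumption on \<open>X\<close> is passed down the sequence of moves.\<close>

lemma tame_sphere_flip_sphere:
  assumes "tame_sphere (int n) X" "scomplex X"
  shows "flip_sphere n ((n + 1) div 2) X"
  using assms
proof (induction rule: tame_sphere.induct)
  case (standard \<alpha>)
  thus ?case by (intro flip_sphere.simplex) auto
next
  case (move X \<alpha> \<beta>)
  have adm: "scomplex X" "int (card \<alpha>) + int (card \<beta>) = int n + 2"
    using move.hyps(2) by (auto simp: admits_move_def)
  have "2 * real (card \<beta>) - 2 < real n" using move.hyps(3) by (simp add: move_index_def field_simps)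
  hence "2 * int (card \<beta>) - 2 < int n" by linarith
  hence "card \<alpha> + card \<beta> = n + 2" "card \<beta> \<le> (n + 1) div 2" using adm(2) by linarith+
  thus ?case by (rule flip_sphere.flip[OF move.IH[OF adm(1)] flip_bistellar_move[OF move.hyps(2) move.prems]])
qed

lemma flip_facts:
  assumes "flip X Y \<alpha> \<beta>"
  shows "scomplex X" "scomplex Y" "finite \<alpha>" "finite \<beta>" "\<alpha> \<inter> \<beta> = {}" "\<alpha> \<noteq> {}" "\<beta> \<noteq> {}"
    "\<And>\<delta>. \<delta> \<in> X \<Longrightarrow> \<not> \<beta> \<subseteq> \<delta>" "\<And>\<delta>. \<delta> \<in> Y \<Longrightarrow> \<not> \<alpha> \<subseteq> \<delta>"
    "\<And>v. v \<in> \<beta> \<Longrightarrow> \<alpha> \<union> \<beta> - {v} \<in> X" "\<And>v. v \<in> \<alpha> \<Longrightarrow> \<alpha> \<union> \<beta> - {v} \<in> Y"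
    "\<And>\<delta>. \<delta> \<in> X \<or> \<delta> \<in> {\<beta>..\<alpha> \<union> \<beta>} \<longleftrightarrow> \<delta> \<in> Y \<or> \<delta> \<in> {\<alpha>..\<alpha> \<union> \<beta>}"
proof -
  have X: "fillable X \<beta> (\<alpha> \<union> \<beta>)" and Y: "fillable Y \<alpha> (\<alpha> \<union> \<beta>)" and disj: "\<alpha> \<inter> \<beta> = {}"
    and eq: "X \<union> {\<beta>..\<alpha> \<union> \<beta>} = Y \<union> {\<alpha>..\<alpha> \<union> \<beta>}"
    using assms by (simp_all add: flip_def)
  show s: "scomplex X" "scomplex Y" "finite \<alpha>" "finite \<beta>" "\<alpha> \<inter> \<beta> = {}"
    using X Y disj by (simp_all add: fillable_def)
  show "\<not> \<beta> \<subseteq> \<delta>" if "\<delta> \<in> X" for \<delta> using X scomplex_subset[OF s(1) that] by (auto simp: fillable_def)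
  show "\<not> \<alpha> \<subseteq> \<delta>" if "\<delta> \<in> Y" for \<delta> using Y scomplex_subset[OF s(2) that] by (auto simp: fillable_def)
  show "\<alpha> \<noteq> {}" "\<beta> \<noteq> {}" using X Y by (auto simp: fillable_def scomplex_def)
  show "\<alpha> \<union> \<beta> - {v} \<in> X" if "v \<in> \<beta>" for v using X that by (simp add: fillable_def)
  show "\<alpha> \<union> \<beta> - {v} \<in> Y" if "v \<in> \<alpha>" for v using Y that by (simp add: fillable_def)
  show "\<delta> \<in> X \<or> \<delta> \<in> {\<beta>..\<alpha> \<union> \<beta>} \<longleftrightarrow> \<delta> \<in> Y \<or> \<delta> \<in> {\<alpha>..\<alpha> \<union> \<beta>}" for \<delta> using eq by blast
qed

lemma flip_verts:
  assumes "flip X Y \<alpha> \<beta>" "card \<alpha> \<ge> 2"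
  shows "\<alpha> \<union> \<beta> \<subseteq> verts Y" "verts X \<subseteq> verts Y"
proof -
  note f = flip_facts[OF assms(1)]
  show sub: "\<alpha> \<union> \<beta> \<subseteq> verts Y"
  proof
    fix v assume v: "v \<in> \<alpha> \<union> \<beta>"
    have "\<not> \<alpha> \<subseteq> {v}" using assms(2) card_mono[of "{v}" \<alpha>] by auto
    then obtain a where "a \<in> \<alpha>" "a \<noteq> v" by auto
    hence "\<alpha> \<union> \<beta> - {a} \<in> Y" "v \<in> \<alpha> \<union> \<beta> - {a}" using f(11)[of a] v by auto
    thus "v \<in> verts Y" unfolding verts_def by blast
  qed
  show "verts X \<subseteq> verts Y"
  proof
    fix v assume "v \<in> verts X"
    then obtain \<delta> where "\<delta> \<in> X" "v \<in> \<delta>" by (auto simp: verts_def)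
    hence "\<delta> \<in> Y \<or> \<delta> \<subseteq> \<alpha> \<union> \<beta>" using f(12)[of \<delta>] by auto
    thus "v \<in> verts Y" using sub \<open>v \<in> \<delta>\<close> unfolding verts_def by blast
  qed
qed

lemma red_hom_induced_flip:
  assumes flip: "flip X Y \<alpha> \<beta>" and k: "k \<noteq> card \<alpha>" "Suc k \<noteq> card \<alpha>" "k \<noteq> card \<beta>" "Suc k \<noteq> card \<beta>"
  shows "red_hom F k (induced Y A) = red_hom F k (induced X A)"
proof -
  have half: "red_hom F k (induced (X \<union> {\<beta>..\<alpha> \<union> \<beta>}) A) = red_hom F k (induced X A)"
    if fill: "fillable X \<beta> (\<alpha> \<union> \<beta>)" and disj: "\<alpha> \<inter> \<beta> = {}" and k: "k \<noteq> card \<beta>" "Suc k \<noteq> card \<beta>" for X \<alpha> \<beta>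
  proof (cases "\<beta> \<subseteq> A")
    case True
    note f = fillable_induced[OF fill True]
    show ?thesis
    proof (cases "\<beta> = (\<alpha> \<union> \<beta>) \<inter> A")
      case False
      thus ?thesis using red_hom_fill[OF f False] True by (simp add: induced_fill)
    next
      case eq: True
      have fin: "finite (induced X A)" "\<beta> \<notin> induced X A" "finite \<beta>" "\<beta> \<noteq> {}"
        using morse_induced_fill(3-6)[OF fill disj] by auto
      then obtain n where n: "card \<beta> = Suc n" by (metis card_gt_0_iff gr0_implies_Suc)
      have "induced (X \<union> {\<beta>..\<alpha> \<union> \<beta>}) A = insert \<beta> (induced X A)"
        using True eq[symmetric] by (simp add: induced_fill)
      thus ?thesis using red_hom_attach_face[OF fin(1,2) n, of F] n k by auto
    qed
  qed (simp add: induced_fill)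
  have f: "fillable X \<beta> (\<alpha> \<union> \<beta>)" "fillable Y \<alpha> (\<beta> \<union> \<alpha>)" "\<alpha> \<inter> \<beta> = {}" "\<beta> \<inter> \<alpha> = {}"
    "X \<union> {\<beta>..\<alpha> \<union> \<beta>} = Y \<union> {\<alpha>..\<beta> \<union> \<alpha>}"
    using flip by (auto simp: flip_def Un_commute)
  show ?thesis using half[OF f(1,3) k(3,4)] half[OF f(2,4) k(1,2)] f(5) by simp
qed

text \<open>Moves of index below \<open>l\<close> change the homology of induced subcomplexes only near the bottom and
near the top, leaving a gap in the middle.\<close>

lemma red_hom_induced_low_flip_sphere:
  assumes "flip_sphere n l X" "l < k" "k + l \<le> n"
  shows "red_hom F k (induced X A) = 0"
  using assms
proof (induction rule: flip_sphere.induct)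
  case (simplex \<epsilon>)
  thus ?case by (simp add: induced_simplex_bd_cases)
next
  case (flip X Y \<alpha> \<beta>)
  thus ?case using red_hom_induced_flip[OF flip.hyps(2), of k F A] by auto
qed

text \<open>Such a move would need \<open>\<beta>\<close> to induce its own boundary, a sphere with homology in the gap.
Consequently, once moves of index \<open>l\<close> are absent, moves of larger index are impossible.\<close>

lemma low_flip_sphere_no_higher_flip:
  fixes X :: "'a::linorder set set"
  assumes X: "flip_sphere n l X" and flip: "flip X Y \<alpha> \<beta>" and \<beta>: "l + 2 \<le> card \<beta>" "2 * card \<beta> \<le> n + 1"
  shows False
proof -
  \<comment> \<open>The claim does not mention homology, so any field will do.\<close>
  let ?F = "TYPE(rat)"
  have fill: "fillable X \<beta> (\<alpha> \<union> \<beta>)" using flip by (simp add: flip_def)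
  have c: "card \<beta> = Suc (card \<beta> - 1)" using \<beta> by simp
  have "finite \<beta>" using flip_facts(4)[OF flip] .
  hence "red_hom ?F (card \<beta> - 1) (induced X \<beta>) = 1"
    using sphere_simplex_bd[of \<beta> "card \<beta> - 1" ?F] c unfolding induced_simplex_bd[OF fill] sphere_hom_def by simp
  moreover have "red_hom ?F (card \<beta> - 1) (induced X \<beta>) = 0"
    by (rule red_hom_induced_low_flip_sphere[OF X]) (use \<beta> in auto)
  ultimately show False by simp
qed

text \<open>The central induction over the moves. Moves of index below \<open>l\<close> change both sides equally. A move
of index \<open>l\<close> decreases the left side strictly, keeps the right side, and raises the next g-number
by one. A move of larger index changes neither side and preserves the second alternative; after the
first alternative it cannot occur.\<close>

lemma weighted_morse_le_g_bound:
  fixes X :: "'a::linorder set set" and F :: "'f::field itself"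
  assumes "flip_sphere n ((n + 1) div 2) X" "2 * l \<le> n" "finite W" "verts X \<subseteq> W"
  shows "flip_sphere n l X \<and> weighted_morse F W l X = g_bound (n + 2) l X \<and> g_sum (n + 2) (l + 1) X = 0
    \<or> weighted_morse F W l X < g_bound (n + 2) l X \<and> g_sum (n + 2) (l + 1) X > 0"
  using assms
proof (induction rule: flip_sphere.induct)
  case (simplex \<epsilon>)
  have "\<epsilon> \<subseteq> verts (simplex_bd \<epsilon>)"
  proof
    fix v assume "v \<in> \<epsilon>"
    moreover have "{v} \<noteq> \<epsilon>" using simplex by auto
    ultimately have "{v} \<in> simplex_bd \<epsilon>" by (auto simp: simplex_bd_def)
    thus "v \<in> verts (simplex_bd \<epsilon>)" by (auto simp: verts_def)
  qed
  hence "\<epsilon> \<subseteq> W" using simplex by auto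
  thus ?case
    using simplex flip_sphere.simplex[OF simplex.hyps, of l]
      weighted_morse_simplex_bd(1)[OF simplex.hyps, of W l F]
      weighted_morse_simplex_bd(2)[OF simplex.hyps, of W l] g_sum_simplex_bd[OF simplex.hyps, of "l + 1"] by simp
next
  case (flip X Y \<alpha> \<beta>)
  have a: "card \<alpha> \<ge> l + 2" "2 * card \<beta> \<le> n + 1" using flip by auto
  have a2: "card \<alpha> \<ge> 2" "card \<alpha> > l" using a by auto
  have W: "\<alpha> \<union> \<beta> \<subseteq> W" "verts X \<subseteq> W" using flip_verts[OF flip.hyps(2) a2(1)] flip.prems by auto
  note wm = weighted_morse_flip[OF flip.hyps(2) a(1) flip.prems(2) W(1), of F]
  note gb = g_bound_flip[OF flip.hyps(2,3) a2(2)]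
  note gs = g_sum_flip[OF flip.hyps(2,3), of "l + 1"]
  note IH = flip.IH[OF flip.prems(1,2) W(2)]
  have gs': "g_sum (n + 2) (l + 1) Y = g_sum (n + 2) (l + 1) X + (if l + 1 = card \<beta> then 1 else 0)"
    using gs a flip.prems(1) by auto
  consider "card \<beta> \<le> l" | "card \<beta> = l + 1" | "card \<beta> \<ge> l + 2" by linarith
  thus ?case
  proof cases
    case 1
    have "flip_sphere n l X \<Longrightarrow> flip_sphere n l Y" by (rule flip_sphere.flip[OF _ flip.hyps(2,3) 1])
    thus ?thesis using IH wm(1)[OF 1] gb gs' 1 by auto
  next
    case 2
    thus ?thesis using IH wm(2)[OF 2] gb gs' by auto
  next
    case 3
    hence "\<not> flip_sphere n l X" using low_flip_sphere_no_higher_flip[OF _ flip.hyps(2) 3 a(2)] by blast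
    thus ?thesis using IH wm(3)[OF 3] gb gs' 3 by auto
  qed
qed

section \<open>Spheres built by flips are homology spheres\<close>

definition pure_of_size :: "nat \<Rightarrow> 'a set set \<Rightarrow> bool" where
  "pure_of_size N X \<longleftrightarrow> (\<forall>\<gamma>\<in>X. card \<gamma> \<le> N \<and> (\<exists>\<delta>\<in>X. \<gamma> \<subseteq> \<delta> \<and> card \<delta> = N))"

lemma cdim_pure_of_size:
  assumes "scomplex X" "pure_of_size N X"
  shows "cdim X = int N - 1" "pure X"
proof -
  have fin: "finite X" "{} \<in> X" using assms by (auto simp: scomplex_def)
  obtain \<delta> where d: "\<delta> \<in> X" "card \<delta> = N" using assms fin unfolding pure_of_size_def by blast
  show c: "cdim X = int N - 1" unfolding cdim_def
  proof (rule Max_eqI)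
    show "int N - 1 \<in> face_dim ` X" using d by (auto simp: face_dim_def intro!: image_eqI[of _ _ \<delta>])
  qed (use fin assms in \<open>auto simp: pure_of_size_def face_dim_def\<close>)
  show "pure X" unfolding pure_def c using assms(2) by (fastforce simp: pure_of_size_def face_dim_def)
qed

lemma closed_homology_manifoldI:
  assumes X: "scomplex X" "pure_of_size (n + 1) X"
    and links: "\<And>\<gamma>. \<gamma> \<in> X \<Longrightarrow> \<gamma> \<noteq> {} \<Longrightarrow> sphere_hom F (n + 1 - card \<gamma>) (link \<gamma> X)"
  shows "closed_homology_manifold F (int n) X"
proof -
  have "homology_of_sphere F (int n - int (card \<gamma>)) (link \<gamma> X)" "\<not> homology_of_point F (link \<gamma> X)"
    if "\<gamma> \<in> X" "\<gamma> \<noteq> {}" for \<gamma>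
  proof -
    have "int (n + 1 - card \<gamma>) - 1 = int n - int (card \<gamma>)"
      using X that by (auto simp: pure_of_size_def)
    thus "homology_of_sphere F (int n - int (card \<gamma>)) (link \<gamma> X)" "\<not> homology_of_point F (link \<gamma> X)"
      using sphere_hom_imp[OF scomplex_link[OF X(1) that(1)] links[OF that]]
        sphere_not_point[OF scomplex_link[OF X(1) that(1)] links[OF that]] by simp_all
  qed
  thus ?thesis using X cdim_pure_of_size[OF X]
    by (auto simp: closed_homology_manifold_def homology_mfd_links_def mfd_boundary_def)
qed

lemma link_empty [simp]: "link {} X = X"
  by (simp add: link_def)

lemma homology_sphereI:
  assumes X: "scomplex X" "pure_of_size (n + 1) X"
    and links: "\<And>\<gamma>. \<gamma> \<in> X \<Longrightarrow> sphere_hom F (n + 1 - card \<gamma>) (link \<gamma> X)"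
  shows "homology_sphere F (int n) X"
proof -
  have "{} \<in> X" using X by (simp add: scomplex_def)
  hence "sphere_hom F (n + 1) X" using links[of "{}"] by simp
  from sphere_hom_imp[OF X(1) this] show ?thesis
    using closed_homology_manifoldI[OF X links] by (simp add: homology_sphere_def)
qed

lemma red_hom_link_fill:
  assumes fill: "fillable X \<beta> \<epsilon>" and \<gamma>: "\<gamma> \<in> X" and ne: "\<not> \<epsilon> \<subseteq> \<beta> \<union> \<gamma>"
  shows "red_hom F k (link \<gamma> (X \<union> {\<beta>..\<epsilon>})) = red_hom F k (link \<gamma> X)"
proof (cases "\<gamma> \<subseteq> \<epsilon>")
  case True
  have "\<beta> - \<gamma> \<noteq> \<epsilon> - \<gamma>" using ne by blast
  from red_hom_fill[OF fillable_link[OF fill \<gamma> True] this] show ?thesis using True by (simp add: link_fill)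
qed (simp add: link_fill)

lemma link_simplex_bd: "\<gamma> \<subset> \<epsilon> \<Longrightarrow> link \<gamma> (simplex_bd \<epsilon>) = simplex_bd (\<epsilon> - \<gamma>)"
  by (auto simp: link_def simplex_bd_def)

text \<open>A face that survives a move contains neither \<open>\<alpha>\<close> nor \<open>\<beta>\<close>, so each of its two
links equals the link in the common filled complex or is a collapse of it. A new face has the
boundary of a simplex as its link.\<close>

lemma flip_sphere_links:
  assumes "flip_sphere n m X"
  shows "scomplex X \<and> pure_of_size (n + 1) X \<and> (\<forall>\<gamma>\<in>X. sphere_hom F (n + 1 - card \<gamma>) (link \<gamma> X))"
  using assms
proof (induction rule: flip_sphere.induct)
  case (simplex \<epsilon>)
  have ne: "\<epsilon> \<noteq> {}" using simplex by auto
  have card: "card \<gamma> < n + 2" if "\<gamma> \<subset> \<epsilon>" for \<gamma> using psubset_card_mono[OF simplex(1) that] simplex(2) by simp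
  have "sphere_hom F (n + 1 - card \<gamma>) (link \<gamma> (simplex_bd \<epsilon>))" if "\<gamma> \<in> simplex_bd \<epsilon>" for \<gamma>
  proof -
    have g: "\<gamma> \<subset> \<epsilon>" using that by (simp add: simplex_bd_def)
    have "card (\<epsilon> - \<gamma>) = Suc (n + 1 - card \<gamma>)"
      using g card[OF g] simplex finite_subset[of \<gamma> \<epsilon>] by (simp add: card_Diff_subset psubset_imp_subset)
    thus ?thesis using sphere_simplex_bd[of "\<epsilon> - \<gamma>" "n + 1 - card \<gamma>" F] simplex by (simp add: link_simplex_bd[OF g])
  qed
  moreover have "pure_of_size (n + 1) (simplex_bd \<epsilon>)"
    unfolding pure_of_size_def
  proof (intro ballI conjI)
    fix \<gamma> assume "\<gamma> \<in> simplex_bd \<epsilon>"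
    hence g: "\<gamma> \<subset> \<epsilon>" by (simp add: simplex_bd_def)
    thus "card \<gamma> \<le> n + 1" using card[OF g] by simp
    obtain v where v: "v \<in> \<epsilon>" "v \<notin> \<gamma>" using g by blast
    show "\<exists>\<delta>\<in>simplex_bd \<epsilon>. \<gamma> \<subseteq> \<delta> \<and> card \<delta> = n + 1"
      by (rule bexI[of _ "\<epsilon> - {v}"]) (use v g simplex in \<open>auto simp: simplex_bd_def\<close>)
  qed
  ultimately show ?case using scomplex_simplex_bd[OF simplex(1) ne] by blast
next
  case (flip X Y \<alpha> \<beta>)
  note f = flip_facts[OF flip.hyps(2)]
  let ?\<epsilon> = "\<alpha> \<union> \<beta>"
  have fill: "fillable X \<beta> ?\<epsilon>" "fillable Y \<alpha> ?\<epsilon>" "X \<union> {\<beta>..?\<epsilon>} = Y \<union> {\<alpha>..?\<epsilon>}"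
    using flip.hyps(2) by (auto simp: flip_def)
  have X: "scomplex X" "pure_of_size (n + 1) X" "\<And>\<gamma>. \<gamma> \<in> X \<Longrightarrow> sphere_hom F (n + 1 - card \<gamma>) (link \<gamma> X)"
    using flip.IH by auto
  have card\<epsilon>: "card ?\<epsilon> = n + 2" "finite ?\<epsilon>" using f flip.hyps(3) by (auto simp: card_Un_disjoint)
  have YX: "\<gamma> \<in> X \<or> \<beta> \<subseteq> \<gamma> \<and> \<gamma> \<subset> ?\<epsilon>" if "\<gamma> \<in> Y" for \<gamma> using f(9)[OF that] f(12)[of \<gamma>] that by auto
  have "sphere_hom F (n + 1 - card \<gamma>) (link \<gamma> Y)" if \<gamma>: "\<gamma> \<in> Y" for \<gamma>
  proof (cases "\<gamma> \<in> X")
    case True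
    have "\<not> ?\<epsilon> \<subseteq> \<beta> \<union> \<gamma>" "\<not> ?\<epsilon> \<subseteq> \<alpha> \<union> \<gamma>" using f(9)[OF \<gamma>] f(8)[OF True] f(5) by blast+
    hence "red_hom F k (link \<gamma> Y) = red_hom F k (link \<gamma> X)" for k
      using red_hom_link_fill[OF fill(1) True] red_hom_link_fill[OF fill(2) \<gamma>] fill(3) by metis
    thus ?thesis using X(3)[OF True] by (simp add: sphere_hom_def)
  next
    case False
    hence g: "\<beta> \<subseteq> \<gamma>" "\<gamma> \<subset> ?\<epsilon>" using YX[OF \<gamma>] by auto
    have "link \<gamma> Y = simplex_bd (?\<epsilon> - \<gamma>)"
    proof (intro equalityI subsetI)
      fix \<tau> assume \<tau>: "\<tau> \<in> link \<gamma> Y"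
      hence "\<gamma> \<union> \<tau> \<in> Y" "\<gamma> \<inter> \<tau> = {}" by (auto simp: link_def)
      moreover have "\<gamma> \<union> \<tau> \<notin> X" using scomplex_subset[OF X(1), of "\<gamma> \<union> \<tau>" \<gamma>] False by auto
      ultimately have "\<gamma> \<union> \<tau> \<subset> ?\<epsilon>" using YX by blast
      thus "\<tau> \<in> simplex_bd (?\<epsilon> - \<gamma>)" using \<open>\<gamma> \<inter> \<tau> = {}\<close> g unfolding simplex_bd_def by blast
    next
      fix \<tau> assume "\<tau> \<in> simplex_bd (?\<epsilon> - \<gamma>)"
      hence t: "\<tau> \<subset> ?\<epsilon> - \<gamma>" by (simp add: simplex_bd_def)
      then obtain v where v: "v \<in> ?\<epsilon>" "v \<notin> \<gamma>" "v \<notin> \<tau>" by blast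
      hence "v \<in> \<alpha>" using g by blast
      hence "?\<epsilon> - {v} \<in> Y" using f(11) by blast
      moreover have "\<gamma> \<union> \<tau> \<subseteq> ?\<epsilon> - {v}" using v g t by blast
      ultimately have "\<gamma> \<union> \<tau> \<in> Y" using scomplex_subset[OF f(2)] by blast
      thus "\<tau> \<in> link \<gamma> Y" using t by (auto simp: link_def)
    qed
    moreover have "card (?\<epsilon> - \<gamma>) = Suc (n + 1 - card \<gamma>)"
    proof -
      have "card \<gamma> < n + 2" using psubset_card_mono[OF card\<epsilon>(2) g(2)] card\<epsilon> by simp
      moreover have "card (?\<epsilon> - \<gamma>) = card ?\<epsilon> - card \<gamma>"
        using g card\<epsilon> finite_subset[of \<gamma> ?\<epsilon>] by (intro card_Diff_subset) auto
      ultimately show ?thesis using card\<epsilon> by simp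
    qed
    ultimately show ?thesis using sphere_simplex_bd[of "?\<epsilon> - \<gamma>" _ F] card\<epsilon>(2) by simp
  qed
  moreover have "pure_of_size (n + 1) Y"
    unfolding pure_of_size_def
  proof (intro ballI conjI)
    fix \<gamma> assume \<gamma>: "\<gamma> \<in> Y"
    show "card \<gamma> \<le> n + 1"
    proof (cases "\<gamma> \<in> X")
      case False
      hence "\<gamma> \<subset> ?\<epsilon>" using YX[OF \<gamma>] by blast
      thus ?thesis using psubset_card_mono[OF card\<epsilon>(2), of \<gamma>] card\<epsilon>(1) by simp
    qed (use X(2) in \<open>simp add: pure_of_size_def\<close>)
    show "\<exists>\<delta>\<in>Y. \<gamma> \<subseteq> \<delta> \<and> card \<delta> = n + 1"
    proof (cases "\<gamma> \<subseteq> ?\<epsilon>")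
      case True
      obtain v where v: "v \<in> \<alpha>" "v \<notin> \<gamma>" using f(9)[OF \<gamma>] by blast
      have "card (?\<epsilon> - {v}) = n + 1" using v card\<epsilon> by (simp add: card_Diff_singleton)
      thus ?thesis using f(11)[OF v(1)] v True by (intro bexI[of _ "?\<epsilon> - {v}"]) auto
    next
      case False
      hence "\<gamma> \<in> X" using YX[OF \<gamma>] by blast
      then obtain \<delta> where d: "\<delta> \<in> X" "\<gamma> \<subseteq> \<delta>" "card \<delta> = n + 1" using X(2) unfolding pure_of_size_def by blast
      have "\<not> \<delta> \<subseteq> ?\<epsilon>" using False d by blast
      hence "\<delta> \<in> Y" using f(12)[of \<delta>] d by auto
      thus ?thesis using d by blast
    qed
  qed
  ultimately show ?case using f(2) by blast
qed

lemma flip_sphere_homology_sphere: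
  assumes "flip_sphere n m X" shows "homology_sphere F (int n) X"
  using flip_sphere_links[OF assms, of F] homology_sphereI by blast

section \<open>Stacked balls from moves of small index\<close>

text \<open>A ball \<open>\<Delta>\<close> with boundary \<open>S\<close> and without interior faces of size below \<open>n + 2 - l\<close>. The
boundary is a separate argument, so that homology of the links is required rather than used to
determine it.\<close>

definition filling_ball ::
  "'f::field itself \<Rightarrow> nat \<Rightarrow> nat \<Rightarrow> 'a::linorder set set \<Rightarrow> 'a set set \<Rightarrow> bool" where
  "filling_ball F n l \<Delta> S \<longleftrightarrow> scomplex \<Delta> \<and> pure_of_size (n + 2) \<Delta> \<and> S \<subseteq> \<Delta> \<and>
     (\<forall>\<gamma>\<in>S. acyclic_hom F (link \<gamma> \<Delta>)) \<and>
     (\<forall>\<gamma>\<in>\<Delta> - S. sphere_hom F (n + 2 - card \<gamma>) (link \<gamma> \<Delta>) \<and> n + 2 \<le> card \<gamma> + l)"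

lemma link_Pow: "\<gamma> \<subseteq> \<epsilon> \<Longrightarrow> link \<gamma> (Pow \<epsilon>) = Pow (\<epsilon> - \<gamma>)"
  by (auto simp: link_def)

lemma sphere_hom_empty_face: "sphere_hom F 0 {{} :: 'a::linorder set}"
proof -
  have "simplex_bd {undefined :: 'a} = {{}}" by (auto simp: simplex_bd_def)
  thus ?thesis using sphere_simplex_bd[of "{undefined :: 'a}" 0 F] by simp
qed

lemma filling_ball_simplex:
  assumes "finite \<epsilon>" "card \<epsilon> = n + 2"
  shows "filling_ball F n l (Pow \<epsilon>) (simplex_bd \<epsilon>)"
  unfolding filling_ball_def
proof (intro conjI ballI)
  show "scomplex (Pow \<epsilon>)" using assms(1) by (rule scomplex_Pow)
  show "pure_of_size (n + 2) (Pow \<epsilon>)" using assms card_mono[OF assms(1)] by (auto simp: pure_of_size_def)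
  show "simplex_bd \<epsilon> \<subseteq> Pow \<epsilon>" by (auto simp: simplex_bd_def)
  show "acyclic_hom F (link \<gamma> (Pow \<epsilon>))" if "\<gamma> \<in> simplex_bd \<epsilon>" for \<gamma>
  proof -
    have g: "\<gamma> \<subset> \<epsilon>" using that by (simp add: simplex_bd_def)
    hence "\<gamma> \<subseteq> \<epsilon>" "\<epsilon> - \<gamma> \<noteq> {}" by auto
    thus ?thesis using acyclic_Pow[of "\<epsilon> - \<gamma>" F] assms by (simp add: link_Pow)
  qed
  fix \<gamma> assume "\<gamma> \<in> Pow \<epsilon> - simplex_bd \<epsilon>"
  hence "\<gamma> = \<epsilon>" by (auto simp: simplex_bd_def)
  thus "sphere_hom F (n + 2 - card \<gamma>) (link \<gamma> (Pow \<epsilon>))" "n + 2 \<le> card \<gamma> + l"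
    using assms sphere_hom_empty_face[of F] by (simp_all add: link_Pow)
qed

text \<open>Attaching the simplex \<open>\<alpha> \<union> \<beta>\<close> to a ball realises the move on its boundary. The face \<open>\<beta>\<close>
is not yet present because it is too small to be interior. The faces of the boundary that become
interior are those containing \<open>\<alpha>\<close>; their acyclic links are closed up to spheres by one face.\<close>

lemma filling_ball_flip:
  assumes ball: "filling_ball F n l \<Delta> X" and flip: "flip X Y \<alpha> \<beta>"
    and card: "card \<alpha> + card \<beta> = n + 2" "card \<beta> \<le> l" and l: "2 * l \<le> n"
  shows "filling_ball F n l (\<Delta> \<union> {\<beta>..\<alpha> \<union> \<beta>}) Y"
proof -
  let ?\<epsilon> = "\<alpha> \<union> \<beta>"
  let ?\<Delta> = "\<Delta> \<union> {\<beta>..?\<epsilon>}"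
  note f = flip_facts[OF flip]
  have \<Delta>: "scomplex \<Delta>" "pure_of_size (n + 2) \<Delta>" "X \<subseteq> \<Delta>"
    and bd: "\<And>\<gamma>. \<gamma> \<in> X \<Longrightarrow> acyclic_hom F (link \<gamma> \<Delta>)"
    and int: "\<And>\<gamma>. \<gamma> \<in> \<Delta> \<Longrightarrow> \<gamma> \<notin> X \<Longrightarrow> sphere_hom F (n + 2 - card \<gamma>) (link \<gamma> \<Delta>)"
    and int_card: "\<And>\<gamma>. \<gamma> \<in> \<Delta> \<Longrightarrow> \<gamma> \<notin> X \<Longrightarrow> n + 2 \<le> card \<gamma> + l"
    using ball by (auto simp: filling_ball_def)
  have fin: "finite ?\<epsilon>" and card\<epsilon>: "card ?\<epsilon> = n + 2" using f card by (auto simp: card_Un_disjoint)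
  have \<beta>: "\<beta> \<notin> \<Delta>"
  proof
    assume "\<beta> \<in> \<Delta>"
    moreover have "\<beta> \<notin> X" using f(8)[of \<beta>] by auto
    ultimately show False using int_card[of \<beta>] card l by simp
  qed
  have fill: "fillable \<Delta> \<beta> ?\<epsilon>"
    unfolding fillable_def using \<Delta> fin \<beta> f(10) by auto
  have no\<beta>: "\<not> \<beta> \<subseteq> \<gamma>" if "\<gamma> \<in> \<Delta>" for \<gamma> using \<beta> scomplex_subset[OF \<Delta>(1) that] by blast
  have new_link: "link \<gamma> ?\<Delta> = Pow (?\<epsilon> - \<gamma>)" if "\<gamma> \<notin> \<Delta>" "\<gamma> \<in> {\<beta>..?\<epsilon>}" for \<gamma>
  proof (intro equalityI subsetI)
    fix \<tau> assume "\<tau> \<in> link \<gamma> ?\<Delta>"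
    hence t: "\<gamma> \<inter> \<tau> = {}" "\<gamma> \<union> \<tau> \<in> ?\<Delta>" by (auto simp: link_def)
    have "\<gamma> \<union> \<tau> \<notin> \<Delta>" using that(1) scomplex_subset[OF \<Delta>(1), of "\<gamma> \<union> \<tau>" \<gamma>] by auto
    thus "\<tau> \<in> Pow (?\<epsilon> - \<gamma>)" using t by auto
  next
    fix \<tau> assume "\<tau> \<in> Pow (?\<epsilon> - \<gamma>)"
    thus "\<tau> \<in> link \<gamma> ?\<Delta>" using that(2) unfolding link_def by auto
  qed
  have Y_acyclic: "acyclic_hom F (link \<gamma> ?\<Delta>)" if \<gamma>: "\<gamma> \<in> Y" for \<gamma>
  proof (cases "\<gamma> \<in> \<Delta>")
    case True
    hence "\<gamma> \<in> X" using f(12)[of \<gamma>] \<gamma> no\<beta> by auto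
    moreover have "\<not> ?\<epsilon> \<subseteq> \<beta> \<union> \<gamma>" using f(5) f(9)[OF \<gamma>] by blast
    ultimately show ?thesis using bd by (simp add: acyclic_hom_def red_hom_link_fill[OF fill True])
  next
    case False
    hence g: "\<gamma> \<in> {\<beta>..?\<epsilon>}" using f(12)[of \<gamma>] \<gamma> \<Delta>(3) by blast
    have "?\<epsilon> - \<gamma> \<noteq> {}" using f(9)[OF \<gamma>] by blast
    thus ?thesis unfolding new_link[OF False g] using fin by (intro acyclic_Pow) auto
  qed
  have interior: "sphere_hom F (n + 2 - card \<gamma>) (link \<gamma> ?\<Delta>) \<and> n + 2 \<le> card \<gamma> + l"
    if \<gamma>: "\<gamma> \<in> ?\<Delta>" "\<gamma> \<notin> Y" for \<gamma>
  proof -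
    have fing: "finite \<gamma>" using scomplex_fill[OF fill] \<gamma>(1) by (rule scomplex_finite_face)
    consider "\<gamma> \<in> \<Delta>" "\<gamma> \<notin> X" | "\<gamma> \<in> X" | "\<gamma> \<notin> \<Delta>" "\<gamma> \<in> {\<beta>..?\<epsilon>}" using \<gamma>(1) by blast
    thus ?thesis
    proof cases
      case 1
      have "\<not> \<gamma> \<subseteq> ?\<epsilon>"
      proof
        assume sub: "\<gamma> \<subseteq> ?\<epsilon>"
        obtain v where v: "v \<in> \<beta>" "v \<notin> \<gamma>" using no\<beta>[OF 1(1)] by blast
        have "\<gamma> \<subseteq> ?\<epsilon> - {v}" using sub v by blast
        thus False using scomplex_subset[OF f(1) f(10)[OF v(1)]] 1(2) by blast
      qed
      thus ?thesis using int[OF 1] int_card[OF 1] by (simp add: link_fill)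
    next
      case 2
      have g: "\<alpha> \<subseteq> \<gamma>" "\<gamma> \<subseteq> ?\<epsilon>" using f(12)[of \<gamma>] 2 \<gamma>(2) by auto
      have eq: "\<beta> - \<gamma> = ?\<epsilon> - \<gamma>" using g by blast
      have ne: "\<beta> - \<gamma> \<noteq> {}" using f(8)[OF 2] by blast
      have L: "link \<gamma> ?\<Delta> = insert (\<beta> - \<gamma>) (link \<gamma> \<Delta>)" using g eq by (simp add: link_fill)
      have in\<Delta>: "\<gamma> \<in> \<Delta>" using 2 \<Delta> by blast
      have "\<beta> - \<gamma> \<notin> link \<gamma> \<Delta>" using fillable_link[OF fill in\<Delta> g(2)] by (simp add: fillable_def)
      moreover have "scomplex (link \<gamma> ?\<Delta>)" by (rule scomplex_link[OF scomplex_fill[OF fill] \<gamma>(1)])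
      ultimately have "sphere_hom F (card (\<beta> - \<gamma>)) (link \<gamma> ?\<Delta>)"
        using sphere_attach_acyclic[of "\<beta> - \<gamma>" "link \<gamma> \<Delta>" F] bd[OF 2] ne L by simp
      moreover have "card (\<beta> - \<gamma>) = n + 2 - card \<gamma>"
        unfolding eq using g(2) fing card\<epsilon> by (simp add: card_Diff_subset)
      moreover have "n + 2 \<le> card \<gamma> + l" using card_mono[OF fing g(1)] card by simp
      ultimately show ?thesis by simp
    next
      case 3
      have "\<alpha> \<subseteq> \<gamma>" using f(12)[of \<gamma>] 3 \<gamma>(2) by auto
      hence "\<gamma> = ?\<epsilon>" using 3(2) by auto
      thus ?thesis using new_link[OF 3] card\<epsilon> sphere_hom_empty_face[of F] by simp
    qed
  qed
  have "pure_of_size (n + 2) ?\<Delta>"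
    unfolding pure_of_size_def
  proof
    fix \<gamma> assume "\<gamma> \<in> ?\<Delta>"
    thus "card \<gamma> \<le> n + 2 \<and> (\<exists>\<delta>\<in>?\<Delta>. \<gamma> \<subseteq> \<delta> \<and> card \<delta> = n + 2)"
    proof
      assume "\<gamma> \<in> \<Delta>"
      thus ?thesis using \<Delta>(2) unfolding pure_of_size_def by blast
    next
      assume "\<gamma> \<in> {\<beta>..?\<epsilon>}"
      hence "\<gamma> \<subseteq> ?\<epsilon>" "?\<epsilon> \<in> ?\<Delta>" by auto
      thus ?thesis using card\<epsilon> card_mono[OF fin, of \<gamma>] by auto
    qed
  qed
  moreover have "Y \<subseteq> ?\<Delta>" using f(12) \<Delta>(3) by blast
  ultimately show ?thesis
    unfolding filling_ball_def using scomplex_fill[OF fill] Y_acyclic interior by blast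
qed

lemma flip_sphere_filling_ball:
  assumes "flip_sphere n l S" "2 * l \<le> n"
  shows "\<exists>\<Delta>. filling_ball F n l \<Delta> S"
  using assms
proof (induction rule: flip_sphere.induct)
  case (simplex \<epsilon>)
  thus ?case using filling_ball_simplex by blast
next
  case (flip X Y \<alpha> \<beta>)
  thus ?case using filling_ball_flip by blast
qed

lemma flip_sphere_stacked:
  fixes S :: "'a::linorder set set" and F :: "'f::field itself"
  assumes S: "flip_sphere n l S" and l: "2 * l \<le> n"
  shows "stacked_sphere F (int n) l S"
proof -
  obtain \<Delta> where "filling_ball F n l \<Delta> S" using flip_sphere_filling_ball[OF assms] by blast
  hence \<Delta>: "scomplex \<Delta>" "pure_of_size (n + 2) \<Delta>" "S \<subseteq> \<Delta>"
    and bd: "\<And>\<gamma>. \<gamma> \<in> S \<Longrightarrow> acyclic_hom F (link \<gamma> \<Delta>)"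
    and int: "\<And>\<gamma>. \<gamma> \<in> \<Delta> \<Longrightarrow> \<gamma> \<notin> S \<Longrightarrow> sphere_hom F (n + 2 - card \<gamma>) (link \<gamma> \<Delta>)"
    and int_card: "\<And>\<gamma>. \<gamma> \<in> \<Delta> \<Longrightarrow> \<gamma> \<notin> S \<Longrightarrow> n + 2 \<le> card \<gamma> + l"
    by (auto simp: filling_ball_def)
  have sphere: "homology_sphere F (int n) S" using S by (rule flip_sphere_homology_sphere)
  have empty: "{} \<in> S" using flip_sphere_links[OF S, of F] by (simp add: scomplex_def)
  have point: "homology_of_point F (link \<gamma> \<Delta>)" if "\<gamma> \<in> S" for \<gamma>
    using acyclic_hom_imp[OF scomplex_link[OF \<Delta>(1)] bd[OF that]] that \<Delta>(3) by blast
  have not_point: "\<not> homology_of_point F (link \<gamma> \<Delta>)"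
    and sph: "homology_of_sphere F (int n + 1 - int (card \<gamma>)) (link \<gamma> \<Delta>)" if "\<gamma> \<in> \<Delta>" "\<gamma> \<notin> S" for \<gamma>
  proof -
    have eq: "int (n + 2 - card \<gamma>) - 1 = int n + 1 - int (card \<gamma>)"
      using \<Delta>(2) that by (auto simp: pure_of_size_def of_nat_diff)
    thus "\<not> homology_of_point F (link \<gamma> \<Delta>)" "homology_of_sphere F (int n + 1 - int (card \<gamma>)) (link \<gamma> \<Delta>)"
      using sphere_not_point[OF scomplex_link[OF \<Delta>(1) that(1)] int[OF that]]
        sphere_hom_imp[OF scomplex_link[OF \<Delta>(1) that(1)] int[OF that]] by (simp_all only: eq not_False_eq_True)
  qed
  have bd_eq: "mfd_boundary F \<Delta> = S"
    unfolding mfd_boundary_def using point not_point empty \<Delta>(3) by blast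
  have "homology_mfd_links F (int n + 1) \<Delta>"
    unfolding homology_mfd_links_def using \<Delta>(1) cdim_pure_of_size[OF \<Delta>(1,2)] point sph by auto
  hence "homology_ball F (int n + 1) \<Delta>"
    using point[OF empty] sphere bd_eq
    by (simp add: homology_ball_def homology_manifold_def homology_sphere_def)
  moreover have "skel (int n - int l) \<Delta> = skel (int n - int l) S"
    using \<Delta>(3) int_card by (force simp: skel_def face_dim_def)
  ultimately show ?thesis unfolding stacked_sphere_def using sphere bd_eq l by auto
qed

section \<open>Vanishing of a g-number for stacked spheres\<close>

text \<open>The left side is a polynomial in \<open>x\<close> of degree \<open>k\<close>, expanded in the basis of binomial
coefficients. It is inclusion-exclusion for \<open>k\<close>-subsets of an \<open>N\<close>-set that avoid a given
\<open>x\<close>-subset.\<close>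

lemma binomial_complement_expansion:
  assumes "x \<le> N"
  shows "int ((N - x) choose k) = (\<Sum>s\<le>k. (-1) ^ s * int (x choose s) * int ((N - s) choose (k - s)))"
  using assms
proof (induction x arbitrary: N k)
  case 0
  have "(\<Sum>s\<le>k. (-1) ^ s * int (0 choose s) * int ((N - s) choose (k - s)))
      = (\<Sum>s\<le>k. if s = 0 then int (N choose k) else 0)"
    by (intro sum.cong refl) (auto simp: gr0_conv_Suc)
  thus ?case by simp
next
  case (Suc x)
  then obtain N' where N: "N = Suc N'" "x \<le> N'" by (cases N) auto
  show ?case
  proof (cases k)
    case 0 thus ?thesis by simp
  next
    case (Suc k')
    let ?t = "\<lambda>x N k s. (-1) ^ s * int (x choose s) * int ((N - s) choose (k - s))"
    have "(\<Sum>s\<le>k. ?t (Suc x) N k s) = ?t (Suc x) N k 0 + (\<Sum>s\<le>k'. ?t (Suc x) N k (Suc s))"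
      unfolding Suc by (rule sum.atMost_Suc_shift)
    also have "(\<Sum>s\<le>k'. ?t (Suc x) N k (Suc s)) = (\<Sum>s\<le>k'. ?t x N k (Suc s) - ?t x N' k' s)"
      by (intro sum.cong refl) (simp add: Suc N algebra_simps)
    also have "\<dots> = (\<Sum>s\<le>k'. ?t x N k (Suc s)) - (\<Sum>s\<le>k'. ?t x N' k' s)" by (rule sum_subtractf)
    also have "?t (Suc x) N k 0 + ((\<Sum>s\<le>k'. ?t x N k (Suc s)) - (\<Sum>s\<le>k'. ?t x N' k' s))
        = (\<Sum>s\<le>k. ?t x N k s) - (\<Sum>s\<le>k'. ?t x N' k' s)"
      unfolding Suc sum.atMost_Suc_shift by simp
    also have "\<dots> = int ((N - x) choose k) - int ((N' - x) choose k')"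
      using Suc.IH[of N k] Suc.IH[of N' k'] N by simp
    also have "\<dots> = int ((N - Suc x) choose k)" using N Suc by (simp add: Suc_diff_le)
    finally show ?thesis ..
  qed
qed

lemma sum_star_eq_link:
  assumes "finite \<gamma>" "finite X" "\<And>\<sigma>. \<sigma> \<in> X \<Longrightarrow> finite \<sigma>"
  shows "(\<Sum>\<tau>\<in>{\<tau>\<in>X. \<gamma> \<subseteq> \<tau>}. f (card \<tau>)) = (\<Sum>\<sigma>\<in>link \<gamma> X. f (card \<gamma> + card \<sigma>))"
proof (rule sum.reindex_bij_witness[of _ "\<lambda>\<sigma>. \<gamma> \<union> \<sigma>" "\<lambda>\<tau>. \<tau> - \<gamma>"])
  fix \<tau> assume "\<tau> \<in> {\<tau>\<in>X. \<gamma> \<subseteq> \<tau>}"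
  hence t: "\<tau> \<in> X" "\<gamma> \<subseteq> \<tau>" "finite \<tau>" using assms by auto
  have eq: "\<gamma> \<union> (\<tau> - \<gamma>) = \<tau>" using t by auto
  thus "\<gamma> \<union> (\<tau> - \<gamma>) = \<tau>" "\<tau> - \<gamma> \<in> link \<gamma> X" using t by (auto simp: link_def)
  have "card \<gamma> + card (\<tau> - \<gamma>) = card \<tau>" using t assms(1) by (simp add: card_Diff_subset card_mono)
  thus "f (card \<gamma> + card (\<tau> - \<gamma>)) = f (card \<tau>)" by simp
qed (auto simp: link_def)

text \<open>A Dehn-Sommerville argument. For every boundary face \<open>\<gamma>\<close> the Euler characteristic of its acyclic
link gives a vanishing alternating sum over the faces of the ball that contain \<open>\<gamma>\<close>. As all small
faces of a stacked ball lie in the boundary, the alternating sum over the ball of any polynomial of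
degree at most \<open>n + 1 - l\<close> in the face size vanishes, and the g-number of index \<open>l + 1\<close> is such a
sum.\<close>

lemma stacked_sphere_g_sum:
  fixes S :: "'a::linorder set set" and F :: "'f::field itself"
  assumes st: "stacked_sphere F (int n) l S" and l: "2 * l \<le> n"
  shows "g_sum (n + 2) (l + 1) S = 0"
proof -
  obtain \<Delta> where ball: "homology_ball F (int n + 1) \<Delta>" and bd: "mfd_boundary F \<Delta> = S"
    and sk: "skel (int n - int l) \<Delta> = skel (int n - int l) S"
    using st by (auto simp: stacked_sphere_def)
  have \<Delta>: "scomplex \<Delta>" and dim: "cdim \<Delta> = int n + 1" and pt: "homology_of_point F \<Delta>"
    using ball by (auto simp: homology_ball_def homology_manifold_def homology_mfd_links_def)
  have fin: "finite \<Delta>" "{} \<in> \<Delta>" using \<Delta> by (auto simp: scomplex_def)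
  have card: "card \<tau> \<le> n + 2" if "\<tau> \<in> \<Delta>" for \<tau>
  proof -
    have "face_dim \<tau> \<le> cdim \<Delta>" unfolding cdim_def using that fin by (intro Max_ge) auto
    thus ?thesis using dim by (simp add: face_dim_def)
  qed
  have S: "S \<subseteq> \<Delta>" and point: "\<And>\<gamma>. \<gamma> \<in> S \<Longrightarrow> homology_of_point F (link \<gamma> \<Delta>)"
    using bd pt fin by (auto simp: mfd_boundary_def)
  have interior: "n + 1 < card \<gamma> + l" if "\<gamma> \<in> \<Delta>" "\<gamma> \<notin> S" for \<gamma>
  proof (rule ccontr)
    assume "\<not> n + 1 < card \<gamma> + l"
    hence "\<gamma> \<in> skel (int n - int l) \<Delta>" using that by (simp add: skel_def face_dim_def)
    hence "\<gamma> \<in> skel (int n - int l) S" by (simp only: sk)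
    thus False using that by (simp add: skel_def)
  qed
  \<comment> \<open>The link of a boundary face has the homology of a point.\<close>
  have star: "(\<Sum>\<tau>\<in>{\<tau>\<in>\<Delta>. \<gamma> \<subseteq> \<tau>}. (-1) ^ card \<tau>) = (0 :: int)" if "\<gamma> \<in> S" for \<gamma>
  proof -
    have g: "\<gamma> \<in> \<Delta>" using that S by blast
    have "(\<Sum>\<tau>\<in>{\<tau>\<in>\<Delta>. \<gamma> \<subseteq> \<tau>}. (-1) ^ card \<tau>) = (\<Sum>\<sigma>\<in>link \<gamma> \<Delta>. (-1) ^ (card \<gamma> + card \<sigma>) :: int)"
      using scomplex_finite_face[OF \<Delta>] g fin by (intro sum_star_eq_link) auto
    also have "\<dots> = (-1) ^ card \<gamma> * (\<Sum>\<sigma>\<in>link \<gamma> \<Delta>. (-1) ^ card \<sigma>)"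
      by (simp add: power_add sum_distrib_left)
    also have "(\<Sum>\<sigma>\<in>link \<gamma> \<Delta>. (-1) ^ card \<sigma>) = 1 - (\<Sum>i<n + 2. (-1) ^ i * int (betti F i (link \<gamma> \<Delta>)))"
    proof (rule euler_betti[OF scomplex_link[OF \<Delta> g]])
      fix \<sigma> assume "\<sigma> \<in> link \<gamma> \<Delta>"
      hence "\<sigma> \<in> \<Delta>" using scomplex_subset[OF \<Delta>, of "\<gamma> \<union> \<sigma>" \<sigma>] by (auto simp: link_def)
      thus "card \<sigma> \<le> n + 2" by (rule card)
    qed
    also have "(\<Sum>i<n + 2. (-1) ^ i * int (betti F i (link \<gamma> \<Delta>))) = (\<Sum>i<n + 2. if i = 0 then 1 else 0)"
      using point[OF that] by (intro sum.cong refl) (simp add: homology_of_point_def)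
    also have "\<dots> = 1" by simp
    finally show ?thesis by simp
  qed
  \<comment> \<open>Double counting pairs of a face and a subface of size \<open>s\<close>, all of which lie in the boundary.\<close>
  have moment: "(\<Sum>\<tau>\<in>\<Delta>. (-1) ^ card \<tau> * int (card \<tau> choose s)) = 0" if s: "s \<le> n + 1 - l" for s
  proof -
    have sub: "\<Delta> \<inter> {\<gamma>. card \<gamma> = s} \<subseteq> S" using interior s l by fastforce
    have "(\<Sum>\<tau>\<in>\<Delta>. (-1) ^ card \<tau> * int (card \<tau> choose s))
        = (\<Sum>\<tau>\<in>\<Delta>. \<Sum>\<gamma>\<in>{\<gamma>\<in>faces s \<Delta>. \<gamma> \<subseteq> \<tau>}. (-1) ^ card \<tau>)"
    proof (intro sum.cong refl)
      fix \<tau> assume \<tau>: "\<tau> \<in> \<Delta>"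
      have "{\<gamma>\<in>faces s \<Delta>. \<gamma> \<subseteq> \<tau>} = {\<gamma>. \<gamma> \<subseteq> \<tau> \<and> card \<gamma> = s}"
        using scomplex_subset[OF \<Delta> \<tau>] by (auto simp: faces_def)
      thus "(-1) ^ card \<tau> * int (card \<tau> choose s) = (\<Sum>\<gamma>\<in>{\<gamma>\<in>faces s \<Delta>. \<gamma> \<subseteq> \<tau>}. (-1) ^ card \<tau>)"
        using n_subsets[OF scomplex_finite_face[OF \<Delta> \<tau>], of s] by simp
    qed
    also have "\<dots> = (\<Sum>\<gamma>\<in>faces s \<Delta>. \<Sum>\<tau>\<in>{\<tau>\<in>\<Delta>. \<gamma> \<subseteq> \<tau>}. (-1) ^ card \<tau>)"
      using fin by (intro sum.swap_restrict) auto
    also have "\<dots> = 0" using star sub by (intro sum.neutral) (auto simp: faces_def)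
    finally show ?thesis .
  qed
  define k where "k = n + 1 - l"
  have N: "n + 2 - (l + 1) = k" using l by (simp add: k_def)
  have "g_sum (n + 2) (l + 1) \<Delta> = (\<Sum>\<tau>\<in>\<Delta>. (-1) ^ (l + 1 + card \<tau>) *
      (\<Sum>s\<le>k. (-1) ^ s * int (card \<tau> choose s) * int ((n + 2 - s) choose (k - s))))"
    unfolding g_sum_def N by (intro sum.cong refl) (simp only: binomial_complement_expansion[OF card])
  also have "\<dots> = (\<Sum>s\<le>k. (-1) ^ (l + 1) * (-1) ^ s * int ((n + 2 - s) choose (k - s)) *
      (\<Sum>\<tau>\<in>\<Delta>. (-1) ^ card \<tau> * int (card \<tau> choose s)))"
    unfolding sum_distrib_left by (subst sum.swap) (intro sum.cong refl, simp add: power_add)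
  also have "\<dots> = 0" using moment by (intro sum.neutral) (simp add: k_def)
  finally have "g_sum (n + 2) (l + 1) \<Delta> = 0" .
  moreover have "g_sum (n + 2) (l + 1) \<Delta> = g_sum (n + 2) (l + 1) S"
    unfolding g_sum_def N
  proof (intro sum.mono_neutral_right ballI)
    fix \<gamma> assume "\<gamma> \<in> \<Delta> - S"
    hence "n + 2 - card \<gamma> < k" using interior[of \<gamma>] l by (auto simp: k_def)
    thus "(-1) ^ (l + 1 + card \<gamma>) * int ((n + 2 - card \<gamma>) choose k) = 0" by simp
  qed (use fin S in auto)
  ultimately show ?thesis by simp
qed

section \<open>Summation over the vertex links\<close>

text \<open>The local form of the theorem, for a single vertex link.\<close>

lemma flip_sphere_morse_inequality:
  fixes S :: "'a::linorder set set" and F :: "'f::field itself"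
  assumes S: "flip_sphere n ((n + 1) div 2) S" and l: "2 * l \<le> n"
  shows "weighted_morse F (verts S) l S \<le> g_bound (n + 2) l S"
    and "weighted_morse F (verts S) l S = g_bound (n + 2) l S \<longleftrightarrow> stacked_sphere F (int n) l S"
proof -
  have "scomplex S" using flip_sphere_links[OF S, of F] by blast
  hence "finite (verts S)" by (auto simp: scomplex_def verts_def)
  note alt = weighted_morse_le_g_bound[OF S l this order_refl, of F]
  show "weighted_morse F (verts S) l S \<le> g_bound (n + 2) l S" using alt by auto
  show "weighted_morse F (verts S) l S = g_bound (n + 2) l S \<longleftrightarrow> stacked_sphere F (int n) l S"
  proof
    assume "weighted_morse F (verts S) l S = g_bound (n + 2) l S"
    hence "flip_sphere n l S" using alt by auto
    thus "stacked_sphere F (int n) l S" using l by (rule flip_sphere_stacked)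
  next
    assume "stacked_sphere F (int n) l S"
    hence "g_sum (n + 2) (l + 1) S = 0" using l by (rule stacked_sphere_g_sum)
    thus "weighted_morse F (verts S) l S = g_bound (n + 2) l S" using alt by auto
  qed
qed

lemma morse_eq_red_betti:
  assumes X: "scomplex X" and l: "1 \<le> l"
  shows "morse F l X = (\<Sum>i<l. (-1) ^ (l - 1 - i) * red_betti F i X)"
proof -
  obtain l' where l': "l = Suc l'" using l by (cases l) auto
  have "(\<Sum>i<l. (-1) ^ (l - 1 - i) * red_betti F i X)
      = (\<Sum>i<Suc l'. (-1) ^ (l' - i) * red_hom F (Suc i) X + (if i = 0 then - ((-1) ^ l' * red_hom F 0 X) else 0))"
    unfolding l' by (intro sum.cong refl) (simp add: red_betti_def betti_eq_red_hom[OF X] algebra_simps)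
  also have "\<dots> = (\<Sum>i\<le>l'. (-1) ^ (l' - i) * red_hom F (Suc i) X) - (-1) ^ l' * red_hom F 0 X"
    by (simp add: sum.distrib lessThan_Suc_atMost)
  also have "\<dots> = morse F l X"
    unfolding morse_def l' by (subst sum.atMost_Suc_shift) simp
  finally show ?thesis ..
qed

lemma sigma_eq_weighted_morse:
  assumes X: "scomplex X" and l: "1 \<le> l"
  shows "(\<Sum>i<l. (-1) ^ (l - 1 - i) * sigma_number F i X) / (1 + real (face_number 0 X))
    = weighted_morse F (verts X) l X"
proof -
  have "{\<alpha> \<in> X. face_dim \<alpha> = 0} = (\<lambda>v. {v}) ` verts X"
  proof (intro equalityI subsetI)
    fix \<alpha> assume "\<alpha> \<in> {\<alpha> \<in> X. face_dim \<alpha> = 0}"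
    hence "\<alpha> \<in> X" "card \<alpha> = 1" by (auto simp: face_dim_def)
    thus "\<alpha> \<in> (\<lambda>v. {v}) ` verts X" by (auto simp: card_1_singleton_iff verts_def)
  next
    fix \<alpha> assume "\<alpha> \<in> (\<lambda>v. {v}) ` verts X"
    then obtain v \<sigma> where "\<alpha> = {v}" "v \<in> \<sigma>" "\<sigma> \<in> X" by (auto simp: verts_def)
    thus "\<alpha> \<in> {\<alpha> \<in> X. face_dim \<alpha> = 0}" using scomplex_subset[OF X, of \<sigma> "{v}"] by (simp add: face_dim_def)
  qed
  hence f0: "face_number 0 X = card (verts X)" by (simp add: face_number_def card_image)
  have "(\<Sum>i<l. (-1) ^ (l - 1 - i) * sigma_number F i X) / (1 + real (face_number 0 X))
      = (\<Sum>i<l. \<Sum>A\<in>Pow (verts X). subset_weight (verts X) A * ((-1) ^ (l - 1 - i) * of_int (red_betti F i (induced X A))))"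
    unfolding sigma_number_def sum_divide_distrib sum_distrib_left
    by (intro sum.cong refl) (simp add: f0 subset_weight_def mult_ac add.commute)
  also have "\<dots> = (\<Sum>A\<in>Pow (verts X). subset_weight (verts X) A *
      of_int (\<Sum>i<l. (-1) ^ (l - 1 - i) * red_betti F i (induced X A)))"
    by (subst sum.swap) (simp add: sum_distrib_left)
  also have "\<dots> = weighted_morse F (verts X) l X"
    unfolding weighted_morse_def morse_eq_red_betti[OF scomplex_induced[OF X] l] ..
  finally show ?thesis .
qed

text \<open>The reciprocals that make up \<open>\<mu>\<^sub>0\<close> cancel against the Kronecker terms of \<open>\<mu>\<^sub>1\<close>, which come with the
opposite sign; what is left of each link is its alternating sum of sigma-numbers.\<close>

lemma alternating_mu_sum:
  assumes X: "scomplex X" and l: "1 \<le> l"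
  shows "(\<Sum>i=0..l. (-1) ^ (l - i) * mu_number F i X)
    = (\<Sum>x\<in>verts X. weighted_morse F (verts (link {x} X)) l (link {x} X))"
proof -
  let ?L = "\<lambda>x. link {x} X"
  let ?c = "\<lambda>x. 1 + real (face_number 0 (?L x))"
  obtain l' where l': "l = Suc l'" using l by (cases l) auto
  have link: "scomplex (?L x)" if "x \<in> verts X" for x
  proof -
    obtain \<sigma> where "\<sigma> \<in> X" "x \<in> \<sigma>" using \<open>x \<in> verts X\<close> by (auto simp: verts_def)
    hence "{x} \<in> X" using scomplex_subset[OF X, of \<sigma> "{x}"] by simp
    thus ?thesis using X scomplex_link by blast
  qed
  have "(\<Sum>i=0..l. (-1) ^ (l - i) * mu_number F i X)
      = (-1) ^ l * mu_number F 0 X + (\<Sum>i\<le>l'. (-1) ^ (l' - i) * mu_number F (Suc i) X)"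
    unfolding atLeast0AtMost l' by (subst sum.atMost_Suc_shift) simp
  also have "(\<Sum>i\<le>l'. (-1) ^ (l' - i) * mu_number F (Suc i) X)
      = (\<Sum>x\<in>verts X. \<Sum>i\<le>l'. (-1) ^ (l' - i) * (((if i = 0 then 1 else 0) + sigma_number F i (?L x)) / ?c x))"
    by (subst sum.swap) (simp add: mu_number_def sum_distrib_left)
  also have "(-1) ^ l * mu_number F 0 X + \<dots>
      = (\<Sum>x\<in>verts X. (-1) ^ l / ?c x + (\<Sum>i\<le>l'. (-1) ^ (l' - i) * (((if i = 0 then 1 else 0) + sigma_number F i (?L x)) / ?c x)))"
    by (simp add: mu_number_def sum.distrib sum_distrib_left)
  also have "\<dots> = (\<Sum>x\<in>verts X. weighted_morse F (verts (?L x)) l (?L x))"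
  proof (intro sum.cong refl)
    fix x assume x: "x \<in> verts X"
    have "(\<Sum>i\<le>l'. (-1) ^ (l' - i) * (((if i = 0 then 1 else 0) + sigma_number F i (?L x)) / ?c x))
        = (\<Sum>i\<le>l'. (if i = 0 then (-1) ^ l' / ?c x else 0) + (-1) ^ (l' - i) * sigma_number F i (?L x) / ?c x)"
      by (intro sum.cong refl) (simp add: add_divide_distrib distrib_left)
    also have "\<dots> = (-1) ^ l' / ?c x + (\<Sum>i<l. (-1) ^ (l - 1 - i) * sigma_number F i (?L x)) / ?c x"
      by (simp add: sum.distrib sum_divide_distrib l' lessThan_Suc_atMost)
    finally show "(-1) ^ l / ?c x + (\<Sum>i\<le>l'. (-1) ^ (l' - i) * (((if i = 0 then 1 else 0) + sigma_number F i (?L x)) / ?c x))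
        = weighted_morse F (verts (?L x)) l (?L x)"
      using sigma_eq_weighted_morse[OF link[OF x] l, of F] by (simp add: l')
  qed
  finally show ?thesis .
qed

lemma sum_vertex_links:
  assumes X: "scomplex X"
  shows "(\<Sum>x\<in>verts X. \<Sum>\<sigma>\<in>link {x} X. f (card \<sigma> + 1)) = (\<Sum>\<tau>\<in>X. int (card \<tau>) * f (card \<tau>))"
proof -
  have fin: "finite X" "finite (verts X)" using X by (auto simp: scomplex_def verts_def)
  have "(\<Sum>x\<in>verts X. \<Sum>\<sigma>\<in>link {x} X. f (card \<sigma> + 1)) = (\<Sum>x\<in>verts X. \<Sum>\<tau>\<in>{\<tau>\<in>X. x \<in> \<tau>}. f (card \<tau>))"
  proof (rule sum.cong[OF refl])
    fix x assume "x \<in> verts X"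
    have "(\<Sum>\<tau>\<in>{\<tau>\<in>X. {x} \<subseteq> \<tau>}. f (card \<tau>)) = (\<Sum>\<sigma>\<in>link {x} X. f (card {x} + card \<sigma>))"
      using fin scomplex_finite_face[OF X] by (intro sum_star_eq_link) auto
    thus "(\<Sum>\<sigma>\<in>link {x} X. f (card \<sigma> + 1)) = (\<Sum>\<tau>\<in>{\<tau>\<in>X. x \<in> \<tau>}. f (card \<tau>))" by simp
  qed
  also have "\<dots> = (\<Sum>\<tau>\<in>X. \<Sum>x\<in>{x\<in>verts X. x \<in> \<tau>}. f (card \<tau>))"
    using fin by (intro sum.swap_restrict)
  also have "\<dots> = (\<Sum>\<tau>\<in>X. int (card \<tau>) * f (card \<tau>))"
  proof (intro sum.cong refl)
    fix \<tau> assume "\<tau> \<in> X"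
    hence "{x\<in>verts X. x \<in> \<tau>} = \<tau>" by (auto simp: verts_def)
    thus "(\<Sum>x\<in>{x\<in>verts X. x \<in> \<tau>}. f (card \<tau>)) = int (card \<tau>) * f (card \<tau>)" by simp
  qed
  finally show ?thesis .
qed

text \<open>Double counting of the pairs of a vertex and a face containing it.\<close>

lemma sum_g_sum_links:
  assumes X: "scomplex X" and card: "\<And>\<tau>. \<tau> \<in> X \<Longrightarrow> card \<tau> \<le> N + 1" and j: "j \<le> N"
  shows "(\<Sum>x\<in>verts X. g_sum N j (link {x} X))
    = int (j + 1) * g_sum (N + 1) (j + 1) X + int (N + 1 - j) * g_sum (N + 1) j X"
proof -
  have "(\<Sum>x\<in>verts X. g_sum N j (link {x} X))
      = (\<Sum>x\<in>verts X. \<Sum>\<sigma>\<in>link {x} X. (-1) ^ (j + 1 + (card \<sigma> + 1)) * int ((N + 1 - (card \<sigma> + 1)) choose (N - j)))"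
    by (simp add: g_sum_def)
  also have "\<dots> = (\<Sum>\<tau>\<in>X. int (card \<tau>) * ((-1) ^ (j + 1 + card \<tau>) * int ((N + 1 - card \<tau>) choose (N - j))))"
    by (rule sum_vertex_links[OF X])
  also have "\<dots> = (\<Sum>\<tau>\<in>X. int (j + 1) * ((-1) ^ (j + 1 + card \<tau>) * int ((N + 1 - card \<tau>) choose (N + 1 - (j + 1))))
      + int (N + 1 - j) * ((-1) ^ (j + card \<tau>) * int ((N + 1 - card \<tau>) choose (N + 1 - j))))"
  proof (intro sum.cong refl)
    fix \<tau> assume \<tau>: "\<tau> \<in> X"
    let ?m = "N + 1 - card \<tau>"
    have k: "N + 1 - j = Suc (N - j)" using j by simp
    have "Suc (N - j) * (?m choose Suc (N - j)) = (?m - (N - j)) * (?m choose (N - j))"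
      using binomial_absorb_comp[of ?m "N - j"] binomial_absorption[of "N - j" ?m]
      by (metis binomial_absorption binomial_absorb_comp diff_Suc_1)
    hence "int (N + 1 - j) * int (?m choose (N + 1 - j)) = int (?m - (N - j)) * int (?m choose (N - j))"
      unfolding k by (simp only: of_nat_mult[symmetric])
    also have "\<dots> = (int (j + 1) - int (card \<tau>)) * int (?m choose (N - j))"
    proof (cases "card \<tau> \<le> j + 1")
      case True
      hence "int (?m - (N - j)) = int (j + 1) - int (card \<tau>)" using j card[OF \<tau>] by linarith
      thus ?thesis by simp
    next
      case False
      hence "?m < N - j" using card[OF \<tau>] by linarith
      thus ?thesis by simp
    qed
    finally have abs: "int (N + 1 - j) * int (?m choose (N + 1 - j)) = (int (j + 1) - int (card \<tau>)) * int (?m choose (N - j))" .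
    have "int (j + 1) * ((-1) ^ (j + 1 + card \<tau>) * int (?m choose (N + 1 - (j + 1))))
      + int (N + 1 - j) * ((-1) ^ (j + card \<tau>) * int (?m choose (N + 1 - j)))
      = (-1) ^ (j + card \<tau>) * (int (N + 1 - j) * int (?m choose (N + 1 - j)) - int (j + 1) * int (?m choose (N - j)))"
      by (simp add: algebra_simps)
    also have "\<dots> = int (card \<tau>) * ((-1) ^ (j + 1 + card \<tau>) * int (?m choose (N - j)))"
      unfolding abs by (simp add: algebra_simps)
    finally show "int (card \<tau>) * ((-1) ^ (j + 1 + card \<tau>) * int (?m choose (N - j)))
      = int (j + 1) * ((-1) ^ (j + 1 + card \<tau>) * int (?m choose (N + 1 - (j + 1))))
      + int (N + 1 - j) * ((-1) ^ (j + card \<tau>) * int (?m choose (N + 1 - j)))" ..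
  qed
  also have "\<dots> = int (j + 1) * g_sum (N + 1) (j + 1) X + int (N + 1 - j) * g_sum (N + 1) j X"
    by (simp only: g_sum_def sum.distrib sum_distrib_left)
  finally show ?thesis .
qed

text \<open>With the beta weights, the two terms of \<open>sum_g_sum_links\<close> become consecutive quotients of a
g-number by a binomial coefficient. The alternating sum telescopes and leaves the last quotient and
\<open>g\<^sub>0 = 1\<close>.\<close>

lemma sum_g_bound_links:
  assumes X: "scomplex X" and card: "\<And>\<tau>. \<tau> \<in> X \<Longrightarrow> card \<tau> \<le> N" and l: "l < N"
  shows "(\<Sum>x\<in>verts X. g_bound N l (link {x} X))
    = (-1) ^ l + of_int (g_sum (N + 1) (l + 1) X) / real ((N + 1) choose (l + 1))"
proof -
  have card': "card \<tau> \<le> N + 1" if "\<tau> \<in> X" for \<tau> using card[OF that] by simp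
  define q where "q j = of_int (g_sum (N + 1) j X) / real ((N + 1) choose j)" for j
  have step: "(\<Sum>x\<in>verts X. of_int (g_sum N j (link {x} X)) * beta_weight j (N - j)) = q (j + 1) + q j"
    if j: "j \<le> N" for j
  proof -
    have b: "real (j + 1) * beta_weight j (N - j) = 1 / real ((N + 1) choose (j + 1))"
    proof -
      have "real (j + 1) * beta_weight j (N - j) = real (N + 2) * beta_weight (j + 1) (N + 1 - (j + 1))"
        using j by (simp add: beta_weight_def divide_simps)
      also have "\<dots> = 1 / real ((N + 1) choose (j + 1))"
        using j by (subst beta_weight_binomial) (simp_all add: divide_simps)
      finally show ?thesis .
    qed
    have b': "real (N + 1 - j) * beta_weight j (N - j) = 1 / real ((N + 1) choose j)"
    proof -
      have "N + 1 - j = Suc (N - j)" using j by simp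
      hence "real (N + 1 - j) * beta_weight j (N - j) = real (N + 2) * beta_weight j (N + 1 - j)"
        using j by (simp add: beta_weight_def divide_simps)
      also have "\<dots> = 1 / real ((N + 1) choose j)"
        using j by (subst beta_weight_binomial) (simp_all add: divide_simps)
      finally show ?thesis .
    qed
    have "(\<Sum>x\<in>verts X. of_int (g_sum N j (link {x} X)) * beta_weight j (N - j))
        = of_int (\<Sum>x\<in>verts X. g_sum N j (link {x} X)) * beta_weight j (N - j)"
      by (simp add: sum_distrib_right)
    also have "\<dots> = of_int (g_sum (N + 1) (j + 1) X) * (real (j + 1) * beta_weight j (N - j))
        + of_int (g_sum (N + 1) j X) * (real (N + 1 - j) * beta_weight j (N - j))"
    proof -
      have "(\<Sum>x\<in>verts X. g_sum N j (link {x} X))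
          = int (j + 1) * g_sum (N + 1) (j + 1) X + int (N + 1 - j) * g_sum (N + 1) j X"
        using X card' j by (rule sum_g_sum_links)
      hence "real_of_int (\<Sum>x\<in>verts X. g_sum N j (link {x} X))
          = real (j + 1) * of_int (g_sum (N + 1) (j + 1) X) + real (N + 1 - j) * of_int (g_sum (N + 1) j X)"
        by (simp only: of_int_add of_int_mult of_int_of_nat_eq)
      thus ?thesis by (simp only: distrib_left distrib_right mult_ac)
    qed
    finally show ?thesis unfolding b b' q_def by simp
  qed
  have "(\<Sum>x\<in>verts X. g_bound N l (link {x} X))
      = (\<Sum>j\<le>l. (-1) ^ (l - j) * (\<Sum>x\<in>verts X. of_int (g_sum N j (link {x} X)) * beta_weight j (N - j)))"
    unfolding g_bound_def sum_distrib_left by (subst sum.swap) (simp add: mult.assoc)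
  also have "\<dots> = (\<Sum>j\<le>l. (-1) ^ (l - j) * (q (j + 1) + q j))"
  proof (rule sum.cong[OF refl])
    fix j assume "j \<in> {..l}"
    hence "j \<le> N" using l by simp
    thus "(-1) ^ (l - j) * (\<Sum>x\<in>verts X. of_int (g_sum N j (link {x} X)) * beta_weight j (N - j))
        = (-1) ^ (l - j) * (q (j + 1) + q j)" by (simp only: step)
  qed
  also have "\<dots> = (-1) ^ l * q 0 + q (l + 1)"
  proof (induction l)
    case (Suc l)
    have "(\<Sum>j\<le>Suc l. (-1) ^ (Suc l - j) * (q (j + 1) + q j))
        = (\<Sum>j\<le>l. - ((-1) ^ (l - j) * (q (j + 1) + q j))) + (q (Suc l + 1) + q (Suc l))"
      by (simp add: Suc_diff_le)
    thus ?case using Suc by (simp add: sum_negf)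
  qed simp
  also have "q 0 = 1"
  proof -
    have "g_sum (N + 1) 0 X = (\<Sum>\<tau>\<in>X. if \<tau> = {} then 1 else 0)"
      unfolding g_sum_def
    proof (intro sum.cong refl)
      fix \<tau> assume \<tau>: "\<tau> \<in> X"
      show "(-1) ^ (0 + card \<tau>) * int ((N + 1 - card \<tau>) choose (N + 1 - 0)) = (if \<tau> = {} then 1 else 0)"
        using scomplex_finite_face[OF X \<tau>] by (cases "\<tau> = {}") (simp_all add: card_gt_0_iff)
    qed
    also have "\<dots> = 1" using X by (simp add: scomplex_def)
    finally show ?thesis by (simp add: q_def)
  qed
  finally show ?thesis by (simp add: q_def)
qed

lemma link_link: "x \<in> \<gamma> \<Longrightarrow> link \<gamma> M = link (\<gamma> - {x}) (link {x} M)"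
proof -
  assume x: "x \<in> \<gamma>"
  have eq: "{x} \<union> ((\<gamma> - {x}) \<union> \<sigma>) = \<gamma> \<union> \<sigma>" for \<sigma> using x by blast
  show ?thesis unfolding link_def mem_Collect_eq eq using x by blast
qed

theorem theorem1p9:
  fixes F :: "'f::field itself" and M :: "'a::linorder set set" and d l :: nat
  assumes "locally_tame_manifold (int d) M"
    and "1 \<le> l" and "real l \<le> (real d - 1) / 2"
  shows "(\<Sum>i=0..l. (-1) ^ (l - i) * mu_number F i M)
           \<le> (-1) ^ l + real_of_int (g_number (l + 1) M) / real ((d + 2) choose (l + 1))
       \<and> ((\<Sum>i=0..l. (-1) ^ (l - i) * mu_number F i M)
             = (-1) ^ l + real_of_int (g_number (l + 1) M) / real ((d + 2) choose (l + 1))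
          \<longleftrightarrow> locally_stacked F l M)"
proof -
  have M: "scomplex M" and dim: "cdim M = int d"
    and tame: "\<And>x. x \<in> verts M \<Longrightarrow> tame_sphere (int d - 1) (link {x} M)"
    using assms(1) by (auto simp: locally_tame_manifold_def)
  obtain n where n: "d = Suc n" "2 * l \<le> n"
  proof (rule that[of "d - 1"])
    have "2 * real l + 1 \<le> real d" using assms(3) by (simp add: field_simps)
    hence "2 * l + 1 \<le> d" by linarith
    thus "d = Suc (d - 1)" "2 * l \<le> d - 1" by simp_all
  qed
  have fin: "finite M" "finite (verts M)" using M by (auto simp: scomplex_def verts_def)
  have vertex: "{x} \<in> M" if "x \<in> verts M" for x
    using that scomplex_subset[OF M, of _ "{x}"] by (auto simp: verts_def)
  let ?L = "\<lambda>x. link {x} M"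
  have sphere: "flip_sphere n ((n + 1) div 2) (?L x)" if "x \<in> verts M" for x
    using tame_sphere_flip_sphere[of n "?L x"] tame[OF that] scomplex_link[OF M vertex[OF that]] n by simp
  note L = flip_sphere_links[OF sphere, of _ F]
  have card: "card \<tau> \<le> n + 2" if "\<tau> \<in> M" for \<tau>
  proof -
    have "face_dim \<tau> \<le> cdim M" unfolding cdim_def using that fin by (intro Max_ge) auto
    thus ?thesis using dim n by (simp add: face_dim_def)
  qed
  have mfd: "homology_manifold F (cdim M) M"
  proof -
    have face: "\<gamma> - {x} \<in> ?L x" "x \<in> verts M" "card \<gamma> = Suc (card (\<gamma> - {x}))" if "\<gamma> \<in> M" "x \<in> \<gamma>" for \<gamma> x
      using that scomplex_finite_face[OF M that(1)] card.remove[of \<gamma> x]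
      by (auto simp: link_def insert_absorb verts_def)
    have up: "\<exists>\<delta>\<in>M. \<gamma> \<subseteq> \<delta> \<and> card \<delta> = n + 2" if \<gamma>: "\<gamma> \<in> M" "x \<in> \<gamma>" for \<gamma> x
    proof -
      obtain \<delta> where d: "\<delta> \<in> ?L x" "\<gamma> - {x} \<subseteq> \<delta>" "card \<delta> = n + 1"
        using L[OF face(2)[OF \<gamma>]] face(1)[OF \<gamma>] unfolding pure_of_size_def by blast
      have "insert x \<delta> \<in> M" "x \<notin> \<delta>" using d(1) by (auto simp: link_def)
      moreover have "finite \<delta>" using d(3) card.infinite by fastforce
      ultimately show ?thesis using d by (intro bexI[of _ "insert x \<delta>"]) auto
    qed
    have "pure_of_size (d + 1) M"
      unfolding pure_of_size_def
    proof
      fix \<gamma> assume \<gamma>: "\<gamma> \<in> M"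
      have "face_dim ` M \<noteq> {}" "finite (face_dim ` M)" using \<gamma> fin by auto
      hence "cdim M \<in> face_dim ` M" unfolding cdim_def by (rule Max_in[rotated])
      then obtain \<delta> where "\<delta> \<in> M" "card \<delta> = n + 2" using dim n by (auto simp: face_dim_def)
      thus "card \<gamma> \<le> d + 1 \<and> (\<exists>\<delta>\<in>M. \<gamma> \<subseteq> \<delta> \<and> card \<delta> = d + 1)"
        using card[OF \<gamma>] up[OF \<gamma>] n by (cases "\<gamma> = {}") auto
    qed
    moreover have "sphere_hom F (d + 1 - card \<gamma>) (link \<gamma> M)" if \<gamma>: "\<gamma> \<in> M" "\<gamma> \<noteq> {}" for \<gamma>
    proof -
      obtain x where x: "x \<in> \<gamma>" using \<gamma> by auto
      note f = face[OF \<gamma>(1) x]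
      have "sphere_hom F (n + 1 - card (\<gamma> - {x})) (link (\<gamma> - {x}) (?L x))" using L[OF f(2)] f(1) by blast
      thus ?thesis unfolding link_link[OF x, of M] using f(3) n by simp
    qed
    ultimately have "closed_homology_manifold F (int d) M" using M by (intro closed_homology_manifoldI)
    thus ?thesis using dim by (simp add: homology_manifold_def closed_homology_manifold_def)
  qed
  have le: "weighted_morse F (verts (?L x)) l (?L x) \<le> g_bound (n + 2) l (?L x)"
    and eq: "weighted_morse F (verts (?L x)) l (?L x) = g_bound (n + 2) l (?L x) \<longleftrightarrow> stacked_sphere F (int n) l (?L x)"
    if "x \<in> verts M" for x
    using flip_sphere_morse_inequality[OF sphere[OF that] n(2), of F] by auto
  have lhs: "(\<Sum>i=0..l. (-1) ^ (l - i) * mu_number F i M)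
      = (\<Sum>x\<in>verts M. weighted_morse F (verts (?L x)) l (?L x))"
    by (rule alternating_mu_sum[OF M assms(2)])
  have "g_number (l + 1) M = g_sum (n + 3) (l + 1) M"
  proof (rule g_number_eq_g_sum[OF M])
    show "card \<gamma> \<le> n + 3" if "\<gamma> \<in> M" for \<gamma> using card[OF that] by simp
  qed (use dim n in auto)
  hence rhs: "(-1) ^ l + real_of_int (g_number (l + 1) M) / real ((d + 2) choose (l + 1))
      = (\<Sum>x\<in>verts M. g_bound (n + 2) l (?L x))"
    using sum_g_bound_links[OF M card, of l] n by (simp add: numeral_3_eq_3)
  have "(\<Sum>x\<in>verts M. weighted_morse F (verts (?L x)) l (?L x)) = (\<Sum>x\<in>verts M. g_bound (n + 2) l (?L x))
      \<longleftrightarrow> (\<forall>x\<in>verts M. weighted_morse F (verts (?L x)) l (?L x) = g_bound (n + 2) l (?L x))"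
    (is "?A = ?B \<longleftrightarrow> ?C")
  proof
    assume "?A = ?B"
    hence "(\<Sum>x\<in>verts M. g_bound (n + 2) l (?L x) - weighted_morse F (verts (?L x)) l (?L x)) = 0"
      by (simp add: sum_subtractf)
    hence "\<forall>x\<in>verts M. g_bound (n + 2) l (?L x) - weighted_morse F (verts (?L x)) l (?L x) = 0"
      using fin le by (subst (asm) sum_nonneg_eq_0_iff) auto
    thus ?C by auto
  qed auto
  also have "\<dots> \<longleftrightarrow> locally_stacked F l M"
    using eq mfd dim n by (simp add: locally_stacked_def)
  finally show ?thesis unfolding lhs rhs using le by (auto intro: sum_mono)
qed

end
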